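(* Let $(A,\alpha)$ be a unital C*-dynamical system (of multiplicity $d$). Then the mapping $\tau\mapsto\varphi_\tau$ with $$\varphi_\tau(S_\mu a S_\nu^* )=\begin{cases}\tau(a) & \text{for } \mu=\emptyset=\nu,\\ 0 & \text{otherwise},\end{cases}\qquad a\in A,\ \mu,\nu\in\mathbb{F}_+^d,$$ is an affine weak*-homeomorphism from the simplex of the states in $S(A)$ (respectively, the tracial states in $T(A)$) that vanish on $J_{(A,\alpha)}=(\bigcap_{i=1}^d\ker\alpha_i)^\perp$ onto the simplex of the ground states (respectively, the KMS$_\infty$ states) on $\mathcal{O}(A,\alpha)$.
   Context: A unital C*-dynamical system $(A,\alpha)$ of multiplicity $d$ (with $1 \le d < \infty$) consists of a unital C*-algebra $A$ and $d$ unital $*$-endomorphisms $\alpha_1,\dots,\alpha_d$ of $A$. $\mathbb{F}_+^d$ is the free semigroup (monoid) of words on $d$ symbols, with empty word $\emptyset$. $S(A)$ is the state space and $T(A)$ the tracial state space of $A$. For an ideal $I$ of $A$, $I^\perp=\{a\in A: ab=0\text{ for all }b\in I\}$, and $J_{(A,\alpha)}:=(\bigcap_{i=1}^d\ker\alpha_i)^\perp$. $\mathcal{O}(A,\alpha)$ (the Cuntz-Pimsner algebra) is the universal C*-algebra generated by $A$ and elements $S_1,\dots,S_d$ such that $[S_1,\dots,S_d]$ is a row isometry ($S_i^*S_j=\delta_{i,j}1$), $aS_i=S_i\alpha_i(a)$ for all $a\in A$, $i=1,\dots,d$, and $a(1-\sum_{i=1}^dS_iS_i^* )=0$ for all $a\in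 J_{(A,\alpha)}$. The algebra $A$ embeds in it isometrically and the unit of $A$ is its unit. For $\mu=\mu_n\cdots\mu_1$ write $S_\mu=S_{\mu_n}\cdots S_{\mu_1}$, with $S_\emptyset=1$; the elements $S_\mu aS_\nu^*$ span a dense $*$-subalgebra. The gauge action satisfies $\gamma_z(a)=a$, $\gamma_z(S_i)=zS_i$ for $z\in\mathbb{T}$, and $\sigma:\mathbb{R}\to\mathrm{Aut}(\mathcal{O}(A,\alpha))$ is $\sigma_t=\gamma_{e^{it}}$. For $\beta\in\mathbb{R}$, a state $\psi$ on a C*-algebra $B$ with an action $\sigma$ of $\mathbb{R}$ is a $(\sigma,\beta)$-KMS state if $\psi(xy)=\psi(y\sigma_{i\beta}(x))$ for all $x,y$ in a norm-dense $\sigma$-invariant $*$-subalgebra of the analytic elements of $B$ (elements $x$ for which $t\mapsto\sigma_t(x)$ extends to an entire function $z\mapsto\sigma_z(x)$). A state is a KMS$_\infty$ state if it is a weak*-limit of $(\sigma,\beta)$-KMS states as $\beta\to\infty$. A state $\psi$ is a ground state if $z\mapsto\psi(x\sigma_z(y))$ is bounded on $\{z\in\mathbb{C}:\mathrm{Im}\,z>0\}$ for all $x,y$ in a dense analytic subset (here: the span of the elements $S_\mu aS_\nu^*$). *)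

theory Defs
  imports "HOL-Analysis.Analysis" "HOL-Library.Poly_Mapping"
begin

section \<open>Unital C*-algebras\<close>

class scaleC =
  fixes scaleC :: "complex \<Rightarrow> 'a \<Rightarrow> 'a" (infixr \<open>*\<^sub>C\<close> 75)

text \<open>Nonzero unital complex C*-algebras.  The complex scalar multiplication extends the real one
  of the library class \<^class>\<open>real_normed_algebra_1\<close>, which also provides \<open>0 \<noteq> 1\<close>.\<close>

class cstar_algebra = real_normed_algebra_1 + banach + scaleC +
  fixes star :: "'a \<Rightarrow> 'a"
  assumes scaleC_of_real: "complex_of_real r *\<^sub>C x = r *\<^sub>R x"
    and scaleC_add_right: "c *\<^sub>C (x + y) = c *\<^sub>C x + c *\<^sub>C y"
    and scaleC_add_left: "(c + d) *\<^sub>C x = c *\<^sub>C x + d *\<^sub>C x"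
    and scaleC_scaleC: "c *\<^sub>C d *\<^sub>C x = (c * d) *\<^sub>C x"
    and mult_scaleC_left: "(c *\<^sub>C x) * y = c *\<^sub>C (x * y)"
    and mult_scaleC_right: "x * (c *\<^sub>C y) = c *\<^sub>C (x * y)"
    and norm_scaleC: "norm (c *\<^sub>C x) = cmod c * norm x"
    and star_star: "star (star x) = x"
    and star_add: "star (x + y) = star x + star y"
    and star_scaleC: "star (c *\<^sub>C x) = cnj c *\<^sub>C star x"
    and star_mult: "star (x * y) = star y * star x"
    and cstar_identity: "norm (star x * x) = (norm x)\<^sup>2"

lemma scaleC_one: "1 *\<^sub>C (x::'a::cstar_algebra) = x"
  using scaleC_of_real[of 1 x] by simp

lemma module_scaleC: "module (scaleC :: complex \<Rightarrow> 'a::cstar_algebra \<Rightarrow> 'a)"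
  by unfold_locales (simp_all add: scaleC_add_right scaleC_add_left scaleC_scaleC scaleC_one)

definition unital_star_hom :: "('a::cstar_algebra \<Rightarrow> 'b::cstar_algebra) \<Rightarrow> bool" where
  "unital_star_hom h \<longleftrightarrow>
     (\<forall>x y. h (x + y) = h x + h y) \<and> (\<forall>c x. h (c *\<^sub>C x) = c *\<^sub>C h x) \<and>
     (\<forall>x y. h (x * y) = h x * h y) \<and> (\<forall>x. h (star x) = star (h x)) \<and> h 1 = 1"

section \<open>States\<close>

definition states :: "('a::cstar_algebra \<Rightarrow> complex) set" where
  "states = {\<phi>. (\<forall>x y. \<phi> (x + y) = \<phi> x + \<phi> y) \<and> (\<forall>c x. \<phi> (c *\<^sub>C x) = c * \<phi> x) \<and>
                (\<forall>x. \<phi> (star x * x) \<in> \<real>\<^sub>\<ge>\<^sub>0) \<and> \<phi> 1 = 1}"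

definition tracial_states :: "('a::cstar_algebra \<Rightarrow> complex) set" where
  "tracial_states = {\<phi> \<in> states. \<forall>x y. \<phi> (x * y) = \<phi> (y * x)}"

text \<open>The topology of pointwise convergence; it induces the weak*-topology on sets of states.\<close>

definition weak_star :: "('a \<Rightarrow> complex) topology" where
  "weak_star = product_topology (\<lambda>_. euclidean) UNIV"

definition mix :: "real \<Rightarrow> ('a \<Rightarrow> complex) \<Rightarrow> ('a \<Rightarrow> complex) \<Rightarrow> 'a \<Rightarrow> complex" where
  "mix s \<phi> \<psi> = (\<lambda>x. of_real s * \<phi> x + of_real (1 - s) * \<psi> x)"

definition compact_convex :: "('a \<Rightarrow> complex) set \<Rightarrow> bool" where
  "compact_convex X \<longleftrightarrow> compactin weak_star X \<and> (\<forall>\<phi>\<in>X. \<forall>\<psi>\<in>X. \<forall>s\<in>{0..1}. mix s \<phi> \<psi> \<in> X)"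

definition affine_weak_star_homeomorphism ::
    "('a \<Rightarrow> complex) set \<Rightarrow> ('b \<Rightarrow> complex) set \<Rightarrow> (('a \<Rightarrow> complex) \<Rightarrow> 'b \<Rightarrow> complex) \<Rightarrow> bool" where
  "affine_weak_star_homeomorphism X Y \<Phi> \<longleftrightarrow>
     homeomorphic_map (subtopology weak_star X) (subtopology weak_star Y) \<Phi> \<and>
     (\<forall>\<sigma>\<in>X. \<forall>\<tau>\<in>X. \<forall>s\<in>{0..1}. \<Phi> (mix s \<sigma> \<tau>) = mix s (\<Phi> \<sigma>) (\<Phi> \<tau>))"

definition vanishing_on :: "'a set \<Rightarrow> ('a \<Rightarrow> complex) set \<Rightarrow> ('a \<Rightarrow> complex) set" where
  "vanishing_on J X = {\<tau> \<in> X. \<forall>a\<in>J. \<tau> a = 0}"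

section \<open>Dynamical systems and covariant representations\<close>

text \<open>A system of multiplicity \<open>d\<close> is a family of endomorphisms indexed by a finite type \<open>'n\<close> with
  \<open>d\<close> elements; in particular \<open>d \<ge> 1\<close>.\<close>

definition cstar_dynamical_system :: "('n::finite \<Rightarrow> 'a::cstar_algebra \<Rightarrow> 'a) \<Rightarrow> bool" where
  "cstar_dynamical_system \<alpha> \<longleftrightarrow> (\<forall>i. unital_star_hom (\<alpha> i))"

definition annihilator :: "'a::cstar_algebra set \<Rightarrow> 'a set" where
  "annihilator I = {a. \<forall>b\<in>I. a * b = 0}"

definition J_ideal :: "('n::finite \<Rightarrow> 'a::cstar_algebra \<Rightarrow> 'a) \<Rightarrow> 'a set" where
  "J_ideal \<alpha> = annihilator (\<Inter>i. {a. \<alpha> i a = 0})"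

definition covariant ::
    "('n::finite \<Rightarrow> 'a::cstar_algebra \<Rightarrow> 'a) \<Rightarrow> ('a \<Rightarrow> 'b::cstar_algebra) \<Rightarrow> ('n \<Rightarrow> 'b) \<Rightarrow> bool" where
  "covariant \<alpha> \<pi> T \<longleftrightarrow> unital_star_hom \<pi> \<and>
     (\<forall>i j. star (T i) * T j = (if i = j then 1 else 0)) \<and>
     (\<forall>a i. \<pi> a * T i = T i * \<pi> (\<alpha> i a)) \<and>
     (\<forall>a\<in>J_ideal \<alpha>. \<pi> a * (1 - (\<Sum>i\<in>UNIV. T i * star (T i))) = 0)"

section \<open>The free *-algebra on the generators\<close>

datatype ('a, 'n) generator = Coef 'a | Isom 'n

text \<open>A letter is a generator \<open>(g, False)\<close> or a formal adjoint \<open>(g, True)\<close>.  Words form a monoid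
  under concatenation; \<^typ>\<open>_ \<Rightarrow>\<^sub>0 complex\<close> over an additively written monoid is its complex monoid
  algebra.\<close>

type_synonym ('a, 'n) free_star_algebra = "(('a, 'n) generator \<times> bool) list \<Rightarrow>\<^sub>0 complex"

instantiation list :: (type) monoid_add
begin

definition zero_list :: "'a list" where "zero_list = []"
definition plus_list :: "'a list \<Rightarrow> 'a list \<Rightarrow> 'a list" where "plus_list = append"

instance
  by standard (simp_all add: zero_list_def plus_list_def)

end

definition gen :: "('a, 'n) generator \<Rightarrow> ('a, 'n) free_star_algebra" where
  "gen g = Poly_Mapping.single [(g, False)] 1"

definition free_scale :: "complex \<Rightarrow> ('a, 'n) free_star_algebra \<Rightarrow> ('a, 'n) free_star_algebra" where
  "free_scale c f = Poly_Mapping.single [] c * f"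

definition word_star :: "('g \<times> bool) list \<Rightarrow> ('g \<times> bool) list" where
  "word_star w = rev (map (\<lambda>(g, b). (g, \<not> b)) w)"

definition free_star :: "('a, 'n) free_star_algebra \<Rightarrow> ('a, 'n) free_star_algebra" where
  "free_star f = (\<Sum>w\<in>Poly_Mapping.keys f.
     Poly_Mapping.single (word_star w) (cnj (Poly_Mapping.lookup f w)))"

definition relators ::
    "('n::finite \<Rightarrow> 'a::cstar_algebra \<Rightarrow> 'a) \<Rightarrow> ('a, 'n) free_star_algebra set" where
  "relators \<alpha> =
     {gen (Coef (a + b)) - (gen (Coef a) + gen (Coef b)) | a b. True} \<union>
     {gen (Coef (c *\<^sub>C a)) - free_scale c (gen (Coef a)) | c a. True} \<union>
     {gen (Coef (a * b)) - gen (Coef a) * gen (Coef b) | a b. True} \<union>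
     {gen (Coef (star a)) - free_star (gen (Coef a)) | a. True} \<union>
     {gen (Coef 1) - 1} \<union>
     {free_star (gen (Isom i)) * gen (Isom j) - (if i = j then 1 else 0) | i j. True} \<union>
     {gen (Coef a) * gen (Isom i) - gen (Isom i) * gen (Coef (\<alpha> i a)) | a i. True} \<union>
     {gen (Coef a) * (1 - (\<Sum>i\<in>UNIV. gen (Isom i) * free_star (gen (Isom i)))) | a. a \<in> J_ideal \<alpha>}"

definition cstar_seminorm :: "(('a, 'n) free_star_algebra \<Rightarrow> real) \<Rightarrow> bool" where
  "cstar_seminorm p \<longleftrightarrow>
     (\<forall>f g. p (f + g) \<le> p f + p g) \<and> (\<forall>c f. p (free_scale c f) = cmod c * p f) \<and>
     (\<forall>f g. p (f * g) \<le> p f * p g) \<and> (\<forall>f. p (free_star f * f) = (p f)\<^sup>2)"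

fun letter_eval :: "('a \<Rightarrow> 'b) \<Rightarrow> ('n \<Rightarrow> 'b) \<Rightarrow> ('a, 'n) generator \<times> bool \<Rightarrow> 'b::cstar_algebra" where
  "letter_eval \<pi> T (Coef a, b) = (if b then star (\<pi> a) else \<pi> a)"
| "letter_eval \<pi> T (Isom i, b) = (if b then star (T i) else T i)"

definition free_eval ::
    "('a \<Rightarrow> 'b) \<Rightarrow> ('n \<Rightarrow> 'b) \<Rightarrow> ('a, 'n) free_star_algebra \<Rightarrow> 'b::cstar_algebra" where
  "free_eval \<pi> T f = (\<Sum>w\<in>Poly_Mapping.keys f.
     Poly_Mapping.lookup f w *\<^sub>C prod_list (map (letter_eval \<pi> T) w))"

section \<open>The Cuntz-Pimsner algebra\<close>

text \<open>The universal C*-algebra generated by \<open>A\<close> and \<open>S\<close> subject to the covariance relations is the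
  Hausdorff completion of the free *-algebra on the generators in the largest C*-seminorm that
  vanishes on the relators.  The predicate says that \<open>(\<iota>, S)\<close> exhibits the C*-algebra \<open>'b\<close> as such a
  completion: the evaluation map has dense range, and the norm of \<open>'b\<close> pulls back to that largest
  seminorm.  (The pulled back norm is itself an admissible seminorm, by covariance.)
  The universal property with respect to covariant representations in arbitrary C*-algebras is
  \<open>cuntz_pimsner_universal\<close> below.\<close>

definition cuntz_pimsner ::
    "('n::finite \<Rightarrow> 'a::cstar_algebra \<Rightarrow> 'a) \<Rightarrow> ('a \<Rightarrow> 'b::cstar_algebra) \<Rightarrow> ('n \<Rightarrow> 'b) \<Rightarrow> bool" where
  "cuntz_pimsner \<alpha> \<iota> S \<longleftrightarrow>
     covariant \<alpha> \<iota> S \<and>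
     closure (range (free_eval \<iota> S)) = UNIV \<and>
     (\<forall>p. cstar_seminorm p \<and> (\<forall>r\<in>relators \<alpha>. p r = 0) \<longrightarrow> (\<forall>f. p f \<le> norm (free_eval \<iota> S f)))"

lemma scaleC_zero_right [simp]: "c *\<^sub>C (0::'a::cstar_algebra) = 0"
  using norm_scaleC[of c "0::'a"] by simp

lemma scaleC_zero_left [simp]: "0 *\<^sub>C (x::'a::cstar_algebra) = 0"
  using norm_scaleC[of 0 x] by simp

lemma scaleC_minus_one: "(- 1) *\<^sub>C (x::'a::cstar_algebra) = - x"
  using scaleC_of_real[of "- 1" x] by simp

lemma scaleC_sum_right: "c *\<^sub>C (\<Sum>x\<in>A. f x) = (\<Sum>x\<in>A. c *\<^sub>C (f x::'a::cstar_algebra))"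
  by (induction A rule: infinite_finite_induct) (simp_all add: scaleC_add_right)

lemma scaleC_diff_right: "c *\<^sub>C (x - y) = c *\<^sub>C x - c *\<^sub>C (y::'a::cstar_algebra)"
  using scaleC_add_right[of c "x - y" y] by (simp add: algebra_simps)

lemma star_zero [simp]: "star (0::'a::cstar_algebra) = 0"
  using star_scaleC[of 0 "0::'a"] by simp

lemma star_sum: "star (\<Sum>x\<in>A. f x) = (\<Sum>x\<in>A. star (f x::'a::cstar_algebra))"
  by (induction A rule: infinite_finite_induct) (simp_all add: star_add)

lemma star_one [simp]: "star (1::'a::cstar_algebra) = 1"
  by (metis mult.left_neutral mult.right_neutral star_mult star_star)

lemma star_diff: "star (x - y) = star x - star (y::'a::cstar_algebra)"
  using star_add[of "x - y" y] by (simp add: algebra_simps)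

lemma norm_star: "norm (star x) = norm (x::'a::cstar_algebra)"
proof -
  have le: "norm y \<le> norm (star y)" for y :: 'a
  proof (cases "y = 0")
    case False
    have "norm y * norm y \<le> norm (star y) * norm y"
      using cstar_identity[of y] norm_mult_ineq[of "star y" y] by (simp add: power2_eq_square)
    with False show ?thesis by simp
  qed simp
  show ?thesis using le[of x] le[of "star x"] by (simp add: star_star)
qed

lemma continuous_on_star: "continuous_on X (star :: 'a::cstar_algebra \<Rightarrow> 'a)"
  by (rule continuous_onI, metis dist_norm norm_star star_diff less_imp_le)

lemma continuous_on_scaleC: "continuous_on X (\<lambda>x::'a::cstar_algebra. c *\<^sub>C x)"
proof (rule linear_continuous_on)
  show "bounded_linear (\<lambda>x::'a. c *\<^sub>C x)"
  proof (rule bounded_linear_intro[where K = "cmod c"])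
    show "c *\<^sub>C r *\<^sub>R x = r *\<^sub>R c *\<^sub>C x" for r and x :: 'a
      by (simp add: scaleC_scaleC mult.commute flip: scaleC_of_real)
  qed (simp_all add: scaleC_add_right norm_scaleC mult.commute)
qed

lemma free_eval_single:
  "free_eval \<pi> T (Poly_Mapping.single w c) = c *\<^sub>C prod_list (map (letter_eval \<pi> T) w)"
  by (cases "c = 0") (simp_all add: free_eval_def)

lemma free_eval_zero [simp]: "free_eval \<pi> T 0 = 0"
  by (simp add: free_eval_def)

lemma free_eval_add: "free_eval \<pi> T (f + g) = free_eval \<pi> T f + free_eval \<pi> T g"
  unfolding free_eval_def by (rule setsum_keys_plus_distrib) (simp_all add: scaleC_add_left)

lemma free_eval_sum: "free_eval \<pi> T (\<Sum>x\<in>A. f x) = (\<Sum>x\<in>A. free_eval \<pi> T (f x))"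
  by (induction A rule: infinite_finite_induct) (simp_all add: free_eval_add)

lemma free_eval_diff: "free_eval \<pi> T (f - g) = free_eval \<pi> T f - free_eval \<pi> T g"
  using free_eval_add[of \<pi> T "f - g" g] by (simp add: algebra_simps)

lemma free_sum_single:
  "f = (\<Sum>w\<in>Poly_Mapping.keys f. Poly_Mapping.single w (Poly_Mapping.lookup f w))"
  by (rule poly_mapping_eqI)
     (simp add: lookup_sum lookup_single when_def not_in_keys_iff_lookup_eq_zero)

lemma free_eval_single_mult:
  "free_eval \<pi> T (Poly_Mapping.single v c * Poly_Mapping.single w d) =
   free_eval \<pi> T (Poly_Mapping.single v c) * free_eval \<pi> T (Poly_Mapping.single w d)"
  by (simp add: mult_single free_eval_single plus_list_def mult_scaleC_left mult_scaleC_right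
      scaleC_scaleC mult.commute)

lemma free_eval_mult: "free_eval \<pi> T (f * g) = free_eval \<pi> T f * free_eval \<pi> T g"
proof -
  let ?s = "\<lambda>f w. Poly_Mapping.single w (Poly_Mapping.lookup f w)"
  have "free_eval \<pi> T (f * g) =
      free_eval \<pi> T ((\<Sum>v\<in>Poly_Mapping.keys f. ?s f v) * (\<Sum>w\<in>Poly_Mapping.keys g. ?s g w))"
    by (simp flip: free_sum_single)
  also have "\<dots> = (\<Sum>v\<in>Poly_Mapping.keys f. free_eval \<pi> T (?s f v)) *
      (\<Sum>w\<in>Poly_Mapping.keys g. free_eval \<pi> T (?s g w))"
    by (simp add: sum_product free_eval_sum free_eval_single_mult)
  finally show ?thesis by (simp flip: free_sum_single free_eval_sum)
qed

lemma free_eval_one [simp]: "free_eval \<pi> T 1 = 1"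
  using free_eval_single[of \<pi> T "[]" 1] by (simp add: scaleC_one zero_list_def flip: single_one)

lemma free_eval_scale: "free_eval \<pi> T (free_scale c f) = c *\<^sub>C free_eval \<pi> T f"
  by (simp add: free_scale_def free_eval_mult free_eval_single mult_scaleC_left)

lemma letter_eval_star: "letter_eval \<pi> T (g, \<not> b) = star (letter_eval \<pi> T (g, b))"
  by (cases g) (simp_all add: star_star)

lemma word_eval_star:
  "prod_list (map (letter_eval \<pi> T) (word_star w)) = star (prod_list (map (letter_eval \<pi> T) w))"
  by (induction w) (auto simp: word_star_def star_mult letter_eval_star)

lemma free_eval_star: "free_eval \<pi> T (free_star f) = star (free_eval \<pi> T f)"
proof -
  have "free_eval \<pi> T (free_star f) = (\<Sum>w\<in>Poly_Mapping.keys f.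
      star (Poly_Mapping.lookup f w *\<^sub>C prod_list (map (letter_eval \<pi> T) w)))"
    by (simp add: free_star_def free_eval_sum free_eval_single word_eval_star star_scaleC)
  then show ?thesis by (simp add: free_eval_def star_sum)
qed

lemma free_eval_gen [simp]:
  "free_eval \<pi> T (gen (Coef a)) = \<pi> a" "free_eval \<pi> T (gen (Isom i)) = T i"
  by (simp_all add: gen_def free_eval_single scaleC_one)

lemma cstar_seminorm_norm_free_eval: "cstar_seminorm (\<lambda>f. norm (free_eval \<pi> T f))"
  by (simp add: cstar_seminorm_def free_eval_add free_eval_scale free_eval_mult free_eval_star
      norm_triangle_ineq norm_scaleC norm_mult_ineq cstar_identity)

lemma covariant_free_eval_relators:
  assumes "covariant \<alpha> \<pi> T" and "r \<in> relators \<alpha>"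
  shows "free_eval \<pi> T r = 0"
  using assms
  by (auto simp: relators_def covariant_def unital_star_hom_def free_eval_diff free_eval_add
      free_eval_scale free_eval_mult free_eval_star free_eval_sum)

text \<open>The continuity clause only serves to keep the uniqueness proof short: *-homomorphisms between
  C*-algebras are automatically continuous.\<close>

theorem cuntz_pimsner_universal:
  fixes \<pi> :: "'a::cstar_algebra \<Rightarrow> 'c::cstar_algebra" and \<iota> :: "'a \<Rightarrow> 'b::cstar_algebra"
  assumes CP: "cuntz_pimsner \<alpha> \<iota> S" and cov: "covariant \<alpha> \<pi> T"
  shows "\<exists>!\<rho> :: 'b \<Rightarrow> 'c. unital_star_hom \<rho> \<and> continuous_on UNIV \<rho> \<and>
           (\<forall>a. \<rho> (\<iota> a) = \<pi> a) \<and> (\<forall>i. \<rho> (S i) = T i)"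
proof (rule ex_ex1I)
  let ?E = "free_eval \<iota> S" and ?F = "free_eval \<pi> T"
  let ?X = "range ?E"
  have dense: "closure ?X = UNIV" using CP by (simp add: cuntz_pimsner_def)
  have le: "norm (?F f) \<le> norm (?E f)" for f
  proof -
    have "\<forall>r\<in>relators \<alpha>. norm (?F r) = 0"
      using covariant_free_eval_relators[OF cov] by simp
    with CP cstar_seminorm_norm_free_eval[of \<pi> T] show ?thesis
      unfolding cuntz_pimsner_def by blast
  qed
  define \<rho>0 where "\<rho>0 x = ?F (SOME f. ?E f = x)" for x
  have \<rho>0: "\<rho>0 (?E f) = ?F f" for f
  proof -
    have "?E (SOME g. ?E g = ?E f) = ?E f" by (rule someI) simp
    then have "norm (?F ((SOME g. ?E g = ?E f) - f)) \<le> 0"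
      using le[of "(SOME g. ?E g = ?E f) - f"] by (simp add: free_eval_diff)
    then show ?thesis by (simp add: \<rho>0_def free_eval_diff)
  qed
  have "uniformly_continuous_on ?X \<rho>0"
    unfolding uniformly_continuous_on_def
  proof (intro allI impI)
    fix e :: real assume "e > 0"
    moreover have "dist (\<rho>0 x') (\<rho>0 x) \<le> dist x' x" if "x \<in> ?X" "x' \<in> ?X" for x x'
    proof -
      from that(1) obtain f where "x = ?E f" by (rule rangeE)
      moreover from that(2) obtain g where "x' = ?E g" by (rule rangeE)
      ultimately show ?thesis using le[of "g - f"] by (simp add: \<rho>0 dist_norm free_eval_diff)
    qed
    ultimately show "\<exists>d>0. \<forall>x\<in>?X. \<forall>x'\<in>?X. dist x' x < d \<longrightarrow> dist (\<rho>0 x') (\<rho>0 x) < e"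
      by (meson le_less_trans)
  qed
  then obtain \<rho> where "uniformly_continuous_on (closure ?X) \<rho>"
      and ext: "\<And>x. x \<in> ?X \<Longrightarrow> \<rho>0 x = \<rho> x"
    using uniformly_continuous_on_extension_on_closure[of ?X \<rho>0] by metis
  then have cont: "continuous_on UNIV \<rho>"
    by (simp add: dense uniformly_continuous_imp_continuous)
  have \<rho>: "\<rho> (?E f) = ?F f" for f using ext[of "?E f"] \<rho>0[of f] by simp
  have all: "P x" if "closed {x. P x}" "\<And>f. P (?E f)" for P x
    using closure_minimal[of ?X "{x. P x}"] that dense by auto
  note [continuous_intros] = continuous_on_compose2[OF cont _ subset_UNIV]
    continuous_on_compose2[OF continuous_on_star _ subset_UNIV]
    continuous_on_compose2[OF continuous_on_scaleC _ subset_UNIV]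
  have add: "\<rho> (x + y) = \<rho> x + \<rho> y" for x y
  proof (rule all[where x = x])
    show "\<rho> (?E f + y) = \<rho> (?E f) + \<rho> y" for f
      by (rule all[where x = y])
         (auto intro!: closed_Collect_eq continuous_intros simp: \<rho> simp flip: free_eval_add)
  qed (auto intro!: closed_Collect_eq continuous_intros)
  have mult: "\<rho> (x * y) = \<rho> x * \<rho> y" for x y
  proof (rule all[where x = x])
    show "\<rho> (?E f * y) = \<rho> (?E f) * \<rho> y" for f
      by (rule all[where x = y])
         (auto intro!: closed_Collect_eq continuous_intros simp: \<rho> simp flip: free_eval_mult)
  qed (auto intro!: closed_Collect_eq continuous_intros)
  have scale: "\<rho> (c *\<^sub>C x) = c *\<^sub>C \<rho> x" for c x
    by (rule all[where x = x])
       (auto intro!: closed_Collect_eq continuous_intros simp: \<rho> simp flip: free_eval_scale)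
  have star: "\<rho> (star x) = star (\<rho> x)" for x
    by (rule all[where x = x])
       (auto intro!: closed_Collect_eq continuous_intros simp: \<rho> simp flip: free_eval_star)
  have "\<rho> 1 = 1" "\<rho> (\<iota> a) = \<pi> a" "\<rho> (S i) = T i" for a i
    using \<rho>[of 1] \<rho>[of "gen (Coef a)"] \<rho>[of "gen (Isom i)"] by simp_all
  with add mult scale star cont
  show "\<exists>\<rho>. unital_star_hom \<rho> \<and> continuous_on UNIV \<rho> \<and>
          (\<forall>a. \<rho> (\<iota> a) = \<pi> a) \<and> (\<forall>i. \<rho> (S i) = T i)"
    unfolding unital_star_hom_def by blast
next
  let ?E = "free_eval \<iota> S"
  fix \<rho> \<rho>' :: "'b \<Rightarrow> 'c"
  assume 1: "unital_star_hom \<rho> \<and> continuous_on UNIV \<rho> \<and>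
      (\<forall>a. \<rho> (\<iota> a) = \<pi> a) \<and> (\<forall>i. \<rho> (S i) = T i)"
    and 2: "unital_star_hom \<rho>' \<and> continuous_on UNIV \<rho>' \<and>
      (\<forall>a. \<rho>' (\<iota> a) = \<pi> a) \<and> (\<forall>i. \<rho>' (S i) = T i)"
  have eval: "h (?E f) = free_eval \<pi> T f"
    if "unital_star_hom h" "\<forall>a. h (\<iota> a) = \<pi> a" "\<forall>i. h (S i) = T i" for h :: "'b \<Rightarrow> 'c" and f
  proof -
    have h: "h (x + y) = h x + h y" "h (x * y) = h x * h y" "h (c *\<^sub>C x) = c *\<^sub>C h x"
        "h (star x) = star (h x)" "h 1 = 1" for x y c
      using that by (auto simp: unital_star_hom_def)
    have h0: "h 0 = 0" using h(1)[of 0 0] by simp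
    have sum: "h (\<Sum>x\<in>A. u x) = (\<Sum>x\<in>A. h (u x))" for A and u :: "_ \<Rightarrow> 'b"
      by (induction A rule: infinite_finite_induct) (simp_all add: h h0)
    have letter: "h (letter_eval \<iota> S l) = letter_eval \<pi> T l" for l
      using that by (cases "(\<iota>, S, l)" rule: letter_eval.cases) (auto simp: h)
    have "h (prod_list (map (letter_eval \<iota> S) w)) = prod_list (map (letter_eval \<pi> T) w)" for w
      by (induction w) (simp_all add: h letter)
    then show ?thesis by (simp add: free_eval_def sum h)
  qed
  have "closed {x. \<rho> x = \<rho>' x}"
    using 1 2 by (intro closed_Collect_eq) auto
  moreover have "range ?E \<subseteq> {x. \<rho> x = \<rho>' x}"
    using 1 2 by (auto simp: eval)
  ultimately have "closure (range ?E) \<subseteq> {x. \<rho> x = \<rho>' x}" by (rule closure_minimal[rotated])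
  with CP show "\<rho> = \<rho>'" by (auto simp: cuntz_pimsner_def)
qed

section \<open>Gauge action, KMS states and ground states\<close>

definition gauge :: "('a \<Rightarrow> 'b::cstar_algebra) \<Rightarrow> ('n \<Rightarrow> 'b) \<Rightarrow> complex \<Rightarrow> 'b \<Rightarrow> 'b" where
  "gauge \<iota> S z = (THE g. unital_star_hom g \<and> bij g \<and>
     (\<forall>a. g (\<iota> a) = \<iota> a) \<and> (\<forall>i. g (S i) = z *\<^sub>C S i))"

definition gauge_flow :: "('a \<Rightarrow> 'b::cstar_algebra) \<Rightarrow> ('n \<Rightarrow> 'b) \<Rightarrow> real \<Rightarrow> 'b \<Rightarrow> 'b" where
  "gauge_flow \<iota> S t = gauge \<iota> S (exp (\<i> * of_real t))"

definition entire :: "(complex \<Rightarrow> 'b::cstar_algebra) \<Rightarrow> bool" where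
  "entire f \<longleftrightarrow> (\<forall>z. \<exists>D. ((\<lambda>h. inverse h *\<^sub>C (f (z + h) - f z)) \<longlongrightarrow> D) (at 0))"

definition entire_extension :: "(real \<Rightarrow> 'b::cstar_algebra \<Rightarrow> 'b) \<Rightarrow> 'b \<Rightarrow> (complex \<Rightarrow> 'b) \<Rightarrow> bool" where
  "entire_extension \<sigma> x f \<longleftrightarrow> entire f \<and> (\<forall>t. f (of_real t) = \<sigma> t x)"

definition analytic_elements :: "(real \<Rightarrow> 'b::cstar_algebra \<Rightarrow> 'b) \<Rightarrow> 'b set" where
  "analytic_elements \<sigma> = {x. \<exists>f. entire_extension \<sigma> x f}"

text \<open>\<open>\<sigma>\<^sub>z(x)\<close> for analytic \<open>x\<close>.  The extension is unique by the identity theorem, so the choice is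
  immaterial.\<close>

definition complex_flow :: "(real \<Rightarrow> 'b::cstar_algebra \<Rightarrow> 'b) \<Rightarrow> complex \<Rightarrow> 'b \<Rightarrow> 'b" where
  "complex_flow \<sigma> z x = (SOME f. entire_extension \<sigma> x f) z"

definition star_subalgebra :: "'b::cstar_algebra set \<Rightarrow> bool" where
  "star_subalgebra D \<longleftrightarrow> 0 \<in> D \<and> (\<forall>x\<in>D. \<forall>y\<in>D. x + y \<in> D \<and> x * y \<in> D) \<and>
     (\<forall>x\<in>D. star x \<in> D \<and> (\<forall>c. c *\<^sub>C x \<in> D))"

definition KMS_state ::
    "(real \<Rightarrow> 'b::cstar_algebra \<Rightarrow> 'b) \<Rightarrow> real \<Rightarrow> ('b \<Rightarrow> complex) \<Rightarrow> bool" where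
  "KMS_state \<sigma> \<beta> \<psi> \<longleftrightarrow> \<psi> \<in> states \<and>
     (\<exists>D. star_subalgebra D \<and> closure D = UNIV \<and> D \<subseteq> analytic_elements \<sigma> \<and> (\<forall>t. \<sigma> t ` D \<subseteq> D) \<and>
        (\<forall>x\<in>D. \<forall>y\<in>D. \<psi> (x * y) = \<psi> (y * complex_flow \<sigma> (\<i> * of_real \<beta>) x)))"

text \<open>Limits of nets \<open>(\<psi>\<^sub>k)\<close> of \<open>(\<sigma>, \<beta>\<^sub>k)\<close>-KMS states with \<open>\<beta>\<^sub>k \<rightarrow> \<infinity>\<close>; nets are rendered by
  proper filters on the set of pairs \<open>(\<beta>, \<psi>)\<close>.\<close>

definition KMS_infinity_states :: "(real \<Rightarrow> 'b::cstar_algebra \<Rightarrow> 'b) \<Rightarrow> ('b \<Rightarrow> complex) set" where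
  "KMS_infinity_states \<sigma> = {\<psi> \<in> states. \<exists>F :: (real \<times> ('b \<Rightarrow> complex)) filter.
     F \<noteq> bot \<and> filterlim fst at_top F \<and> eventually (\<lambda>(\<beta>, \<eta>). KMS_state \<sigma> \<beta> \<eta>) F \<and>
     limitin weak_star snd \<psi> F}"

definition monomial :: "('a \<Rightarrow> 'b::cstar_algebra) \<Rightarrow> ('n \<Rightarrow> 'b) \<Rightarrow> 'n list \<Rightarrow> 'a \<Rightarrow> 'n list \<Rightarrow> 'b" where
  "monomial \<iota> S \<mu> a \<nu> = prod_list (map S \<mu>) * \<iota> a * star (prod_list (map S \<nu>))"

definition monomial_span :: "('a \<Rightarrow> 'b::cstar_algebra) \<Rightarrow> ('n \<Rightarrow> 'b) \<Rightarrow> 'b set" where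
  "monomial_span \<iota> S = module.span scaleC {monomial \<iota> S \<mu> a \<nu> | \<mu> a \<nu>. True}"

definition ground_states :: "('a \<Rightarrow> 'b::cstar_algebra) \<Rightarrow> ('n \<Rightarrow> 'b) \<Rightarrow> ('b \<Rightarrow> complex) set" where
  "ground_states \<iota> S = {\<psi> \<in> states. \<forall>x\<in>monomial_span \<iota> S. \<forall>y\<in>monomial_span \<iota> S.
     bounded ((\<lambda>z. \<psi> (x * complex_flow (gauge_flow \<iota> S) z y)) ` {z. Im z > 0})}"

section \<open>The map on states\<close>

definition is_phi ::
    "('a \<Rightarrow> 'b::cstar_algebra) \<Rightarrow> ('n \<Rightarrow> 'b) \<Rightarrow> ('a \<Rightarrow> complex) \<Rightarrow> ('b \<Rightarrow> complex) \<Rightarrow> bool" where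
  "is_phi \<iota> S \<tau> \<phi> \<longleftrightarrow> \<phi> \<in> states \<and>
     (\<forall>\<mu> a \<nu>. \<phi> (monomial \<iota> S \<mu> a \<nu>) = (if \<mu> = [] \<and> \<nu> = [] then \<tau> a else 0))"

definition phi :: "('a \<Rightarrow> 'b::cstar_algebra) \<Rightarrow> ('n \<Rightarrow> 'b) \<Rightarrow> ('a \<Rightarrow> complex) \<Rightarrow> 'b \<Rightarrow> complex" where
  "phi \<iota> S \<tau> = (THE \<phi>. is_phi \<iota> S \<tau> \<phi>)"

end

theory Submission
  imports Defs "HOL-Complex_Analysis.Complex_Analysis"
begin

text \<open>A state \<open>\<tau>\<close> vanishing on \<open>J\<close> acts on the Fock space over its GNS space, with one summand for each
  word; the vanishing makes this representation covariant, so its vacuum vector state factors through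
  the Cuntz-Pimsner algebra and is \<open>\<phi>\<^sub>\<tau>\<close>.  The states so obtained are those that vanish on all
  \<open>S\<^sub>i y\<close>.  Boundedness of \<open>z \<mapsto> \<psi> (x \<sigma>\<^sub>z (S\<^sub>i\<^sup>*))\<close> forces this for a ground state, and
  \<open>\<psi> (S\<^sub>i y) = exp (- \<beta>) \<psi> (y S\<^sub>i)\<close> forces it for limits of KMS states.  Conversely, for tracial
  \<open>\<tau>\<close> the Gibbs averages of \<open>\<phi>\<^sub>\<tau> (S\<^sub>w\<^sup>* x S\<^sub>w)\<close> over the words \<open>w\<close>, with weights
  proportional to \<open>exp (- \<beta> |w|)\<close>, are KMS states converging to \<open>\<phi>\<^sub>\<tau>\<close>.\<close>

text \<open>\<open>cuntz_pimsner\<close> is phrased by domination of C*-seminorms on the free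
  *-algebra, so neither a GNS quotient nor a Hilbert space completion is formed: A-valued functions
  of finite support on words carry a semi-inner product, and its operator seminorm is compared with
  the norm of the target directly. States and *-homomorphisms are given purely algebraically, so
  their continuity must be earned first; the binomial series of sqrt(1 - h) stands in for functional
  calculus. Two obstacles shape the rest. \<open>complex_flow\<close> is a choice of extension, so
  computations with it pass through bounded functionals and the identity theorem. The dense
  subalgebra in \<open>KMS_state\<close> is arbitrary and may miss S_i and A, so the relations at
  those elements are recovered from Fourier coefficients of the flow. Finally, weights exp(-\<beta>
  k) over d^k words of length k are summable only if d exp(-\<beta>) < 1; KMS states are therefore
  built for large \<beta>, which is all that the limit sees.\<close>

section \<open>Square roots near the identity\<close>

lemma star_scaleR: "star (r *\<^sub>R x) = r *\<^sub>R star (x::'a::cstar_algebra)"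
  by (simp add: star_scaleC flip: scaleC_of_real)

lemma star_power: "star (x ^ n) = star (x::'a::cstar_algebra) ^ n"
  by (induction n) (simp_all add: star_mult power_commutes)

lemma bounded_linear_star: "bounded_linear (star :: 'a::cstar_algebra \<Rightarrow> 'a)"
  by (rule bounded_linear_intro[where K = 1]) (simp_all add: star_add star_scaleR norm_star)

text \<open>Consecutive coefficients have ratio (1/2 - n)/(n + 1), of modulus at most one. This
  crude bound makes the geometric series of \<open>norm h\<close> a majorant in
  \<open>sqrt_one_minus\<close>.\<close>

lemma abs_half_gbinomial_le_one: "\<bar>(1/2 :: real) gchoose n\<bar> \<le> 1"
proof (induction n)
  case (Suc n)
  have "real (Suc n) * ((1/2) gchoose Suc n) = (1/2 - real n) * ((1/2) gchoose n)"
    using gbinomial_absorb_comp[of "1/2::real" n] gbinomial_absorption[of n "1/2::real"] by simp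
  then have "real (Suc n) * \<bar>(1/2) gchoose Suc n\<bar> = \<bar>1/2 - real n\<bar> * \<bar>(1/2::real) gchoose n\<bar>"
    by (metis abs_mult abs_of_nat)
  also have "\<dots> \<le> real (Suc n) * 1"
    using Suc by (intro mult_mono) auto
  finally show ?case by simp
qed simp

text \<open>\<open>c\<close> is the binomial series of (1 + x)^(1/2) at x = -h. Real coefficients
  make it self-adjoint, and a power series in h commutes with whatever commutes with h. Later uses
  reach the boundary \<open>norm h = 1\<close> by scaling.\<close>

lemma sqrt_one_minus:
  fixes h :: "'a::cstar_algebra"
  assumes h: "star h = h" "norm h < 1"
  shows "\<exists>c. star c = c \<and> c * c = 1 - h \<and> (\<forall>y. y * h = h * y \<longrightarrow> y * c = c * y)"
proof -
  define a where "a n = ((1/2 :: real) gchoose n) *\<^sub>R (- h) ^ n" for n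
  define c where "c = suminf a"
  have "summable (\<lambda>n. norm h ^ n)"
    using h by (simp add: summable_geometric)
  moreover have "norm (norm (a n)) \<le> norm h ^ n" for n
    using mult_mono[OF abs_half_gbinomial_le_one[of n] norm_power_ineq[of "- h" n]]
    by (simp add: a_def)
  ultimately have sn: "summable (\<lambda>n. norm (a n))"
    by (rule summable_comparison_test'[where N = 0])
  then have s: "summable a" by (rule summable_norm_cancel)
  have "star c = suminf (\<lambda>n. star (a n))"
    unfolding c_def by (rule bounded_linear.suminf[OF bounded_linear_star s])
  also have "(\<lambda>n. star (a n)) = a"
    using h star_diff[of 0 h] by (simp add: a_def star_scaleR star_power fun_eq_iff)
  finally have "star c = c" by (simp add: c_def)
  moreover have "c * c = suminf (\<lambda>k. \<Sum>i\<le>k. a i * a (k - i))"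
    unfolding c_def by (rule Cauchy_product[OF sn sn])
  then have "c * c = 1 - h"
  proof -
    \<comment> \<open>Vandermonde convolves the coefficients for 1/2 with themselves into those for
      1, which vanish beyond k = 1; this leaves 1 - h.\<close>
    have "(\<Sum>i\<le>k. a i * a (k - i)) = ((1::real) gchoose k) *\<^sub>R (- h) ^ k" for k
    proof -
      have "(\<Sum>i\<le>k. a i * a (k - i)) =
          (\<Sum>i\<le>k. (((1/2) gchoose i) * ((1/2::real) gchoose (k - i))) *\<^sub>R (- h) ^ k)"
        by (intro sum.cong refl) (simp add: a_def flip: power_add)
      also have "\<dots> = (\<Sum>i\<le>k. ((1/2) gchoose i) * ((1/2::real) gchoose (k - i))) *\<^sub>R (- h) ^ k"
        by (simp only: scaleR_sum_left)
      finally show ?thesis using gbinomial_Vandermonde[of "1/2::real" "1/2" k]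
        by (simp add: atMost_atLeast0)
    qed
    then have "c * c = suminf (\<lambda>k. ((1::real) gchoose k) *\<^sub>R (- h) ^ k)"
      using \<open>c * c = suminf (\<lambda>k. \<Sum>i\<le>k. a i * a (k - i))\<close> by simp
    also have "\<dots> = (\<Sum>k\<in>{0,1}. ((1::real) gchoose k) *\<^sub>R (- h) ^ k)"
    proof (rule suminf_finite)
      fix n :: nat assume "n \<notin> {0, 1}"
      then have "(1::nat) choose n = 0" by auto
      then have "(1::real) gchoose n = 0"
        using binomial_gbinomial[of 1 n, where ?'a = real] by (metis of_nat_0 of_nat_1)
      then show "((1::real) gchoose n) *\<^sub>R (- h) ^ n = 0" by simp
    qed simp
    finally show ?thesis by simp
  qed
  moreover have "y * c = c * y" if "y * h = h * y" for y
  proof -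
    have "y * a n = a n * y" for n
      using power_commuting_commutes[of "- h" y n] that by (simp add: a_def)
    then show ?thesis using suminf_mult[OF s, of y] suminf_mult2[OF s, of y] by (simp add: c_def)
  qed
  ultimately show ?thesis by blast
qed

section \<open>Positive functionals\<close>

text \<open>States without normalisation: compressions and sums stay in this class, while their
  value at 1 varies.\<close>

definition positive_functional :: "('a::cstar_algebra \<Rightarrow> complex) \<Rightarrow> bool" where
  "positive_functional L \<longleftrightarrow> (\<forall>x y. L (x + y) = L x + L y) \<and> (\<forall>c x. L (c *\<^sub>C x) = c * L x) \<and>
     (\<forall>x. L (star x * x) \<in> \<real>\<^sub>\<ge>\<^sub>0)"

lemma states_iff: "\<phi> \<in> states \<longleftrightarrow> positive_functional \<phi> \<and> \<phi> 1 = 1"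
  by (auto simp: states_def positive_functional_def)

text \<open>The discriminant argument behind Cauchy-Schwarz, isolated because it serves both
  positive functionals and \<open>fock_inner\<close>. The parameter is complex so that the phase of
  \<open>b\<close> can be removed.\<close>

lemma cmod_square_le_of_discriminant:
  fixes A C :: real and b :: complex
  assumes nonneg: "\<And>s. 0 \<le> A + 2 * Re (s * b) + (cmod s)\<^sup>2 * C" and C: "0 \<le> C"
  shows "(cmod b)\<^sup>2 \<le> A * C"
proof (cases "b = 0")
  case True
  then show ?thesis using nonneg[of 0] C by simp
next
  case False
  define B where "B = (cmod b)\<^sup>2"
  have B: "B > 0" using False by (simp add: B_def)
  have bb: "Re (cnj b * b) = B" by (simp add: B_def cmod_power2 flip: power2_eq_square)
  \<comment> \<open>The choice \<open>s = - t * cnj b\<close> turns the hypothesis into a real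
    quadratic in t.\<close>
  have t: "0 \<le> A - 2 * t * B + t\<^sup>2 * B * C" for t
    using nonneg[of "of_real (- t) * cnj b"] bb
    by (simp add: norm_mult power_mult_distrib B_def mult.assoc)
  show ?thesis
  \<comment> \<open>For \<open>C = 0\<close> the bound is affine and takes the value -1 at the
    chosen t; otherwise t = 1 / C minimises the quadratic and gives A - B / C.\<close>
  proof (cases "C = 0")
    case True
    then show ?thesis using t[of "(A + 1) / (2 * B)"] B by simp
  next
    case False
    then show ?thesis using t[of "1 / C"] C by (simp add: B_def field_simps power2_eq_square)
  qed
qed

context
  fixes L :: "'a::cstar_algebra \<Rightarrow> complex"
  assumes L: "positive_functional L"
begin

lemma pf_add: "L (x + y) = L x + L y"
  and pf_scaleC: "L (c *\<^sub>C x) = c * L x"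
  and pf_square: "L (star x * x) \<in> \<real>\<^sub>\<ge>\<^sub>0"
  using L by (auto simp: positive_functional_def)

lemma pf_zero [simp]: "L 0 = 0"
  using pf_scaleC[of 0 0] by simp

lemma pf_minus: "L (- x) = - L x"
  using pf_scaleC[of "-1" x] by (simp add: scaleC_minus_one)

lemma pf_diff: "L (x - y) = L x - L y"
  using pf_add[of x "- y"] by (simp add: pf_minus)

lemma pf_scaleR: "L (r *\<^sub>R x) = of_real r * L x"
  by (simp add: pf_scaleC flip: scaleC_of_real)

lemma pf_sum: "L (\<Sum>i\<in>I. f i) = (\<Sum>i\<in>I. L (f i))"
  by (induction I rule: infinite_finite_induct) (simp_all add: pf_add)

lemma pf_square_Re: "0 \<le> Re (L (star x * x))" and pf_square_Im: "Im (L (star x * x)) = 0"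
  using pf_square[of x] by (auto simp: complex_nonneg_Reals_iff)

text \<open>The value at the square of 1 + c x is real, so the cross terms have no imaginary part; c
  = 1 and c = \<i> then determine both components.\<close>

lemma pf_star: "L (star x) = cnj (L x)"
proof -
  have e: "star (1 + c *\<^sub>C x) * (1 + c *\<^sub>C x) = 1 + c *\<^sub>C x + cnj c *\<^sub>C star x + (cnj c * c) *\<^sub>C (star x * x)" for c
    by (simp add: star_add star_scaleC algebra_simps mult_scaleC_left mult_scaleC_right scaleC_scaleC
        scaleC_add_right)
  have "Im (L 1) = 0" using pf_square_Im[of 1] by simp
  then have "Im (c * L x + cnj c * L (star x)) = 0" for c
    using pf_square_Im[of "1 + c *\<^sub>C x"] pf_square_Im[of x]
    by (simp only: e pf_add pf_scaleC plus_complex.sel) simp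
  from this[of 1] this[of \<i>] show ?thesis by (simp add: complex_eq_iff)
qed

lemma pf_cauchy_schwarz: "(cmod (L (star x * y)))\<^sup>2 \<le> Re (L (star x * x)) * Re (L (star y * y))"
proof (rule cmod_square_le_of_discriminant)
  fix s
  have e: "star (x + s *\<^sub>C y) * (x + s *\<^sub>C y) =
      star x * x + s *\<^sub>C (star x * y) + cnj s *\<^sub>C (star y * x) + (cnj s * s) *\<^sub>C (star y * y)"
    by (simp add: star_add star_scaleC algebra_simps mult_scaleC_left mult_scaleC_right scaleC_scaleC
        scaleC_add_right)
  have "L (star y * x) = cnj (L (star x * y))"
    using pf_star[of "star x * y"] by (simp add: star_mult star_star)
  moreover have "cnj s * s = of_real ((cmod s)\<^sup>2)"
    by (metis complex_norm_square mult.commute)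
  ultimately show "0 \<le> Re (L (star x * x)) + 2 * Re (s * L (star x * y)) + (cmod s)\<^sup>2 * Re (L (star y * y))"
    using pf_square_Re[of "x + s *\<^sub>C y"]
    by (simp only: e pf_add pf_scaleC plus_complex.sel) simp
qed (rule pf_square_Re)

text \<open>For every t > norm h the element 1 - h/t is the square of a self-adjoint
  \<open>c\<close>, so its value is nonnegative. Letting t fall to norm h removes the strictness
  demanded by the square root.\<close>

lemma pf_Re_le:
  assumes "star h = h"
  shows "Re (L h) \<le> norm h * Re (L 1)"
proof -
  have L1: "0 \<le> Re (L 1)" using pf_square_Re[of 1] by simp
  have "Re (L h) \<le> t * Re (L 1)" if th: "t > norm h" for t
  proof -
    have t: "t > 0" using th norm_ge_zero[of h] by linarith
    obtain c where c: "star c = c" "c * c = 1 - h /\<^sub>R t"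
    proof -
      have "norm (h /\<^sub>R t) < 1" using th t by (simp add: divide_simps)
      with sqrt_one_minus[of "h /\<^sub>R t"] assms that show thesis by (auto simp: star_scaleR)
    qed
    have "0 \<le> Re (L (1 - h /\<^sub>R t))" using pf_square_Re[of c] c by simp
    then show ?thesis using t by (simp add: pf_diff pf_scaleR field_simps)
  qed
  then have "\<forall>t>norm h. Re (L h) \<le> t * Re (L 1)" by blast
  moreover have "((\<lambda>t. t * Re (L 1)) \<longlongrightarrow> norm h * Re (L 1)) (at_right (norm h))"
    by (intro tendsto_intros)
  ultimately show ?thesis
    by (intro tendsto_lowerbound[where F = "at_right (norm h)"])
       (auto simp: eventually_at_right_less intro: eventually_at_right_less eventually_mono[OF eventually_at_right_less])
qed

text \<open>Cauchy-Schwarz against 1 leaves only the self-adjoint element \<open>star x * x\<close>,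
  whose norm the C*-identity gives. Positivity thus yields continuity.\<close>

lemma pf_norm_le: "cmod (L x) \<le> Re (L 1) * norm x"
proof (rule power2_le_imp_le)
  have L1: "0 \<le> Re (L 1)" using pf_square_Re[of 1] by simp
  have "(cmod (L x))\<^sup>2 \<le> Re (L 1) * Re (L (star x * x))"
    using pf_cauchy_schwarz[of 1 x] by simp
  also have "\<dots> \<le> Re (L 1) * ((norm x)\<^sup>2 * Re (L 1))"
    using pf_Re_le[of "star x * x"] L1
    by (intro mult_left_mono) (simp_all add: star_mult star_star cstar_identity)
  finally show "(cmod (L x))\<^sup>2 \<le> (Re (L 1) * norm x)\<^sup>2" by (simp add: power2_eq_square algebra_simps)
qed (use pf_square_Re[of 1] in simp)

lemma bounded_linear_pf: "bounded_linear L"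
  by (rule bounded_linear_intro[where K = "Re (L 1)"])
     (use pf_norm_le in \<open>simp_all add: pf_add pf_scaleR mult.commute scaleR_conv_of_real[where ?'a = complex]\<close>)

lemma positive_functional_compress: "positive_functional (\<lambda>x. L (star b * x * b))"
  unfolding positive_functional_def
proof (intro conjI allI)
  show "L (star b * (star x * x) * b) \<in> \<real>\<^sub>\<ge>\<^sub>0" for x
    using pf_square[of "x * b"] by (simp add: star_mult mult.assoc)
qed (simp_all add: algebra_simps pf_add mult_scaleC_left mult_scaleC_right pf_scaleC)

end

lemma state_norm_le: "\<phi> \<in> states \<Longrightarrow> cmod (\<phi> x) \<le> norm x"
  using pf_norm_le[of \<phi> x] by (simp add: states_iff)

section \<open>Automatic continuity of *-homomorphisms\<close>

lemma unital_star_hom_simps: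
  assumes "unital_star_hom h"
  shows "h (x + y) = h x + h y" "h (c *\<^sub>C x) = c *\<^sub>C h x" "h (x * y) = h x * h y"
    "h (star x) = star (h x)" "h 1 = 1" "h 0 = 0" "h (x - y) = h x - h y" "h (r *\<^sub>R x) = r *\<^sub>R h x"
proof -
  show a: "h (x + y) = h x + h y" "h (c *\<^sub>C x) = c *\<^sub>C h x" "h (x * y) = h x * h y"
    "h (star x) = star (h x)" "h 1 = 1" for x y c
    using assms by (auto simp: unital_star_hom_def)
  show "h 0 = 0" using a(1)[of 0 0] by simp
  show "h (x - y) = h x - h y" using a(1)[of "x - y" y] by simp
  show "h (r *\<^sub>R x) = r *\<^sub>R h x" by (simp add: a flip: scaleC_of_real)
qed

text \<open>Spectral theory is avoided: only images of unitaries are estimated, whose norm is one by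
  the C*-identity. Scaling with an epsilon covers self-adjoint elements, and the C*-identity all
  others.\<close>

lemma unital_star_hom_contractive:
  fixes h :: "'a::cstar_algebra \<Rightarrow> 'b::cstar_algebra"
  assumes h: "unital_star_hom h"
  shows "norm (h x) \<le> norm x"
proof -
  note hs = unital_star_hom_simps[OF h]
  text \<open>A self-adjoint strict contraction is the real part of a unitary.\<close>
  have 1: "norm (h k) \<le> 1" if k: "star k = k" "norm k < 1" for k
  proof -
    have "norm (k * k) < 1"
      using cstar_identity[of k] k by (simp add: power_less_one_iff)
    then obtain c where c: "star c = c" "c * c = 1 - k * k" "\<And>y. y * (k * k) = k * k * y \<Longrightarrow> y * c = c * y"
      using sqrt_one_minus[of "k * k"] k by (metis star_mult)
    have kc: "k * c = c * k" by (rule c(3)) (simp add: mult.assoc)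
    define u where "u = k + \<i> *\<^sub>C c"
    have su: "star u = k - \<i> *\<^sub>C c"
      using scaleC_scaleC[of "-1" \<i> c] by (simp add: u_def star_add star_scaleC k c scaleC_minus_one)
    have "star u * u = k * k + \<i> *\<^sub>C (k * c) - \<i> *\<^sub>C (c * k) + c * c"
      unfolding su unfolding u_def using scaleC_minus_one[of "c * c"]
      by (simp add: ring_distribs mult_scaleC_left mult_scaleC_right
          scaleC_scaleC scaleC_diff_right)
    then have "star u * u = 1" by (simp add: kc c(2))
    then have "star (h u) * h u = 1" by (metis hs(3-5))
    then have "(norm (h u))\<^sup>2 = 1" using cstar_identity[of "h u"] by simp
    then have nu: "norm (h u) = 1" by (simp add: power2_eq_1_iff) (metis norm_ge_zero neg_0_le_iff_le not_one_le_zero)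
    have "u + star u = 2 *\<^sub>R k"
      unfolding su unfolding u_def by (simp add: scaleR_2)
    then have "2 *\<^sub>R h k = h u + star (h u)" by (metis hs(1,4,8))
    then have "2 * norm (h k) \<le> 2"
      using norm_triangle_ineq[of "h u" "star (h u)"] nu
      by (metis norm_scaleR norm_star abs_numeral one_add_one)
    then show ?thesis by simp
  qed
  have 2: "norm (h k) \<le> norm k" if k: "star k = k" for k
  proof (rule field_le_epsilon)
    fix e :: real assume e: "e > 0"
    define t where "t = norm k + e"
    have t: "t > 0" "norm k < t" using e by (simp_all add: t_def add_nonneg_pos)
    have "norm (h (k /\<^sub>R t)) \<le> 1"
      using t k by (intro 1) (simp_all add: star_scaleR divide_simps)
    then show "norm (h k) \<le> norm k + e" using t by (simp add: hs divide_simps t_def)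
  qed
  have "(norm (h x))\<^sup>2 \<le> (norm x)\<^sup>2"
    using 2[of "star x * x"] by (simp add: star_mult star_star hs cstar_identity)
  then show ?thesis by (rule power2_le_imp_le) simp
qed

lemma continuous_on_unital_star_hom:
  assumes "unital_star_hom h"
  shows "continuous_on X h"
proof (rule continuous_on_subset[OF _ subset_UNIV], rule linear_continuous_on)
  show "bounded_linear h"
    by (rule bounded_linear_intro[where K = 1])
       (simp_all add: unital_star_hom_simps[OF assms] unital_star_hom_contractive[OF assms])
qed

section \<open>The Fock representation\<close>

text \<open>Here \<open>v w\<close> represents a GNS vector at the word w, without passing to
  classes. The action of a coefficient through \<open>fold \<alpha> w\<close> is forced by a S_i =
  S_i \<alpha>_i(a), since \<open>Isom i\<close> prepends i and \<open>fold\<close> applies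
  \<alpha>_i first. That adjoint letters act as adjoints is shown in
  \<open>fock_letter_adjoint\<close>.\<close>

fun fock_letter ::
    "('n \<Rightarrow> 'a \<Rightarrow> 'a) \<Rightarrow> ('a, 'n) generator \<times> bool \<Rightarrow> ('n list \<Rightarrow> 'a) \<Rightarrow> 'n list \<Rightarrow> 'a::cstar_algebra" where
  "fock_letter \<alpha> (Coef a, b) v = (\<lambda>w. fold \<alpha> w (if b then star a else a) * v w)"
| "fock_letter \<alpha> (Isom i, b) v =
     (\<lambda>w. if b then v (i # w) else case w of [] \<Rightarrow> 0 | j # w' \<Rightarrow> if i = j then v w' else 0)"

definition fock_word ::
    "('n \<Rightarrow> 'a \<Rightarrow> 'a) \<Rightarrow> (('a, 'n) generator \<times> bool) list \<Rightarrow> ('n list \<Rightarrow> 'a) \<Rightarrow> 'n list \<Rightarrow> 'a::cstar_algebra" where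
  "fock_word \<alpha> = foldr (fock_letter \<alpha>)"

definition fock_rep ::
    "('n \<Rightarrow> 'a \<Rightarrow> 'a) \<Rightarrow> ('a, 'n) free_star_algebra \<Rightarrow> ('n list \<Rightarrow> 'a) \<Rightarrow> 'n list \<Rightarrow> 'a::cstar_algebra" where
  "fock_rep \<alpha> f v = (\<lambda>w. \<Sum>x\<in>Poly_Mapping.keys f. Poly_Mapping.lookup f x *\<^sub>C fock_word \<alpha> x v w)"

definition finite_support :: "('w \<Rightarrow> 'a::zero) \<Rightarrow> bool" where
  "finite_support v \<longleftrightarrow> finite {w. v w \<noteq> 0}"

text \<open>Only a semi-inner product, since \<tau> may annihilate nonzero positive elements.
  Indexing by the support of \<open>u\<close> alone makes linearity in \<open>v\<close> immediate;
  the left argument is handled by conjugate symmetry for finite supports.\<close>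

definition fock_inner :: "('a::cstar_algebra \<Rightarrow> complex) \<Rightarrow> ('w \<Rightarrow> 'a) \<Rightarrow> ('w \<Rightarrow> 'a) \<Rightarrow> complex" where
  "fock_inner \<tau> u v = (\<Sum>w | u w \<noteq> 0. \<tau> (star (u w) * v w))"

definition fock_norm :: "('a::cstar_algebra \<Rightarrow> complex) \<Rightarrow> ('w \<Rightarrow> 'a) \<Rightarrow> real" where
  "fock_norm \<tau> v = sqrt (Re (fock_inner \<tau> v v))"

section \<open>Fock operators as a representation of the free *-algebra\<close>

lemma unital_star_hom_fold:
  "cstar_dynamical_system \<alpha> \<Longrightarrow> unital_star_hom (fold \<alpha> w)"
  by (induction w) (auto simp: cstar_dynamical_system_def unital_star_hom_def)

lemma fock_letter_sum:
  "fock_letter \<alpha> l (\<lambda>w. \<Sum>x\<in>X. c x *\<^sub>C V x w) w = (\<Sum>x\<in>X. c x *\<^sub>C fock_letter \<alpha> l (V x) w)"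
  by (cases l; cases "fst l") (auto simp: sum_distrib_left mult_scaleC_right split: list.split)

lemma fock_word_sum:
  "fock_word \<alpha> y (\<lambda>w. \<Sum>x\<in>X. c x *\<^sub>C V x w) = (\<lambda>w. \<Sum>x\<in>X. c x *\<^sub>C fock_word \<alpha> y (V x) w)"
  by (induction y) (simp_all add: fock_word_def fock_letter_sum[abs_def])

lemma fock_word_append: "fock_word \<alpha> (x @ y) v = fock_word \<alpha> x (fock_word \<alpha> y v)"
  by (simp add: fock_word_def)

lemma fock_rep_single: "fock_rep \<alpha> (Poly_Mapping.single x c) v = (\<lambda>w. c *\<^sub>C fock_word \<alpha> x v w)"
  by (cases "c = 0") (simp_all add: fock_rep_def fun_eq_iff)

lemma fock_rep_zero [simp]: "fock_rep \<alpha> 0 v w = 0"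
  by (simp add: fock_rep_def)

lemma fock_rep_add: "fock_rep \<alpha> (f + g) v w = fock_rep \<alpha> f v w + fock_rep \<alpha> g v w"
  unfolding fock_rep_def by (rule setsum_keys_plus_distrib) (simp_all add: scaleC_add_left)

lemma fock_rep_diff: "fock_rep \<alpha> (f - g) v w = fock_rep \<alpha> f v w - fock_rep \<alpha> g v w"
  using fock_rep_add[of \<alpha> "f - g" g v w] by (simp add: algebra_simps)

lemma fock_rep_sum: "fock_rep \<alpha> (\<Sum>x\<in>X. f x) v w = (\<Sum>x\<in>X. fock_rep \<alpha> (f x) v w)"
  by (induction X rule: infinite_finite_induct) (simp_all add: fock_rep_add)

lemma fock_rep_single_mult:
  "fock_rep \<alpha> (Poly_Mapping.single x c * g) v = fock_rep \<alpha> (Poly_Mapping.single x c) (fock_rep \<alpha> g v)"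
proof
  let ?s = "\<lambda>y. Poly_Mapping.single y (Poly_Mapping.lookup g y)"
  fix w
  have "fock_rep \<alpha> (Poly_Mapping.single x c * g) v w =
      fock_rep \<alpha> (\<Sum>y\<in>Poly_Mapping.keys g. Poly_Mapping.single x c * ?s y) v w"
    by (simp flip: sum_distrib_left free_sum_single)
  also have "\<dots> = fock_rep \<alpha> (Poly_Mapping.single x c) (fock_rep \<alpha> g v) w"
    by (simp add: fock_rep_sum mult_single fock_rep_single plus_list_def)
       (simp add: fock_rep_def fock_word_sum scaleC_sum_right scaleC_scaleC fock_word_append)
  finally show "fock_rep \<alpha> (Poly_Mapping.single x c * g) v w =
      fock_rep \<alpha> (Poly_Mapping.single x c) (fock_rep \<alpha> g v) w" .
qed

lemma fock_rep_mult: "fock_rep \<alpha> (f * g) v = fock_rep \<alpha> f (fock_rep \<alpha> g v)"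
proof
  fix w
  let ?s = "\<lambda>y. Poly_Mapping.single y (Poly_Mapping.lookup f y)"
  have "fock_rep \<alpha> (f * g) v w = fock_rep \<alpha> (\<Sum>y\<in>Poly_Mapping.keys f. ?s y * g) v w"
    by (simp flip: sum_distrib_right free_sum_single)
  also have "\<dots> = fock_rep \<alpha> (\<Sum>y\<in>Poly_Mapping.keys f. ?s y) (fock_rep \<alpha> g v) w"
    by (simp add: fock_rep_sum fock_rep_single_mult)
  finally show "fock_rep \<alpha> (f * g) v w = fock_rep \<alpha> f (fock_rep \<alpha> g v) w"
    by (simp flip: free_sum_single)
qed

lemma fock_rep_one [simp]: "fock_rep \<alpha> 1 v = v"
  using fock_rep_single[of \<alpha> "[]" 1 v]
  by (simp add: scaleC_one zero_list_def fock_word_def flip: single_one)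

lemma fock_rep_scale: "fock_rep \<alpha> (free_scale c f) v w = c *\<^sub>C fock_rep \<alpha> f v w"
  by (simp add: free_scale_def fock_rep_mult fock_rep_single fock_word_def)

lemma fock_rep_gen: "fock_rep \<alpha> (gen g) v = fock_letter \<alpha> (g, False) v"
  by (simp add: gen_def fock_rep_single scaleC_one fock_word_def)

lemma fock_rep_star_gen: "fock_rep \<alpha> (free_star (gen g)) v = fock_letter \<alpha> (g, True) v"
  by (simp add: gen_def free_star_def word_star_def fock_rep_single scaleC_one fock_word_def)

lemma finite_support_scaleC: "finite_support v \<Longrightarrow> finite_support (\<lambda>w. c *\<^sub>C (v w :: 'a::cstar_algebra))"
  unfolding finite_support_def by (erule rev_finite_subset) auto

lemma finite_support_sum:
  "(\<And>x. x \<in> X \<Longrightarrow> finite_support (V x)) \<Longrightarrow> finite_support (\<lambda>w. \<Sum>x\<in>X. V x w :: 'a::comm_monoid_add)"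
proof (induction X rule: infinite_finite_induct)
  case (insert x X)
  then have "finite ({w. V x w \<noteq> 0} \<union> {w. (\<Sum>x\<in>X. V x w) \<noteq> 0})" by (simp add: finite_support_def)
  then show ?case
    unfolding finite_support_def by (rule rev_finite_subset) (use insert in auto)
qed (simp_all add: finite_support_def)

lemma support_fock_letter_isom:
  "{w. fock_letter \<alpha> (Isom i, False) v w \<noteq> 0} \<subseteq> (#) i ` {w. v w \<noteq> 0}"
proof (rule subsetI)
  show "w \<in> (#) i ` {w. v w \<noteq> 0}" if "w \<in> {w. fock_letter \<alpha> (Isom i, False) v w \<noteq> 0}" for w
    using that by (cases w) (auto split: if_splits)
qed

lemma finite_support_fock_letter:
  assumes "finite_support v"
  shows "finite_support (fock_letter \<alpha> l v)"
proof -
  obtain g b where l: "l = (g, b)" by (cases l)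
  show ?thesis
  proof (cases g)
    case (Coef a)
    with assms show ?thesis
      unfolding finite_support_def l by (auto elim!: rev_finite_subset)
  next
    case (Isom i)
    from assms have "finite {w. v (i # w) \<noteq> 0}" "finite ((\<lambda>w. i # w) ` {w. v w \<noteq> 0})"
      using finite_vimageI[of "{w. v w \<noteq> 0}" "\<lambda>w. i # w"]
      by (auto simp: finite_support_def vimage_def intro: injI)
    then show ?thesis
      unfolding finite_support_def l Isom
      using finite_subset[OF support_fock_letter_isom[of \<alpha> i v]] by (cases b) simp_all
  qed
qed

lemma finite_support_fock_word: "finite_support v \<Longrightarrow> finite_support (fock_word \<alpha> x v)"
  by (induction x) (simp_all add: fock_word_def finite_support_fock_letter)

lemma finite_support_fock_rep: "finite_support v \<Longrightarrow> finite_support (fock_rep \<alpha> f v)"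
  unfolding fock_rep_def
  by (intro finite_support_sum finite_support_scaleC finite_support_fock_word)

subsection \<open>The inner product\<close>

context
  fixes \<tau> :: "'a::cstar_algebra \<Rightarrow> complex"
  assumes \<tau>: "positive_functional \<tau>"
begin

lemmas \<tau>_simps = pf_add[OF \<tau>] pf_scaleC[OF \<tau>] pf_zero[OF \<tau>] pf_sum[OF \<tau>]

lemma fock_inner_superset:
  "finite W \<Longrightarrow> {w. u w \<noteq> 0} \<subseteq> W \<Longrightarrow> fock_inner \<tau> u v = (\<Sum>w\<in>W. \<tau> (star (u w) * v w))"
  unfolding fock_inner_def by (rule sum.mono_neutral_left) (auto simp: \<tau>_simps)

lemma fock_inner_add_right:
  "fock_inner \<tau> u (\<lambda>w. v w + v' w) = fock_inner \<tau> u v + fock_inner \<tau> u v'"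
  by (simp add: fock_inner_def distrib_left \<tau>_simps sum.distrib)

lemma fock_inner_scaleC_right: "fock_inner \<tau> u (\<lambda>w. c *\<^sub>C v w) = c * fock_inner \<tau> u v"
  by (simp add: fock_inner_def mult_scaleC_right \<tau>_simps sum_distrib_left)

lemma fock_inner_sum_right:
  "fock_inner \<tau> u (\<lambda>w. \<Sum>x\<in>X. V x w) = (\<Sum>x\<in>X. fock_inner \<tau> u (V x))"
proof (induction X rule: infinite_finite_induct)
  case (insert x X)
  then show ?case by (simp add: fock_inner_add_right)
qed (simp_all add: fock_inner_def \<tau>_simps)

lemma fock_inner_cnj:
  assumes "finite_support u" "finite_support v"
  shows "fock_inner \<tau> v u = cnj (fock_inner \<tau> u v)"
proof -
  let ?W = "{w. u w \<noteq> 0} \<union> {w. v w \<noteq> 0}"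
  have "finite ?W" using assms by (simp add: finite_support_def)
  moreover have "\<tau> (star (v w) * u w) = cnj (\<tau> (star (u w) * v w))" for w
    using pf_star[OF \<tau>, of "star (u w) * v w"] by (simp add: star_mult star_star)
  ultimately show ?thesis by (subst (1 2) fock_inner_superset[of ?W]) simp_all
qed

lemma fock_inner_self: "0 \<le> Re (fock_inner \<tau> v v)" "Im (fock_inner \<tau> v v) = 0"
  by (simp_all add: fock_inner_def pf_square_Re[OF \<tau>] pf_square_Im[OF \<tau>] sum_nonneg)

lemma fock_norm_nonneg: "0 \<le> fock_norm \<tau> v" and fock_norm_square: "(fock_norm \<tau> v)\<^sup>2 = Re (fock_inner \<tau> v v)"
  using fock_inner_self by (simp_all add: fock_norm_def)

lemma finite_support_add:
  "finite_support u \<Longrightarrow> finite_support v \<Longrightarrow> finite_support (\<lambda>w. u w + (v w :: 'a))"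
  using finite_support_sum[of "UNIV :: bool set" "\<lambda>b. if b then u else v"]
  by (simp add: UNIV_bool add.commute)

lemma fock_inner_add_self:
  assumes "finite_support u" "finite_support v"
  shows "Re (fock_inner \<tau> (\<lambda>w. u w + v w) (\<lambda>w. u w + v w)) =
    Re (fock_inner \<tau> u u) + 2 * Re (fock_inner \<tau> u v) + Re (fock_inner \<tau> v v)"
proof -
  note fs = assms finite_support_add[OF assms]
  have "fock_inner \<tau> (\<lambda>w. u w + v w) x = cnj (fock_inner \<tau> x u) + cnj (fock_inner \<tau> x v)"
    if "finite_support x" for x
    by (subst fock_inner_cnj) (simp_all add: that fs fock_inner_add_right)
  then show ?thesis
    using fs fock_inner_cnj[OF fs(1,2)] by (simp add: fock_inner_add_right)
qed

lemma fock_cauchy_schwarz: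
  assumes u: "finite_support u" and v: "finite_support v"
  shows "cmod (fock_inner \<tau> u v) \<le> fock_norm \<tau> u * fock_norm \<tau> v"
proof (rule power2_le_imp_le)
  have "(cmod (fock_inner \<tau> u v))\<^sup>2 \<le> Re (fock_inner \<tau> u u) * Re (fock_inner \<tau> v v)"
  proof (rule cmod_square_le_of_discriminant)
    fix s
    have "fock_inner \<tau> (\<lambda>w. s *\<^sub>C v w) v = cnj (s * fock_inner \<tau> v v)"
      by (subst fock_inner_cnj) (simp_all add: v finite_support_scaleC fock_inner_scaleC_right)
    moreover have "(cmod s)\<^sup>2 = Re s * Re s + Im s * Im s"
      using cmod_power2[of s] by (simp only: power2_eq_square)
    ultimately have "Re (fock_inner \<tau> (\<lambda>w. s *\<^sub>C v w) (\<lambda>w. s *\<^sub>C v w)) = (cmod s)\<^sup>2 * Re (fock_inner \<tau> v v)"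
      using fock_inner_self(2)[of v]
      by (simp add: fock_inner_scaleC_right algebra_simps)
    then show "0 \<le> Re (fock_inner \<tau> u u) + 2 * Re (s * fock_inner \<tau> u v) + (cmod s)\<^sup>2 * Re (fock_inner \<tau> v v)"
      using fock_inner_self(1)[of "\<lambda>w. u w + s *\<^sub>C v w"] fock_inner_add_self[OF u finite_support_scaleC[OF v, of s]]
      by (simp add: fock_inner_scaleC_right)
  qed (rule fock_inner_self)
  then show "(cmod (fock_inner \<tau> u v))\<^sup>2 \<le> (fock_norm \<tau> u * fock_norm \<tau> v)\<^sup>2"
    by (simp add: power_mult_distrib fock_norm_square)
qed (simp add: fock_norm_nonneg)

lemma fock_norm_add:
  assumes u: "finite_support u" and v: "finite_support v"
  shows "fock_norm \<tau> (\<lambda>w. u w + v w) \<le> fock_norm \<tau> u + fock_norm \<tau> v"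
proof (rule power2_le_imp_le)
  have "Re (fock_inner \<tau> u v) \<le> fock_norm \<tau> u * fock_norm \<tau> v"
    using fock_cauchy_schwarz[OF u v] complex_Re_le_cmod[of "fock_inner \<tau> u v"] by linarith
  then show "(fock_norm \<tau> (\<lambda>w. u w + v w))\<^sup>2 \<le> (fock_norm \<tau> u + fock_norm \<tau> v)\<^sup>2"
    by (simp add: fock_norm_square fock_inner_add_self[OF u v] power2_sum)
qed (simp add: fock_norm_nonneg)

lemma fock_norm_scaleC:
  assumes v: "finite_support v"
  shows "fock_norm \<tau> (\<lambda>w. c *\<^sub>C v w) = cmod c * fock_norm \<tau> v"
proof (rule power2_eq_imp_eq)
  have "fock_inner \<tau> (\<lambda>w. c *\<^sub>C v w) v = cnj (c * fock_inner \<tau> v v)"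
    by (subst fock_inner_cnj) (simp_all add: v finite_support_scaleC fock_inner_scaleC_right)
  moreover have "(cmod c)\<^sup>2 = Re c * Re c + Im c * Im c"
    using cmod_power2[of c] by (simp only: power2_eq_square)
  ultimately show "(fock_norm \<tau> (\<lambda>w. c *\<^sub>C v w))\<^sup>2 = (cmod c * fock_norm \<tau> v)\<^sup>2"
    using fock_inner_self(2)[of v]
    by (simp add: fock_norm_square power_mult_distrib fock_inner_scaleC_right algebra_simps)
qed (simp_all add: fock_norm_nonneg)

lemma fock_norm_sum:
  assumes "\<And>x. x \<in> X \<Longrightarrow> finite_support (V x)"
  shows "fock_norm \<tau> (\<lambda>w. \<Sum>x\<in>X. V x w) \<le> (\<Sum>x\<in>X. fock_norm \<tau> (V x))"
  using assms
proof (induction X rule: infinite_finite_induct)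
  case (insert x X)
  then have "fock_norm \<tau> (\<lambda>w. V x w + (\<Sum>x\<in>X. V x w)) \<le> fock_norm \<tau> (V x) + fock_norm \<tau> (\<lambda>w. \<Sum>x\<in>X. V x w)"
    by (intro fock_norm_add finite_support_sum) auto
  with insert show ?case by fastforce
qed (simp_all add: fock_norm_def fock_inner_def)

text \<open>Creation is computed directly, as it moves the support injectively along
  \<open>(#) i\<close>. Annihilation then follows from conjugate symmetry instead of a second
  reindexing.\<close>

lemma fock_letter_adjoint:
  assumes "cstar_dynamical_system \<alpha>" and u: "finite_support u" and v: "finite_support v"
  shows "fock_inner \<tau> (fock_letter \<alpha> (g, \<not> b) u) v = fock_inner \<tau> u (fock_letter \<alpha> (g, b) v)"
proof (cases g)
  case (Coef a)
  have st: "star (fold \<alpha> w x) = fold \<alpha> w (star x)" for w x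
    using unital_star_hom_fold[of \<alpha> w] assms(1) by (simp add: unital_star_hom_def)
  show ?thesis
    by (subst (1 2) fock_inner_superset[of "{w. u w \<noteq> 0}"])
       (use u in \<open>auto simp: Coef finite_support_def star_mult st star_star mult.assoc\<close>)
next
  case (Isom i)
  have isom: "fock_inner \<tau> (fock_letter \<alpha> (Isom i, False) x) y = fock_inner \<tau> x (fock_letter \<alpha> (Isom i, True) y)"
    if "finite_support x" for x y
  proof -
    have "fock_inner \<tau> (fock_letter \<alpha> (Isom i, False) x) y =
        (\<Sum>w\<in>(\<lambda>w. i # w) ` {w. x w \<noteq> 0}. \<tau> (star (fock_letter \<alpha> (Isom i, False) x w) * y w))"
      by (rule fock_inner_superset[OF _ support_fock_letter_isom]) (use that in \<open>simp add: finite_support_def\<close>)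
    also have "\<dots> = fock_inner \<tau> x (fock_letter \<alpha> (Isom i, True) y)"
      unfolding fock_inner_def by (subst sum.reindex) auto
    finally show ?thesis .
  qed
  show ?thesis
  proof (cases b)
    case True
    with isom[OF u] show ?thesis by (simp add: Isom)
  next
    case False
    have "fock_inner \<tau> (fock_letter \<alpha> (Isom i, True) u) v = cnj (fock_inner \<tau> v (fock_letter \<alpha> (Isom i, True) u))"
      using u v by (intro fock_inner_cnj finite_support_fock_letter)
    also have "\<dots> = cnj (fock_inner \<tau> (fock_letter \<alpha> (Isom i, False) v) u)"
      by (simp only: isom[OF v])
    also have "\<dots> = fock_inner \<tau> u (fock_letter \<alpha> (Isom i, False) v)"
      by (rule fock_inner_cnj[symmetric]) (rule finite_support_fock_letter[OF v], rule u)
    finally show ?thesis using False by (simp add: Isom)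
  qed
qed

lemma fock_word_adjoint:
  assumes "cstar_dynamical_system \<alpha>" "finite_support u" "finite_support v"
  shows "fock_inner \<tau> (fock_word \<alpha> (word_star x) u) v = fock_inner \<tau> u (fock_word \<alpha> x v)"
  using assms(2)
proof (induction x arbitrary: u)
  case (Cons l x)
  obtain g b where l: "l = (g, b)" by (cases l)
  have "fock_inner \<tau> (fock_word \<alpha> (word_star (l # x)) u) v =
      fock_inner \<tau> (fock_word \<alpha> (word_star x) (fock_letter \<alpha> (g, \<not> b) u)) v"
    by (simp add: word_star_def l fock_word_def)
  also have "\<dots> = fock_inner \<tau> (fock_letter \<alpha> (g, \<not> b) u) (fock_word \<alpha> x v)"
    using Cons by (simp add: finite_support_fock_letter)
  also have "\<dots> = fock_inner \<tau> u (fock_letter \<alpha> (g, b) (fock_word \<alpha> x v))"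
    using Cons assms by (intro fock_letter_adjoint finite_support_fock_word)
  finally show ?case by (simp add: l fock_word_def)
qed (simp add: word_star_def fock_word_def)

lemma fock_rep_adjoint:
  assumes "cstar_dynamical_system \<alpha>" and u: "finite_support u" and v: "finite_support v"
  shows "fock_inner \<tau> (fock_rep \<alpha> (free_star f) u) v = fock_inner \<tau> u (fock_rep \<alpha> f v)"
proof -
  have star: "fock_rep \<alpha> (free_star f) u =
      (\<lambda>w. \<Sum>x\<in>Poly_Mapping.keys f. cnj (Poly_Mapping.lookup f x) *\<^sub>C fock_word \<alpha> (word_star x) u w)"
    by (simp add: free_star_def fock_rep_sum fock_rep_single fun_eq_iff)
  have "fock_inner \<tau> (fock_rep \<alpha> (free_star f) u) v = cnj (fock_inner \<tau> v (fock_rep \<alpha> (free_star f) u))"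
    by (rule fock_inner_cnj) (rule v, rule finite_support_fock_rep[OF u])
  also have "\<dots> = (\<Sum>x\<in>Poly_Mapping.keys f. Poly_Mapping.lookup f x *
      cnj (fock_inner \<tau> v (fock_word \<alpha> (word_star x) u)))"
    by (simp add: star fock_inner_sum_right fock_inner_scaleC_right)
  also have "\<dots> = (\<Sum>x\<in>Poly_Mapping.keys f. Poly_Mapping.lookup f x * fock_inner \<tau> u (fock_word \<alpha> x v))"
    by (simp add: fock_word_adjoint[OF assms] finite_support_fock_word u v flip: fock_inner_cnj)
  also have "\<dots> = fock_inner \<tau> u (fock_rep \<alpha> f v)"
    by (simp add: fock_rep_def fock_inner_sum_right fock_inner_scaleC_right)
  finally show ?thesis .
qed

lemma positive_functional_compose_hom:
  assumes "unital_star_hom h"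
  shows "positive_functional (\<lambda>x. \<tau> (h x))"
  unfolding positive_functional_def
  by (simp add: unital_star_hom_simps[OF assms] \<tau>_simps pf_square[OF \<tau>])

text \<open>For a coefficient c, sending x to
  \<open>\<tau> (star (v w) * fold \<alpha> w x * v w)\<close> is a positive functional, so its
  value at \<open>star c * c\<close> is at most norm c squared times its mass. Annihilation discards
  components and creation is isometric, whence the bound 1.\<close>

lemma fock_letter_bounded:
  assumes hom: "cstar_dynamical_system \<alpha>"
  shows "\<exists>K\<ge>0. \<forall>v. finite_support v \<longrightarrow> fock_norm \<tau> (fock_letter \<alpha> l v) \<le> K * fock_norm \<tau> v"
proof -
  obtain g b where l: "l = (g, b)" by (cases l)
  show ?thesis
  proof (cases g)
    case (Coef a)
    define c where "c = (if b then star a else a)"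
    have "fock_norm \<tau> (fock_letter \<alpha> l v) \<le> norm c * fock_norm \<tau> v" if v: "finite_support v" for v
    proof (rule power2_le_imp_le)
      have le: "Re (\<tau> (star (fold \<alpha> w c * v w) * (fold \<alpha> w c * v w))) \<le> (norm c)\<^sup>2 * Re (\<tau> (star (v w) * v w))" for w
      proof -
        have h: "unital_star_hom (fold \<alpha> w)" using hom by (rule unital_star_hom_fold)
        have "positive_functional (\<lambda>x. \<tau> (star (v w) * fold \<alpha> w x * v w))"
          using positive_functional_compress[OF \<tau>, of "v w"] h
          unfolding positive_functional_def
          by (simp add: unital_star_hom_simps)
        from pf_Re_le[OF this, of "star c * c"] show ?thesis
          by (simp add: star_mult star_star cstar_identity unital_star_hom_simps[OF h] mult.assoc)
      qed
      have "fock_letter \<alpha> l v = (\<lambda>w. fold \<alpha> w c * v w)" by (simp add: l Coef c_def)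
      then have "Re (fock_inner \<tau> (fock_letter \<alpha> l v) (fock_letter \<alpha> l v)) =
          (\<Sum>w | v w \<noteq> 0. Re (\<tau> (star (fold \<alpha> w c * v w) * (fold \<alpha> w c * v w))))"
        by (subst fock_inner_superset[of "{w. v w \<noteq> 0}"]) (use v in \<open>auto simp: finite_support_def\<close>)
      also have "\<dots> \<le> (\<Sum>w | v w \<noteq> 0. (norm c)\<^sup>2 * Re (\<tau> (star (v w) * v w)))"
        by (intro sum_mono le)
      also have "\<dots> = (norm c)\<^sup>2 * Re (fock_inner \<tau> v v)"
        by (simp add: fock_inner_def sum_distrib_left)
      finally show "(fock_norm \<tau> (fock_letter \<alpha> l v))\<^sup>2 \<le> (norm c * fock_norm \<tau> v)\<^sup>2"
        by (simp add: fock_norm_square power_mult_distrib)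
    qed (simp add: fock_norm_nonneg)
    then show ?thesis by (intro exI[of _ "norm c"]) simp
  next
    case (Isom i)
    have "fock_norm \<tau> (fock_letter \<alpha> l v) \<le> 1 * fock_norm \<tau> v" if v: "finite_support v" for v
    proof (cases b)
      case True
      have inj: "inj_on ((#) i) X" for X by (simp add: inj_on_def)
      have "Re (fock_inner \<tau> (fock_letter \<alpha> l v) (fock_letter \<alpha> l v)) =
          (\<Sum>w\<in>(#) i ` {w. v (i # w) \<noteq> 0}. Re (\<tau> (star (v w) * v w)))"
        by (simp add: sum.reindex[OF inj] l Isom True fock_inner_def)
      also have "\<dots> \<le> (\<Sum>w | v w \<noteq> 0. Re (\<tau> (star (v w) * v w)))"
        by (rule sum_mono2) (use v pf_square_Re[OF \<tau>] in \<open>auto simp: finite_support_def\<close>)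
      finally show ?thesis by (simp add: fock_norm_def fock_inner_def)
    next
      case False
      have "fock_inner \<tau> (fock_letter \<alpha> l v) (fock_letter \<alpha> l v) = fock_inner \<tau> v v"
        using fock_letter_adjoint[OF hom v finite_support_fock_letter[OF v, of \<alpha> l], where g = "Isom i" and b = True] False
        by (simp add: l Isom)
      then show ?thesis by (simp add: fock_norm_def)
    qed
    then show ?thesis by (intro exI[of _ 1]) simp
  qed
qed

lemma fock_word_bounded:
  assumes hom: "cstar_dynamical_system \<alpha>"
  shows "\<exists>K\<ge>0. \<forall>v. finite_support v \<longrightarrow> fock_norm \<tau> (fock_word \<alpha> x v) \<le> K * fock_norm \<tau> v"
proof (induction x)
  case (Cons l x)
  then obtain K where K: "K \<ge> 0" "\<And>v. finite_support v \<Longrightarrow> fock_norm \<tau> (fock_word \<alpha> x v) \<le> K * fock_norm \<tau> v"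
    by blast
  obtain M where M: "M \<ge> 0" "\<And>v. finite_support v \<Longrightarrow> fock_norm \<tau> (fock_letter \<alpha> l v) \<le> M * fock_norm \<tau> v"
    using fock_letter_bounded[OF hom, where l = l] by blast
  have "fock_norm \<tau> (fock_word \<alpha> (l # x) v) \<le> M * K * fock_norm \<tau> v" if v: "finite_support v" for v
    using M(2)[OF finite_support_fock_word[OF v], of \<alpha> x] mult_left_mono[OF K(2)[OF v] M(1)]
    by (simp add: fock_word_def mult.assoc)
  then show ?case using K M by (intro exI[of _ "M * K"]) simp
qed (auto simp: fock_word_def intro!: exI[of _ 1])

text \<open>Supplies an admissible constant for the infimum in \<open>fock_seminorm\<close>, and
  shows that null vectors are sent to null vectors.\<close>

lemma fock_rep_bounded:
  assumes hom: "cstar_dynamical_system \<alpha>"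
  shows "\<exists>K\<ge>0. \<forall>v. finite_support v \<longrightarrow> fock_norm \<tau> (fock_rep \<alpha> f v) \<le> K * fock_norm \<tau> v"
proof -
  obtain K where K: "\<And>x. K x \<ge> 0"
    "\<And>x v. finite_support v \<Longrightarrow> fock_norm \<tau> (fock_word \<alpha> x v) \<le> K x * fock_norm \<tau> v"
    using fock_word_bounded[OF hom] by metis
  let ?c = "\<lambda>x. Poly_Mapping.lookup f x"
  have "fock_norm \<tau> (fock_rep \<alpha> f v) \<le> (\<Sum>x\<in>Poly_Mapping.keys f. cmod (?c x) * K x) * fock_norm \<tau> v"
    if v: "finite_support v" for v
  proof -
    note fs = finite_support_fock_word[OF v]
    have "fock_norm \<tau> (fock_rep \<alpha> f v) \<le>
        (\<Sum>x\<in>Poly_Mapping.keys f. fock_norm \<tau> (\<lambda>w. ?c x *\<^sub>C fock_word \<alpha> x v w))"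
      unfolding fock_rep_def by (intro fock_norm_sum finite_support_scaleC fs)
    also have "\<dots> \<le> (\<Sum>x\<in>Poly_Mapping.keys f. cmod (?c x) * (K x * fock_norm \<tau> v))"
      using K(2)[OF v] by (intro sum_mono) (simp add: fock_norm_scaleC[OF fs] mult_left_mono)
    finally show ?thesis by (simp add: sum_distrib_right mult.assoc)
  qed
  then show ?thesis
    using K by (intro exI[of _ "\<Sum>x\<in>Poly_Mapping.keys f. cmod (?c x) * K x"]) (auto intro: sum_nonneg)
qed

end

subsection \<open>The operator seminorm\<close>

text \<open>The operator norm as an infimum of bounds, since a quotient of norms breaks down on
  nonzero null vectors. The condition \<open>0 \<le> K\<close> keeps the set bounded below even if
  every vector is null.\<close>

definition fock_seminorm ::
    "('n \<Rightarrow> 'a \<Rightarrow> 'a) \<Rightarrow> ('a::cstar_algebra \<Rightarrow> complex) \<Rightarrow> ('a, 'n) free_star_algebra \<Rightarrow> real" where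
  "fock_seminorm \<alpha> \<tau> f =
     Inf {K. 0 \<le> K \<and> (\<forall>v. finite_support v \<longrightarrow> fock_norm \<tau> (fock_rep \<alpha> f v) \<le> K * fock_norm \<tau> v)}"

context
  fixes \<alpha> :: "'n::finite \<Rightarrow> 'a::cstar_algebra \<Rightarrow> 'a" and \<tau> :: "'a \<Rightarrow> complex"
  assumes ds: "cstar_dynamical_system \<alpha>" and \<tau>: "positive_functional \<tau>"
begin

lemma fock_seminorm_leI:
  assumes "0 \<le> K" "\<And>v. finite_support v \<Longrightarrow> fock_norm \<tau> (fock_rep \<alpha> f v) \<le> K * fock_norm \<tau> v"
  shows "fock_seminorm \<alpha> \<tau> f \<le> K"
  unfolding fock_seminorm_def by (rule cInf_lower) (use assms in \<open>auto intro!: bdd_belowI[of _ 0]\<close>)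

lemma fock_seminorm_nonneg: "0 \<le> fock_seminorm \<alpha> \<tau> f"
  unfolding fock_seminorm_def
  by (rule cInf_greatest) (use fock_rep_bounded[OF \<tau> ds, of f] in auto)

text \<open>Dividing by the norm of \<open>v\<close> gives a lower bound of all admissible
  constants; for a null vector any finite bound does the work instead.\<close>

lemma fock_norm_rep_le:
  assumes v: "finite_support v"
  shows "fock_norm \<tau> (fock_rep \<alpha> f v) \<le> fock_seminorm \<alpha> \<tau> f * fock_norm \<tau> v"
proof (cases "fock_norm \<tau> v = 0")
  case True
  obtain K where "fock_norm \<tau> (fock_rep \<alpha> f v) \<le> K * fock_norm \<tau> v"
    using fock_rep_bounded[OF \<tau> ds, of f] v by blast
  with True show ?thesis by simp
next
  case False
  then have pos: "fock_norm \<tau> v > 0" using fock_norm_nonneg[OF \<tau>, of v] by linarith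
  have "fock_norm \<tau> (fock_rep \<alpha> f v) / fock_norm \<tau> v \<le> fock_seminorm \<alpha> \<tau> f"
    unfolding fock_seminorm_def
    by (rule cInf_greatest) (use fock_rep_bounded[OF \<tau> ds, of f] v pos in \<open>auto simp: divide_simps\<close>)
  with pos show ?thesis by (simp add: divide_simps)
qed

lemma fock_seminorm_add: "fock_seminorm \<alpha> \<tau> (f + g) \<le> fock_seminorm \<alpha> \<tau> f + fock_seminorm \<alpha> \<tau> g"
proof (rule fock_seminorm_leI)
  fix v :: "'n list \<Rightarrow> 'a" assume v: "finite_support v"
  have "fock_norm \<tau> (fock_rep \<alpha> (f + g) v) \<le> fock_norm \<tau> (fock_rep \<alpha> f v) + fock_norm \<tau> (fock_rep \<alpha> g v)"
    using fock_norm_add[OF \<tau> finite_support_fock_rep[OF v] finite_support_fock_rep[OF v]]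
    by (simp add: fock_rep_add[abs_def])
  also have "\<dots> \<le> (fock_seminorm \<alpha> \<tau> f + fock_seminorm \<alpha> \<tau> g) * fock_norm \<tau> v"
    using fock_norm_rep_le[OF v, of f] fock_norm_rep_le[OF v, of g] by (simp add: distrib_right)
  finally show "fock_norm \<tau> (fock_rep \<alpha> (f + g) v) \<le> \<dots>" .
qed (simp add: fock_seminorm_nonneg)

lemma fock_seminorm_mult: "fock_seminorm \<alpha> \<tau> (f * g) \<le> fock_seminorm \<alpha> \<tau> f * fock_seminorm \<alpha> \<tau> g"
proof (rule fock_seminorm_leI)
  fix v :: "'n list \<Rightarrow> 'a" assume v: "finite_support v"
  show "fock_norm \<tau> (fock_rep \<alpha> (f * g) v) \<le> fock_seminorm \<alpha> \<tau> f * fock_seminorm \<alpha> \<tau> g * fock_norm \<tau> v"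
    using fock_norm_rep_le[OF finite_support_fock_rep[OF v], of f \<alpha> g]
      mult_left_mono[OF fock_norm_rep_le[OF v, of g] fock_seminorm_nonneg[of f]]
    by (simp add: fock_rep_mult mult.assoc)
qed (simp add: fock_seminorm_nonneg)

lemma fock_seminorm_scale_le: "fock_seminorm \<alpha> \<tau> (free_scale c f) \<le> cmod c * fock_seminorm \<alpha> \<tau> f"
proof (rule fock_seminorm_leI)
  fix v :: "'n list \<Rightarrow> 'a" assume v: "finite_support v"
  show "fock_norm \<tau> (fock_rep \<alpha> (free_scale c f) v) \<le> cmod c * fock_seminorm \<alpha> \<tau> f * fock_norm \<tau> v"
    using mult_left_mono[OF fock_norm_rep_le[OF v, of f], of "cmod c"]
    by (simp add: fock_rep_scale[abs_def] fock_norm_scaleC[OF \<tau> finite_support_fock_rep[OF v]] mult.assoc)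
qed (simp add: fock_seminorm_nonneg)

lemma fock_seminorm_scale: "fock_seminorm \<alpha> \<tau> (free_scale c f) = cmod c * fock_seminorm \<alpha> \<tau> f"
proof (cases "c = 0")
  case True
  then show ?thesis
    using fock_seminorm_scale_le[of c f] fock_seminorm_nonneg[of "free_scale c f"] by simp
next
  case False
  have "free_scale (inverse c) (free_scale c f) = (Poly_Mapping.single [] 1 * f :: ('a, 'n) free_star_algebra)"
    using False by (simp add: free_scale_def mult_single plus_list_def flip: mult.assoc)
  then have "free_scale (inverse c) (free_scale c f) = f"
    by (simp add: zero_list_def[symmetric])
  with fock_seminorm_scale_le[of "inverse c" "free_scale c f"] False
  have "cmod c * fock_seminorm \<alpha> \<tau> f \<le> fock_seminorm \<alpha> \<tau> (free_scale c f)"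
    by (simp add: norm_divide field_simps)
  with fock_seminorm_scale_le[of c f] show ?thesis by simp
qed

text \<open>The squared norm of f v is the inner product of (f* f) v with v, which Cauchy-Schwarz
  bounds by the seminorm of f* f. This is the half of the C*-identity that rests on the adjoint
  relation.\<close>

lemma fock_seminorm_square_le: "(fock_seminorm \<alpha> \<tau> f)\<^sup>2 \<le> fock_seminorm \<alpha> \<tau> (free_star f * f)"
proof -
  let ?p = "fock_seminorm \<alpha> \<tau> (free_star f * f)"
  have "fock_seminorm \<alpha> \<tau> f \<le> sqrt ?p"
  proof (rule fock_seminorm_leI)
    fix v :: "'n list \<Rightarrow> 'a" assume v: "finite_support v"
    note fv = finite_support_fock_rep[OF v]
    show "fock_norm \<tau> (fock_rep \<alpha> f v) \<le> sqrt ?p * fock_norm \<tau> v"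
    proof (rule power2_le_imp_le)
      have "(fock_norm \<tau> (fock_rep \<alpha> f v))\<^sup>2 = Re (fock_inner \<tau> (fock_rep \<alpha> (free_star f * f) v) v)"
        by (simp add: fock_norm_square[OF \<tau>] fock_rep_mult fock_rep_adjoint[OF \<tau> ds fv v])
      also have "\<dots> \<le> fock_norm \<tau> (fock_rep \<alpha> (free_star f * f) v) * fock_norm \<tau> v"
        using fock_cauchy_schwarz[OF \<tau> fv v] complex_Re_le_cmod order_trans by blast
      also have "\<dots> \<le> ?p * fock_norm \<tau> v * fock_norm \<tau> v"
        by (intro mult_right_mono fock_norm_rep_le v fock_norm_nonneg[OF \<tau>])
      finally show "(fock_norm \<tau> (fock_rep \<alpha> f v))\<^sup>2 \<le> (sqrt ?p * fock_norm \<tau> v)\<^sup>2"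
        using fock_seminorm_nonneg by (simp add: power_mult_distrib) (simp add: power2_eq_square)
    qed (simp add: fock_seminorm_nonneg fock_norm_nonneg[OF \<tau>])
  qed (simp add: fock_seminorm_nonneg)
  then show ?thesis
    using power_mono[OF _ fock_seminorm_nonneg, of f "sqrt ?p" 2] fock_seminorm_nonneg by simp
qed

lemma free_star_star: "free_star (free_star f) = (f :: ('a, 'n) free_star_algebra)"
proof -
  have "word_star (word_star w) = w" for w :: "(('a, 'n) generator \<times> bool) list"
    by (induction w) (auto simp: word_star_def)
  then have inj: "inj (word_star :: (('a, 'n) generator \<times> bool) list \<Rightarrow> _)" and
    ws: "\<And>w :: (('a, 'n) generator \<times> bool) list. word_star (word_star w) = w"
    by (auto intro: inj_on_inverseI)
  have "Poly_Mapping.lookup (free_star f) w = cnj (Poly_Mapping.lookup f (word_star w))"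
    for f :: "('a, 'n) free_star_algebra" and w
  proof -
    have "Poly_Mapping.lookup (free_star f) w =
        (\<Sum>x\<in>Poly_Mapping.keys f. if x = word_star w then cnj (Poly_Mapping.lookup f x) else 0)"
      unfolding free_star_def lookup_sum
      by (intro sum.cong refl) (use ws in \<open>auto simp: lookup_single when_def\<close>)
    also have "\<dots> = cnj (Poly_Mapping.lookup f (word_star w))"
      by (simp add: not_in_keys_iff_lookup_eq_zero)
    finally show ?thesis .
  qed
  then show ?thesis by (intro poly_mapping_eqI) (simp add: ws)
qed

text \<open>Combine \<open>fock_seminorm_square_le\<close> with submultiplicativity for
  \<open>free_star f * f\<close> and cancel one factor.\<close>

lemma fock_seminorm_star_le: "fock_seminorm \<alpha> \<tau> f \<le> fock_seminorm \<alpha> \<tau> (free_star f)"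
proof (cases "fock_seminorm \<alpha> \<tau> f = 0")
  case False
  then have "fock_seminorm \<alpha> \<tau> f > 0" using fock_seminorm_nonneg[of f] by linarith
  moreover have "fock_seminorm \<alpha> \<tau> f * fock_seminorm \<alpha> \<tau> f \<le> fock_seminorm \<alpha> \<tau> (free_star f) * fock_seminorm \<alpha> \<tau> f"
    using fock_seminorm_square_le[of f] fock_seminorm_mult[of "free_star f" f]
    by (simp add: power2_eq_square)
  ultimately show ?thesis by simp
qed (simp add: fock_seminorm_nonneg)

lemma cstar_seminorm_fock: "cstar_seminorm (fock_seminorm \<alpha> \<tau>)"
proof -
  have "fock_seminorm \<alpha> \<tau> (free_star f) = fock_seminorm \<alpha> \<tau> f" for f
    using fock_seminorm_star_le[of f] fock_seminorm_star_le[of "free_star f"] free_star_star[of f] by simp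
  then have "fock_seminorm \<alpha> \<tau> (free_star f * f) = (fock_seminorm \<alpha> \<tau> f)\<^sup>2" for f
    using fock_seminorm_square_le[of f] fock_seminorm_mult[of "free_star f" f]
    by (simp add: power2_eq_square)
  then show ?thesis
    by (simp add: cstar_seminorm_def fock_seminorm_add fock_seminorm_scale fock_seminorm_mult)
qed

lemma J_ideal_left: "a \<in> J_ideal \<alpha> \<Longrightarrow> b * a \<in> J_ideal \<alpha>"
  by (simp add: J_ideal_def annihilator_def mult.assoc)

lemma J_ideal_right: "a \<in> J_ideal \<alpha> \<Longrightarrow> a * b \<in> J_ideal \<alpha>"
  using ds by (simp add: J_ideal_def annihilator_def mult.assoc cstar_dynamical_system_def unital_star_hom_def)

text \<open>The defect projection \<open>1 - \<Sum>\<^sub>i S\<^sub>i S\<^sub>i\<^sup>*\<close> is the projection onto the vacuum summand, where \<open>a\<close>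
  acts as in the GNS representation of \<open>\<tau>\<close>.\<close>

lemma fock_norm_covariance_relator:
  assumes J: "\<And>a. a \<in> J_ideal \<alpha> \<Longrightarrow> \<tau> a = 0" and a: "a \<in> J_ideal \<alpha>"
  shows "fock_norm \<tau> (fock_rep \<alpha>
    (gen (Coef a) * (1 - (\<Sum>i\<in>UNIV. gen (Isom i) * free_star (gen (Isom i))))) v) = 0"
proof -
  have proj: "fock_rep \<alpha> (1 - (\<Sum>i\<in>UNIV. gen (Isom i) * free_star (gen (Isom i)))) v w =
      (if w = [] then v [] else 0)" for w
    by (cases w) (simp_all add: fock_rep_diff fock_rep_sum fock_rep_mult fock_rep_gen fock_rep_star_gen)
  have rep: "fock_rep \<alpha> (gen (Coef a) * (1 - (\<Sum>i\<in>UNIV. gen (Isom i) * free_star (gen (Isom i))))) v =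
      (\<lambda>w. if w = [] then a * v [] else 0)"
    by (simp add: fock_rep_mult fock_rep_gen proj fun_eq_iff)
  have "\<tau> (star (a * v []) * (a * v [])) = 0"
    using J_ideal_right[OF J_ideal_left[OF a, of "star (a * v [])"], of "v []"] J
    by (simp add: mult.assoc)
  moreover have "fock_inner \<tau> (\<lambda>w :: 'n list. if w = [] then a * v [] else 0) (\<lambda>w. if w = [] then a * v [] else 0) =
      \<tau> (star (a * v []) * (a * v []))"
    by (subst fock_inner_superset[OF \<tau>, of "{[]}"]) auto
  ultimately show ?thesis by (simp add: rep fock_norm_def)
qed

text \<open>Apart from the J-relators, every relator acts as the zero operator. A J-relator may
  leave a vacuum component, which is merely null for \<open>fock_norm\<close>; here the vanishing of
  \<tau> on J enters.\<close>

lemma fock_norm_relator: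
  assumes J: "\<And>a. a \<in> J_ideal \<alpha> \<Longrightarrow> \<tau> a = 0" and r: "r \<in> relators \<alpha>"
  shows "fock_norm \<tau> (fock_rep \<alpha> r v) = 0"
proof (cases "\<exists>a\<in>J_ideal \<alpha>. r = gen (Coef a) * (1 - (\<Sum>i\<in>UNIV. gen (Isom i) * free_star (gen (Isom i))))")
  case True
  with fock_norm_covariance_relator[OF J] show ?thesis by blast
next
  case False
  have h: "unital_star_hom (fold \<alpha> w)" for w using ds by (rule unital_star_hom_fold)
  from r False have "fock_rep \<alpha> r v w = 0" for w
    unfolding relators_def
    by (auto simp: fock_rep_diff fock_rep_add fock_rep_scale fock_rep_mult fock_rep_gen
        fock_rep_star_gen unital_star_hom_simps[OF h] distrib_right mult_scaleC_left mult.assoc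
        split: list.split)
  then have "fock_rep \<alpha> r v = (\<lambda>w. 0)" by (simp add: fun_eq_iff)
  then show ?thesis by (simp add: fock_norm_def fock_inner_def)
qed

text \<open>Maximality of the norm among the admissible C*-seminorms, applied to the Fock
  seminorm.\<close>

lemma fock_rep_le:
  assumes J: "\<And>a. a \<in> J_ideal \<alpha> \<Longrightarrow> \<tau> a = 0" and CP: "cuntz_pimsner \<alpha> \<iota> S" and v: "finite_support v"
  shows "fock_norm \<tau> (fock_rep \<alpha> f v) \<le> norm (free_eval \<iota> S f) * fock_norm \<tau> v"
proof -
  have "fock_seminorm \<alpha> \<tau> r = 0" if "r \<in> relators \<alpha>" for r
    using fock_seminorm_leI[of 0 r] fock_seminorm_nonneg[of r] fock_norm_relator[OF J that] by simp
  then have "fock_seminorm \<alpha> \<tau> f \<le> norm (free_eval \<iota> S f)"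
    using CP cstar_seminorm_fock unfolding cuntz_pimsner_def by blast
  then show ?thesis
    using fock_norm_rep_le[OF v, of f] fock_norm_nonneg[OF \<tau>, of v] mult_right_mono order_trans by blast
qed

end

section \<open>States on the Cuntz-Pimsner algebra\<close>

text \<open>Free of \<tau> and cut out by linear, pointwise closed equations, this is the common
  target for ground states and limits of KMS states. The vanishing on y S_i* follows by taking
  adjoints.\<close>

definition vacuum_states :: "('n \<Rightarrow> 'b::cstar_algebra) \<Rightarrow> ('b \<Rightarrow> complex) set" where
  "vacuum_states S = {\<phi> \<in> states. \<forall>i y. \<phi> (S i * y) = 0}"

context
  fixes \<alpha> :: "'n::finite \<Rightarrow> 'a::cstar_algebra \<Rightarrow> 'a" and \<iota> :: "'a \<Rightarrow> 'b::cstar_algebra" and S :: "'n \<Rightarrow> 'b"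
  assumes ds: "cstar_dynamical_system \<alpha>" and CP: "cuntz_pimsner \<alpha> \<iota> S"
begin

section \<open>Relations in the Cuntz-Pimsner algebra and the span of monomials\<close>

lemma covariant_\<iota>: "covariant \<alpha> \<iota> S"
  using CP by (simp add: cuntz_pimsner_def)

lemma hom_\<iota>: "unital_star_hom \<iota>"
  using covariant_\<iota> by (simp add: covariant_def)

lemmas \<iota>_simps = unital_star_hom_simps[OF hom_\<iota>]

lemma isom_relations:
  "star (S i) * S j = (if i = j then 1 else 0)"
  "\<iota> a * S i = S i * \<iota> (\<alpha> i a)"
  "star (S i) * \<iota> a = \<iota> (\<alpha> i a) * star (S i)"
  "a \<in> J_ideal \<alpha> \<Longrightarrow> \<iota> a = (\<Sum>i\<in>UNIV. \<iota> a * S i * star (S i))"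
proof -
  show "star (S i) * S j = (if i = j then 1 else 0)" and c: "\<And>a. \<iota> a * S i = S i * \<iota> (\<alpha> i a)"
    using covariant_\<iota> by (auto simp: covariant_def)
  have "star (\<iota> (star a) * S i) = star (S i * \<iota> (\<alpha> i (star a)))" by (simp only: c)
  then show "star (S i) * \<iota> a = \<iota> (\<alpha> i a) * star (S i)"
    using ds by (simp add: star_mult \<iota>_simps star_star cstar_dynamical_system_def unital_star_hom_def)
  show "\<iota> a = (\<Sum>i\<in>UNIV. \<iota> a * S i * star (S i))" if "a \<in> J_ideal \<alpha>"
  proof -
    have "\<iota> a * (1 - (\<Sum>i\<in>UNIV. S i * star (S i))) = 0"
      using covariant_\<iota> that unfolding covariant_def by blast
    then show ?thesis by (simp add: right_diff_distrib sum_distrib_left mult.assoc)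
  qed
qed

lemma isom_cancel: "star (S i) * (S j * x) = (if i = j then x else 0)"
  using isom_relations(1)[of i j] by (auto simp flip: mult.assoc)

lemma \<iota>_mult_isom_word: "\<iota> a * prod_list (map S \<mu>) = prod_list (map S \<mu>) * \<iota> (fold \<alpha> \<mu> a)"
proof (induction \<mu> arbitrary: a)
  case (Cons i \<mu>)
  have "\<iota> a * prod_list (map S (i # \<mu>)) = S i * (\<iota> (\<alpha> i a) * prod_list (map S \<mu>))"
    by (simp add: isom_relations(2) flip: mult.assoc)
  then show ?case by (simp add: Cons mult.assoc)
qed simp

text \<open>The normal form survives: a coefficient is pushed through the isometries of \<mu>, an
  isometry lengthens \<mu>, and an adjoint meets the first letter of \<mu> or, if \<mu> is empty,
  crosses the coefficient.\<close>

lemma letter_mult_monomial: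
  "letter_eval \<iota> S l * monomial \<iota> S \<mu> a \<nu> \<in> insert 0 {monomial \<iota> S \<mu> a \<nu> | \<mu> a \<nu>. True}"
proof -
  obtain g b where l: "l = (g, b)" by (cases l)
  show ?thesis
  proof (cases g)
    case (Coef c)
    define d where "d = (if b then star c else c)"
    have "letter_eval \<iota> S l = \<iota> d" by (simp add: l Coef d_def \<iota>_simps)
    then have "letter_eval \<iota> S l * monomial \<iota> S \<mu> a \<nu> = monomial \<iota> S \<mu> (fold \<alpha> \<mu> d * a) \<nu>"
      using \<iota>_mult_isom_word[of d \<mu>] by (simp add: monomial_def \<iota>_simps flip: mult.assoc)
    then show ?thesis by blast
  next
    case (Isom i)
    show ?thesis
    proof (cases b)
      case False
      then have "letter_eval \<iota> S l * monomial \<iota> S \<mu> a \<nu> = monomial \<iota> S (i # \<mu>) a \<nu>"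
        by (simp add: l Isom monomial_def mult.assoc)
      then show ?thesis by blast
    next
      case True
      show ?thesis
      proof (cases \<mu>)
        case Nil
        \<comment> \<open>Adjoints reverse products, so a new adjoint on the left appends i at the
          right end of \<nu>.\<close>
        have "letter_eval \<iota> S l * monomial \<iota> S \<mu> a \<nu> = monomial \<iota> S [] (\<alpha> i a) (\<nu> @ [i])"
          using isom_relations(3)[of i a] True
          by (simp add: l Isom Nil monomial_def star_mult flip: mult.assoc)
        then show ?thesis by blast
      next
        case (Cons j \<mu>')
        have "letter_eval \<iota> S l * monomial \<iota> S \<mu> a \<nu> = (if i = j then monomial \<iota> S \<mu>' a \<nu> else 0)"
          using True by (simp add: l Isom Cons monomial_def mult.assoc isom_cancel)
        then show ?thesis by auto
      qed
    qed
  qed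
qed

lemma word_eval_monomial:
  "prod_list (map (letter_eval \<iota> S) w) \<in> insert 0 {monomial \<iota> S \<mu> a \<nu> | \<mu> a \<nu>. True}"
proof (induction w)
  case Nil
  have "monomial \<iota> S [] 1 [] = 1" by (simp add: monomial_def \<iota>_simps)
  then show ?case by auto
next
  case (Cons l w)
  show ?case
  proof (cases "prod_list (map (letter_eval \<iota> S) w) = 0")
    case False
    then obtain \<mu> a \<nu> where "prod_list (map (letter_eval \<iota> S) w) = monomial \<iota> S \<mu> a \<nu>"
      using Cons by blast
    then show ?thesis using letter_mult_monomial[of l \<mu> a \<nu>] by simp
  qed simp
qed

lemma range_free_eval_add: "x \<in> range (free_eval \<iota> S) \<Longrightarrow> y \<in> range (free_eval \<iota> S) \<Longrightarrow> x + y \<in> range (free_eval \<iota> S)"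
  and range_free_eval_mult: "x \<in> range (free_eval \<iota> S) \<Longrightarrow> y \<in> range (free_eval \<iota> S) \<Longrightarrow> x * y \<in> range (free_eval \<iota> S)"
  and range_free_eval_star: "x \<in> range (free_eval \<iota> S) \<Longrightarrow> star x \<in> range (free_eval \<iota> S)"
  and range_free_eval_scale: "x \<in> range (free_eval \<iota> S) \<Longrightarrow> c *\<^sub>C x \<in> range (free_eval \<iota> S)"
  by (auto simp flip: free_eval_add free_eval_mult free_eval_star free_eval_scale)

lemma range_free_eval_gen: "\<iota> a \<in> range (free_eval \<iota> S)" "S i \<in> range (free_eval \<iota> S)"
    "1 \<in> range (free_eval \<iota> S)" "0 \<in> range (free_eval \<iota> S)"
  using rangeI[of "free_eval \<iota> S" "gen (Coef a)"] rangeI[of "free_eval \<iota> S" "gen (Isom i)"]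
    rangeI[of "free_eval \<iota> S" 1] rangeI[of "free_eval \<iota> S" 0]
  by simp_all

lemma isom_word_in_range: "prod_list (map S \<mu>) \<in> range (free_eval \<iota> S)"
proof (induction \<mu>)
  case (Cons i \<mu>)
  then show ?case using range_free_eval_mult[OF range_free_eval_gen(2)] by simp
qed (simp add: range_free_eval_gen)

text \<open>Words reduce to monomials or zero. The identification gives the span its *-algebra
  structure and its density.\<close>

lemma monomial_span_eq: "monomial_span \<iota> S = range (free_eval \<iota> S)"
proof
  show "monomial_span \<iota> S \<subseteq> range (free_eval \<iota> S)"
    unfolding monomial_span_def
  proof (rule module.span_minimal[OF module_scaleC])
    show "{monomial \<iota> S \<mu> a \<nu> | \<mu> a \<nu>. True} \<subseteq> range (free_eval \<iota> S)"
    proof clarify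
      show "monomial \<iota> S \<mu> a \<nu> \<in> range (free_eval \<iota> S)" for \<mu> a \<nu>
        unfolding monomial_def
        by (intro range_free_eval_mult range_free_eval_star range_free_eval_gen isom_word_in_range)
    qed
    show "module.subspace scaleC (range (free_eval \<iota> S))"
      by (intro module.subspaceI[OF module_scaleC] range_free_eval_add range_free_eval_scale range_free_eval_gen)
  qed
  have "prod_list (map (letter_eval \<iota> S) w) \<in> monomial_span \<iota> S" for w
    using word_eval_monomial[of w] module.span_zero[OF module_scaleC]
    by (auto simp: monomial_span_def intro: module.span_base[OF module_scaleC])
  then show "range (free_eval \<iota> S) \<subseteq> monomial_span \<iota> S"
    unfolding free_eval_def monomial_span_def
    by (auto intro!: module.span_sum[OF module_scaleC] module.span_scale[OF module_scaleC])
qed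

lemma monomial_in_span: "monomial \<iota> S \<mu> a \<nu> \<in> monomial_span \<iota> S"
  unfolding monomial_span_def by (rule module.span_base[OF module_scaleC]) blast

lemma closure_monomial_span: "closure (monomial_span \<iota> S) = UNIV"
  using CP by (simp add: monomial_span_eq cuntz_pimsner_def)

lemma monomial_span_induct [consumes 1, case_names zero step]:
  assumes "x \<in> monomial_span \<iota> S" "P 0"
    and "\<And>c \<mu> a \<nu> y. y \<in> monomial_span \<iota> S \<Longrightarrow> P y \<Longrightarrow> P (c *\<^sub>C monomial \<iota> S \<mu> a \<nu> + y)"
  shows "P x"
proof -
  have "x \<in> monomial_span \<iota> S \<and> P x"
    using assms(1) unfolding monomial_span_def
  proof (rule module.span_induct_alt[OF module_scaleC])
    show "0 \<in> module.span scaleC {monomial \<iota> S \<mu> a \<nu> |\<mu> a \<nu>. True} \<and> P 0"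
      using assms(2) module.span_zero[OF module_scaleC] by blast
    fix c x y
    assume x: "x \<in> {monomial \<iota> S \<mu> a \<nu> |\<mu> a \<nu>. True}"
      and y: "y \<in> module.span scaleC {monomial \<iota> S \<mu> a \<nu> |\<mu> a \<nu>. True} \<and> P y"
    then show "c *\<^sub>C x + y \<in> module.span scaleC {monomial \<iota> S \<mu> a \<nu> |\<mu> a \<nu>. True} \<and> P (c *\<^sub>C x + y)"
      using assms(3) module.span_base[OF module_scaleC x]
      by (auto simp: monomial_span_def intro!: module.span_add[OF module_scaleC] module.span_scale[OF module_scaleC])
  qed
  then show ?thesis ..
qed

lemma closed_density_induct:
  assumes "closed {x. P x}" "\<And>x. x \<in> monomial_span \<iota> S \<Longrightarrow> P x"
  shows "P x"
  using closure_minimal[of "monomial_span \<iota> S" "{x. P x}"] assms closure_monomial_span by auto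

lemma eq_of_eq_on_monomials:
  fixes L M :: "'b \<Rightarrow> complex"
  assumes L: "continuous_on UNIV L" "\<And>x y. L (x + y) = L x + L y" "\<And>c x. L (c *\<^sub>C x) = c * L x"
    and M: "continuous_on UNIV M" "\<And>x y. M (x + y) = M x + M y" "\<And>c x. M (c *\<^sub>C x) = c * M x"
    and eq: "\<And>\<mu> a \<nu>. L (monomial \<iota> S \<mu> a \<nu>) = M (monomial \<iota> S \<mu> a \<nu>)"
  shows "L x = M x"
proof (rule closed_density_induct)
  show "closed {x. L x = M x}" by (intro closed_Collect_eq L M)
  show "L x = M x" if "x \<in> monomial_span \<iota> S" for x
    using that
  proof (induction rule: monomial_span_induct)
    case zero
    then show ?case using L(3)[of 0 0] M(3)[of 0 0] by simp
  qed (simp add: L M eq)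
qed

lemma continuous_on_state: "\<phi> \<in> states \<Longrightarrow> continuous_on X (\<phi> :: 'b \<Rightarrow> complex)"
  using bounded_linear_pf[of \<phi>] by (simp add: states_iff linear_continuous_on)

section \<open>Vacuum states and their restrictions to A\<close>

text \<open>Monomials with nonempty \<mu> start with some S_i; those with \<mu> empty and \<nu>
  nonempty are adjoints of such, and states respect adjoints. So the one-sided vacuum condition
  already encodes all prescribed zeros.\<close>

lemma is_phi_iff:
  "is_phi \<iota> S \<tau> \<phi> \<longleftrightarrow> \<phi> \<in> vacuum_states S \<and> (\<forall>a. \<phi> (\<iota> a) = \<tau> a)"
proof
  assume phi: "is_phi \<iota> S \<tau> \<phi>"
  then have st: "\<phi> \<in> states" and pf: "positive_functional \<phi>" by (auto simp: is_phi_def states_iff)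
  have "\<phi> (S i * y) = 0" for i y
  proof (rule eq_of_eq_on_monomials[where L = "\<lambda>y. \<phi> (S i * y)" and M = "\<lambda>_. 0"])
    show "continuous_on UNIV (\<lambda>y. \<phi> (S i * y))"
      by (rule continuous_on_compose2[OF continuous_on_state[OF st] _ subset_UNIV]) (intro continuous_intros)
    have "S i * monomial \<iota> S \<mu> a \<nu> = monomial \<iota> S (i # \<mu>) a \<nu>" for \<mu> a \<nu>
      by (simp add: monomial_def mult.assoc)
    then show "\<phi> (S i * monomial \<iota> S \<mu> a \<nu>) = 0" for \<mu> a \<nu>
      using phi by (simp add: is_phi_def)
  qed (simp_all add: distrib_left pf_add[OF pf] mult_scaleC_right pf_scaleC[OF pf])
  moreover have "\<phi> (monomial \<iota> S [] a []) = \<tau> a" for a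
    using phi by (simp add: is_phi_def)
  then have "\<phi> (\<iota> a) = \<tau> a" for a by (simp add: monomial_def)
  ultimately show "\<phi> \<in> vacuum_states S \<and> (\<forall>a. \<phi> (\<iota> a) = \<tau> a)"
    using st by (simp add: vacuum_states_def)
next
  assume v: "\<phi> \<in> vacuum_states S \<and> (\<forall>a. \<phi> (\<iota> a) = \<tau> a)"
  then have st: "\<phi> \<in> states" and pf: "positive_functional \<phi>" by (auto simp: vacuum_states_def states_iff)
  have 1: "\<phi> (monomial \<iota> S (i # \<mu>) a \<nu>) = 0" for i \<mu> a \<nu>
    using v by (simp add: vacuum_states_def monomial_def mult.assoc)
  have "\<phi> (monomial \<iota> S \<mu> a \<nu>) = (if \<mu> = [] \<and> \<nu> = [] then \<tau> a else 0)" for \<mu> a \<nu>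
  proof (cases \<mu>)
    case Nil
    show ?thesis
    proof (cases \<nu>)
      case (Cons j \<nu>')
      have "star (monomial \<iota> S [] a \<nu>) = monomial \<iota> S \<nu> (star a) []"
        by (simp add: monomial_def star_mult star_star \<iota>_simps)
      then have "cnj (\<phi> (monomial \<iota> S [] a \<nu>)) = 0"
        using pf_star[OF pf, of "monomial \<iota> S [] a \<nu>"] by (simp add: 1 Cons)
      then show ?thesis by (simp add: Nil Cons)
    qed (use v Nil in \<open>simp add: monomial_def\<close>)
  qed (simp add: 1)
  with st show "is_phi \<iota> S \<tau> \<phi>" by (simp add: is_phi_def)
qed

lemma is_phi_unique: "is_phi \<iota> S \<tau> \<phi> \<Longrightarrow> is_phi \<iota> S \<tau> \<psi> \<Longrightarrow> \<phi> = \<psi>"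
proof
  fix x assume p: "is_phi \<iota> S \<tau> \<phi>" "is_phi \<iota> S \<tau> \<psi>"
  then have st: "\<phi> \<in> states" "\<psi> \<in> states"
    and eq: "\<And>\<mu> a \<nu>. \<phi> (monomial \<iota> S \<mu> a \<nu>) = \<psi> (monomial \<iota> S \<mu> a \<nu>)"
    by (auto simp: is_phi_def)
  then have pf: "positive_functional \<phi>" "positive_functional \<psi>" by (auto simp: states_iff)
  show "\<phi> x = \<psi> x"
    by (rule eq_of_eq_on_monomials[where L = \<phi> and M = \<psi>])
       (simp_all add: st eq continuous_on_state pf_add[OF pf(1)] pf_add[OF pf(2)]
          pf_scaleC[OF pf(1)] pf_scaleC[OF pf(2)])
qed

text \<open>For a in J the Cuntz-Pimsner relation rewrites \<open>\<iota> a\<close> as the sum of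
  the elements \<open>S i * \<iota> (\<alpha> i a) * star (S i)\<close>, each killed by a vacuum
  state. This is the necessity of vanishing on J.\<close>

lemma vacuum_state_restrict:
  assumes "\<phi> \<in> vacuum_states S"
  shows "(\<lambda>a. \<phi> (\<iota> a)) \<in> vanishing_on (J_ideal \<alpha>) states"
proof -
  have pf: "positive_functional \<phi>" and 1: "\<phi> 1 = 1" and v: "\<phi> (S i * y) = 0" for i y
    using assms by (auto simp: vacuum_states_def states_iff)
  have "\<phi> (\<iota> a) = 0" if "a \<in> J_ideal \<alpha>" for a
  proof -
    have "\<phi> (\<iota> a) = \<phi> (\<Sum>i\<in>UNIV. \<iota> a * S i * star (S i))" using isom_relations(4)[OF that] by simp
    also have "\<dots> = 0" by (simp add: pf_sum[OF pf] isom_relations(2) mult.assoc v)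
    finally show ?thesis .
  qed
  then show ?thesis
    using positive_functional_compose_hom[OF pf hom_\<iota>] 1
    by (simp add: vanishing_on_def states_iff \<iota>_simps)
qed

text \<open>The vacuum functional is bounded by the norm of the evaluated element, so it descends
  along the dense evaluation map and extends by uniform continuity.\<close>

lemma is_phi_exists:
  assumes "\<tau> \<in> vanishing_on (J_ideal \<alpha>) states"
  shows "\<exists>\<phi>. is_phi \<iota> S \<tau> \<phi>"
proof -
  have \<tau>: "positive_functional \<tau>" "\<tau> 1 = 1" and J: "\<And>a. a \<in> J_ideal \<alpha> \<Longrightarrow> \<tau> a = 0"
    using assms by (auto simp: vanishing_on_def states_iff)
  let ?E = "free_eval \<iota> S" and ?X = "range (free_eval \<iota> S)"
  have dense: "closure ?X = UNIV" using CP by (simp add: cuntz_pimsner_def)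
  \<comment> \<open>The vacuum vector: pairing with it reads off \<tau> of the component at the
    empty word.\<close>
  define \<xi> :: "'n list \<Rightarrow> 'a" where "\<xi> w = (if w = [] then 1 else 0)" for w
  have \<xi>: "finite_support \<xi>" by (simp add: finite_support_def \<xi>_def)
  have inner_\<xi>: "fock_inner \<tau> \<xi> v = \<tau> (v [])" for v
    by (subst fock_inner_superset[OF \<tau>(1), of "{[]}"]) (auto simp: \<xi>_def)
  then have norm_\<xi>: "fock_norm \<tau> \<xi> = 1" by (simp add: fock_norm_def \<tau>) (simp add: \<xi>_def \<tau>)
  define \<Lambda> where "\<Lambda> f = \<tau> (fock_rep \<alpha> f \<xi> [])" for f
  have \<Lambda>_le: "cmod (\<Lambda> f) \<le> norm (?E f)" for f
    using fock_cauchy_schwarz[OF \<tau>(1) \<xi> finite_support_fock_rep[OF \<xi>, of \<alpha> f]]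
      fock_rep_le[OF ds \<tau>(1) J CP \<xi>, of f]
    by (simp add: inner_\<xi> norm_\<xi> \<Lambda>_def)
  have \<Lambda>_diff: "\<Lambda> (f - g) = \<Lambda> f - \<Lambda> g" and \<Lambda>_add: "\<Lambda> (f + g) = \<Lambda> f + \<Lambda> g"
    and \<Lambda>_scale: "\<Lambda> (free_scale c f) = c * \<Lambda> f" for f g c
    by (simp_all add: \<Lambda>_def fock_rep_diff fock_rep_add fock_rep_scale
        pf_add[OF \<tau>(1)] pf_diff[OF \<tau>(1)] pf_scaleC[OF \<tau>(1)])
  have \<Lambda>_pos: "\<Lambda> (free_star f * f) \<in> \<real>\<^sub>\<ge>\<^sub>0" for f
  proof -
    let ?v = "fock_rep \<alpha> f \<xi>"
    have v: "finite_support ?v" using \<xi> by (rule finite_support_fock_rep)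
    have "\<Lambda> (free_star f * f) = fock_inner \<tau> \<xi> (fock_rep \<alpha> (free_star f) ?v)"
      by (simp add: \<Lambda>_def inner_\<xi> fock_rep_mult)
    also have "\<dots> = cnj (fock_inner \<tau> ?v ?v)"
      using fock_inner_cnj[OF \<tau>(1) finite_support_fock_rep[OF v] \<xi>] fock_rep_adjoint[OF \<tau>(1) ds v \<xi>]
      by simp
    finally show ?thesis
      using fock_inner_self[OF \<tau>(1), of ?v] by (simp add: complex_nonneg_Reals_iff)
  qed
  \<comment> \<open>The preimage picked by \<open>SOME\<close> is immaterial, because \<Lambda>
    vanishes where the evaluation does.\<close>
  define \<phi>0 where "\<phi>0 x = \<Lambda> (SOME f. ?E f = x)" for x
  have \<phi>0: "\<phi>0 (?E f) = \<Lambda> f" for f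
  proof -
    have "?E (SOME g. ?E g = ?E f) = ?E f" by (rule someI) simp
    then have "cmod (\<Lambda> ((SOME g. ?E g = ?E f) - f)) \<le> 0"
      using \<Lambda>_le[of "(SOME g. ?E g = ?E f) - f"] by (simp add: free_eval_diff)
    then show ?thesis by (simp add: \<phi>0_def \<Lambda>_diff)
  qed
  have "uniformly_continuous_on ?X \<phi>0"
    unfolding uniformly_continuous_on_def
  proof (intro allI impI)
    fix e :: real assume "e > 0"
    moreover have "dist (\<phi>0 x') (\<phi>0 x) \<le> dist x' x" if "x \<in> ?X" "x' \<in> ?X" for x x'
    proof -
      from that obtain f g where "x = ?E f" "x' = ?E g" by blast
      then show ?thesis using \<Lambda>_le[of "g - f"] by (simp add: \<phi>0 dist_norm free_eval_diff \<Lambda>_diff)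
    qed
    ultimately show "\<exists>d>0. \<forall>x\<in>?X. \<forall>x'\<in>?X. dist x' x < d \<longrightarrow> dist (\<phi>0 x') (\<phi>0 x) < e"
      by (meson le_less_trans)
  qed
  then obtain \<phi> where uc: "uniformly_continuous_on (closure ?X) \<phi>"
      and ext: "\<And>x. x \<in> ?X \<Longrightarrow> \<phi>0 x = \<phi> x"
    using uniformly_continuous_on_extension_on_closure[of ?X \<phi>0] by metis
  from uc have cont: "continuous_on UNIV \<phi>"
    by (simp add: dense uniformly_continuous_imp_continuous)
  have \<phi>: "\<phi> (?E f) = \<Lambda> f" for f using ext[of "?E f"] \<phi>0[of f] by simp
  have all: "P x" if "closed {x. P x}" "\<And>f. P (?E f)" for P and x :: 'b
    using closure_minimal[of ?X "{x. P x}"] that dense by auto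
  note [continuous_intros] = continuous_on_compose2[OF cont _ subset_UNIV]
    continuous_on_compose2[OF continuous_on_star _ subset_UNIV]
    continuous_on_compose2[OF continuous_on_scaleC _ subset_UNIV]
  have "\<phi> (x + y) = \<phi> x + \<phi> y" for x y
  proof (rule all[where x = x])
    show "\<phi> (?E f + y) = \<phi> (?E f) + \<phi> y" for f
      by (rule all[where x = y])
         (auto intro!: closed_Collect_eq continuous_intros simp: \<phi> \<Lambda>_add simp flip: free_eval_add)
  qed (auto intro!: closed_Collect_eq continuous_intros)
  moreover have "\<phi> (c *\<^sub>C x) = c * \<phi> x" for c x
    by (rule all[where x = x])
       (auto intro!: closed_Collect_eq continuous_intros simp: \<phi> \<Lambda>_scale simp flip: free_eval_scale)
  moreover have "\<phi> (star x * x) \<in> \<real>\<^sub>\<ge>\<^sub>0" for x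
  proof (rule all[where x = x])
    have "closed ((\<lambda>x. \<phi> (star x * x)) -` \<real>\<^sub>\<ge>\<^sub>0)"
      by (intro closed_vimage closed_nonneg_Reals_complex continuous_intros)
    then show "closed {x. \<phi> (star x * x) \<in> \<real>\<^sub>\<ge>\<^sub>0}" by (simp add: vimage_def)
    show "\<phi> (star (?E f) * ?E f) \<in> \<real>\<^sub>\<ge>\<^sub>0" for f
      using \<Lambda>_pos[of f] by (simp add: \<phi> flip: free_eval_star free_eval_mult)
  qed
  moreover have \<iota>: "\<phi> (\<iota> a) = \<tau> a" for a
    using \<phi>[of "gen (Coef a)"] by (simp add: \<Lambda>_def fock_rep_gen \<xi>_def)
  moreover have "\<phi> 1 = 1" using \<iota>[of 1] by (simp add: \<iota>_simps \<tau>)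
  \<comment> \<open>Creation operators leave no component at the empty word.\<close>
  moreover have "\<phi> (S i * y) = 0" for i y
  proof (rule all[where x = y])
    show "\<phi> (S i * ?E f) = 0" for f
      using \<phi>[of "gen (Isom i) * f"] by (simp add: \<Lambda>_def fock_rep_mult fock_rep_gen free_eval_mult pf_zero[OF \<tau>(1)])
  qed (auto intro!: closed_Collect_eq continuous_intros)
  ultimately have "is_phi \<iota> S \<tau> \<phi>"
    unfolding is_phi_iff by (simp add: vacuum_states_def states_def)
  then show ?thesis by blast
qed

lemma is_phi_phi:
  assumes "\<tau> \<in> vanishing_on (J_ideal \<alpha>) states"
  shows "is_phi \<iota> S \<tau> (phi \<iota> S \<tau>)"
  unfolding phi_def using is_phi_exists[OF assms] is_phi_unique by (metis theI)

lemma phi_restrict: "\<phi> \<in> vacuum_states S \<Longrightarrow> phi \<iota> S (\<lambda>a. \<phi> (\<iota> a)) = \<phi>"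
  by (rule is_phi_unique[OF is_phi_phi[OF vacuum_state_restrict]]) (simp_all add: is_phi_iff)

end

section \<open>Complex linear functionals and entire extensions\<close>

text \<open>Testing against such functionals turns vector-valued entire functions into scalar
  holomorphic ones. Complex homogeneity is a separate clause because \<open>bounded_linear\<close>
  is real-linear.\<close>

definition bounded_clinear_functional :: "('b::cstar_algebra \<Rightarrow> complex) \<Rightarrow> bool" where
  "bounded_clinear_functional L \<longleftrightarrow> bounded_linear L \<and> (\<forall>c x. L (c *\<^sub>C x) = c * L x)"

lemma bounded_clinear_state:
  assumes "\<phi> \<in> states"
  shows "bounded_clinear_functional (\<lambda>y. \<phi> (x * y * x'))"
proof -
  have pf: "positive_functional \<phi>" using assms by (simp add: states_iff)
  have "bounded_linear (\<lambda>y. \<phi> (x * y * x'))"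
    using bounded_linear_compose[OF bounded_linear_pf[OF pf]
      bounded_linear_compose[OF bounded_linear_mult_left bounded_linear_mult_right]] .
  then show ?thesis
    by (simp add: bounded_clinear_functional_def mult_scaleC_left mult_scaleC_right pf_scaleC[OF pf])
qed

lemma bounded_linear_scaleC_left: "bounded_linear (\<lambda>c. c *\<^sub>C (x::'b::cstar_algebra))"
proof (rule bounded_linear_intro[where K = "norm x"])
  show "(r *\<^sub>R c) *\<^sub>C x = r *\<^sub>R (c *\<^sub>C x)" for r c
    using scaleC_of_real[of r "c *\<^sub>C x"] by (simp add: scaleC_scaleC scaleR_conv_of_real[of r c])
qed (simp_all add: scaleC_add_left norm_scaleC)

lemma entire_exp: "entire (\<lambda>w. exp (k * w) *\<^sub>C (x::'b::cstar_algebra))"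
  unfolding entire_def
proof
  fix z
  have "((\<lambda>w. exp (k * w)) has_field_derivative k * exp (k * z)) (at z)"
    by (auto intro!: derivative_eq_intros)
  then have "((\<lambda>h. (exp (k * (z + h)) - exp (k * z)) / h) \<longlongrightarrow> k * exp (k * z)) (at 0)"
    by (simp add: DERIV_def)
  then have "((\<lambda>h. ((exp (k * (z + h)) - exp (k * z)) / h) *\<^sub>C x) \<longlongrightarrow> (k * exp (k * z)) *\<^sub>C x) (at 0)"
    by (rule bounded_linear.tendsto[OF bounded_linear_scaleC_left])
  moreover have "((exp (k * (z + h)) - exp (k * z)) / h) *\<^sub>C x =
      inverse h *\<^sub>C (exp (k * (z + h)) *\<^sub>C x - exp (k * z) *\<^sub>C x)" for h
    using scaleC_add_left[of "exp (k * (z + h)) - exp (k * z)" "exp (k * z)" x]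
    by (simp add: scaleC_scaleC divide_inverse mult.commute)
  ultimately show "\<exists>D. ((\<lambda>h. inverse h *\<^sub>C (exp (k * (z + h)) *\<^sub>C x - exp (k * z) *\<^sub>C x)) \<longlongrightarrow> D) (at 0)"
    by auto
qed

lemma entire_add:
  assumes "entire f" "entire g"
  shows "entire (\<lambda>w. f w + g w)"
  unfolding entire_def
proof
  fix z
  obtain D E where "((\<lambda>h. inverse h *\<^sub>C (f (z + h) - f z)) \<longlongrightarrow> D) (at 0)"
      "((\<lambda>h. inverse h *\<^sub>C (g (z + h) - g z)) \<longlongrightarrow> E) (at 0)"
    using assms unfolding entire_def by blast
  from tendsto_add[OF this]
  have "((\<lambda>h. inverse h *\<^sub>C (f (z + h) + g (z + h) - (f z + g z))) \<longlongrightarrow> D + E) (at 0)"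
    by (simp add: add_diff_add flip: scaleC_add_right)
  then show "\<exists>D. ((\<lambda>h. inverse h *\<^sub>C (f (z + h) + g (z + h) - (f z + g z))) \<longlongrightarrow> D) (at 0)" ..
qed

lemma holomorphic_functional_entire:
  assumes L: "bounded_clinear_functional L" and f: "entire f"
  shows "(\<lambda>z. L (f z)) holomorphic_on X"
proof -
  have bl: "bounded_linear L" and sc: "L (c *\<^sub>C x) = c * L x" for c x
    using L by (auto simp: bounded_clinear_functional_def)
  interpret L: bounded_linear L by (rule bl)
  have "(\<lambda>z. L (f z)) field_differentiable (at z)" for z
  proof -
    obtain D where "((\<lambda>h. inverse h *\<^sub>C (f (z + h) - f z)) \<longlongrightarrow> D) (at 0)"
      using f unfolding entire_def by blast
    from L.tendsto[OF this] have "((\<lambda>z. L (f z)) has_field_derivative L D) (at z)"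
      by (simp add: DERIV_def sc L.diff divide_inverse mult.commute)
    then show ?thesis by (auto simp: field_differentiable_def)
  qed
  then show ?thesis
    by (auto simp: holomorphic_on_def intro: field_differentiable_at_within)
qed

text \<open>Identity theorem: the reals accumulate at 0.\<close>

lemma holomorphic_eq_of_eq_on_reals:
  assumes "f holomorphic_on UNIV" "g holomorphic_on UNIV" "\<And>t. f (complex_of_real t) = g (of_real t)"
  shows "f z = g z"
proof -
  have lim: "(0::complex) islimpt \<real>"
    unfolding islimpt_approachable
  proof (intro allI impI)
    fix e :: real assume "e > 0"
    then show "\<exists>x'\<in>\<real>. x' \<noteq> 0 \<and> dist x' (0::complex) < e"
      by (intro bexI[of _ "of_real (e / 2)"]) (auto simp: norm_divide)
  qed
  have "f z - g z = 0"
    by (rule analytic_continuation[where f = "\<lambda>z. f z - g z" and S = UNIV, OF _ _ _ _ _ lim])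
       (use assms in \<open>auto intro!: holomorphic_intros elim!: Reals_cases\<close>)
  then show ?thesis by simp
qed

lemma entire_extension_complex_flow:
  assumes "x \<in> analytic_elements \<sigma>"
  shows "entire_extension \<sigma> x (\<lambda>z. complex_flow \<sigma> z x)"
  using assms someI_ex[of "entire_extension \<sigma> x"] by (simp add: analytic_elements_def complex_flow_def)

text \<open>Makes the choice in \<open>complex_flow\<close> computable: any explicit extension may
  replace it under a functional, because the two agree on the real line.\<close>

lemma functional_complex_flow:
  assumes L: "bounded_clinear_functional L" and f: "entire_extension \<sigma> x f"
  shows "L (complex_flow \<sigma> z x) = L (f z)"
proof (rule holomorphic_eq_of_eq_on_reals[where f = "\<lambda>z. L (complex_flow \<sigma> z x)" and g = "\<lambda>z. L (f z)"])
  have g: "entire_extension \<sigma> x (\<lambda>z. complex_flow \<sigma> z x)"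
    using f by (intro entire_extension_complex_flow) (auto simp: analytic_elements_def)
  show "(\<lambda>z. L (complex_flow \<sigma> z x)) holomorphic_on UNIV" "(\<lambda>z. L (f z)) holomorphic_on UNIV"
    using f g by (auto intro!: holomorphic_functional_entire[OF L] simp: entire_extension_def)
  show "L (complex_flow \<sigma> (of_real t) x) = L (f (of_real t))" for t
    using f g by (simp add: entire_extension_def)
qed

section \<open>The gauge flow\<close>

context
  fixes \<alpha> :: "'n::finite \<Rightarrow> 'a::cstar_algebra \<Rightarrow> 'a" and \<iota> :: "'a \<Rightarrow> 'b::cstar_algebra" and S :: "'n \<Rightarrow> 'b"
  assumes ds: "cstar_dynamical_system \<alpha>" and CP: "cuntz_pimsner \<alpha> \<iota> S"
begin

text \<open>The relations contain S_i only through S_i* S_j, S_i S_i* and an identity of degree one,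
  so a factor of modulus one preserves covariance. Automatic continuity reconciles uniqueness here
  with that in the universal property.\<close>

lemma ex1_gauge_hom:
  assumes z: "cmod z = 1"
  shows "\<exists>!g. unital_star_hom g \<and> (\<forall>a. g (\<iota> a) = \<iota> a) \<and> (\<forall>i. g (S i) = z *\<^sub>C S i)"
proof -
  have zz: "z * cnj z = 1" using complex_norm_square[of z] z by simp
  then have zz': "cnj z * z = 1" by (simp add: mult.commute)
  have "covariant \<alpha> \<iota> (\<lambda>i. z *\<^sub>C S i)"
    using covariant_\<iota>[OF ds CP]
    by (simp add: covariant_def star_scaleC mult_scaleC_left mult_scaleC_right scaleC_scaleC zz zz' scaleC_one)
  from cuntz_pimsner_universal[OF CP this] show ?thesis
    by (metis (no_types, lifting) continuous_on_unital_star_hom)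
qed

text \<open>The homomorphism for \<open>cnj z\<close> is the inverse, since both composites fix the
  generators.\<close>

lemma ex1_gauge:
  assumes z: "cmod z = 1"
  shows "\<exists>!g. unital_star_hom g \<and> bij g \<and> (\<forall>a. g (\<iota> a) = \<iota> a) \<and> (\<forall>i. g (S i) = z *\<^sub>C S i)"
proof -
  have zz: "z * cnj z = 1" using complex_norm_square[of z] z by simp
  obtain g where g: "unital_star_hom g" "\<And>a. g (\<iota> a) = \<iota> a" "\<And>i. g (S i) = z *\<^sub>C S i"
    using ex1_gauge_hom[OF z] by blast
  obtain g' where g': "unital_star_hom g'" "\<And>a. g' (\<iota> a) = \<iota> a" "\<And>i. g' (S i) = cnj z *\<^sub>C S i"
    using ex1_gauge_hom[of "cnj z"] z by auto
  have id: "unital_star_hom (\<lambda>x::'b. x)" by (simp add: unital_star_hom_def)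
  have eq_id: "h = (\<lambda>x. x)" if "unital_star_hom h" "\<And>a. h (\<iota> a) = \<iota> a" "\<And>i. h (S i) = S i" for h :: "'b \<Rightarrow> 'b"
    using ex1_gauge_hom[of 1] that id by (auto simp: scaleC_one)
  have "(\<lambda>x. g (g' x)) = (\<lambda>x. x)" "(\<lambda>x. g' (g x)) = (\<lambda>x. x)"
    using g g' zz
    by (auto intro!: eq_id simp: unital_star_hom_def scaleC_scaleC scaleC_one mult.commute)
  then have "bij g" by (intro o_bij[of g' g]) (auto simp: fun_eq_iff)
  with g ex1_gauge_hom[OF z] show ?thesis by blast
qed

abbreviation (input) "flow \<equiv> gauge_flow \<iota> S"

lemma
  shows hom_flow: "unital_star_hom (flow t)"
    and flow_\<iota>: "flow t (\<iota> a) = \<iota> a"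
    and flow_isom: "flow t (S i) = exp (\<i> * of_real t) *\<^sub>C S i"
  using theI'[OF ex1_gauge[of "exp (\<i> * of_real t)"]]
  unfolding gauge_flow_def gauge_def by simp_all

lemmas flow_simps = unital_star_hom_simps[OF hom_flow]

lemma flow_flow: "flow s (flow t x) = flow (s + t) x"
proof -
  let ?z = "exp (\<i> * of_real (s + t))"
  let ?P = "\<lambda>g. unital_star_hom g \<and> (\<forall>a. g (\<iota> a) = \<iota> a) \<and> (\<forall>i. g (S i) = ?z *\<^sub>C S i)"
  have ex1: "\<exists>!g. ?P g" by (rule ex1_gauge_hom) simp
  have "?P (\<lambda>x. flow s (flow t x))"
    by (simp add: unital_star_hom_def flow_\<iota> flow_simps flow_isom scaleC_scaleC ring_distribs exp_add mult.commute)
  moreover have "?P (flow (s + t))" by (simp add: hom_flow flow_\<iota> flow_isom)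
  ultimately have "(\<lambda>x. flow s (flow t x)) = flow (s + t)"
    using the1_equality[OF ex1] by (metis (no_types, lifting))
  then show ?thesis by metis
qed

lemma flow_periodic: "flow (t + 2 * pi) = flow t"
proof -
  have "exp (\<i> * of_real (t + 2 * pi)) = exp (\<i> * of_real t)"
    using exp_plus_2pin[of "\<i> * of_real t" 1] by (simp add: algebra_simps)
  then show ?thesis unfolding gauge_flow_def by (rule arg_cong)
qed

lemma norm_flow_le: "norm (flow t x) \<le> norm x"
  by (rule unital_star_hom_contractive[OF hom_flow])

lemma flow_monomial:
  "flow t (monomial \<iota> S \<mu> a \<nu>) =
    exp (\<i> * (of_nat (length \<mu>) - of_nat (length \<nu>)) * of_real t) *\<^sub>C monomial \<iota> S \<mu> a \<nu>"
proof -
  have w: "flow t (prod_list (map S \<mu>)) = exp (\<i> * of_nat (length \<mu>) * of_real t) *\<^sub>C prod_list (map S \<mu>)" for \<mu>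
    by (induction \<mu>)
       (simp_all add: flow_simps flow_isom scaleC_one mult_scaleC_left mult_scaleC_right scaleC_scaleC
         exp_add[symmetric] algebra_simps)
  show ?thesis
    by (simp add: monomial_def flow_simps w flow_\<iota> star_scaleC mult_scaleC_left mult_scaleC_right
        scaleC_scaleC exp_cnj exp_add[symmetric] algebra_simps)
qed

lemma entire_extension_monomial:
  "entire_extension flow (monomial \<iota> S \<mu> a \<nu>)
    (\<lambda>w. exp (\<i> * (of_nat (length \<mu>) - of_nat (length \<nu>)) * w) *\<^sub>C monomial \<iota> S \<mu> a \<nu>)"
  by (simp add: entire_extension_def entire_exp flow_monomial)

lemma entire_extension_scaleC_add:
  assumes "entire_extension flow x f" "entire_extension flow y g"
  shows "entire_extension flow (c *\<^sub>C x + y) (\<lambda>w. c *\<^sub>C f w + g w)"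
proof -
  have "entire (\<lambda>w. c *\<^sub>C f w)"
    unfolding entire_def
  proof
    fix z
    obtain D where "((\<lambda>h. inverse h *\<^sub>C (f (z + h) - f z)) \<longlongrightarrow> D) (at 0)"
      using assms unfolding entire_extension_def entire_def by blast
    then have "((\<lambda>h. c *\<^sub>C inverse h *\<^sub>C (f (z + h) - f z)) \<longlongrightarrow> c *\<^sub>C D) (at 0)"
      by (rule continuous_on_tendsto_compose[OF continuous_on_scaleC[of UNIV]]) auto
    then show "\<exists>D. ((\<lambda>h. inverse h *\<^sub>C (c *\<^sub>C f (z + h) - c *\<^sub>C f z)) \<longlongrightarrow> D) (at 0)"
      by (auto simp: scaleC_scaleC mult.commute simp flip: scaleC_diff_right)
  qed
  with assms show ?thesis by (simp add: entire_extension_def entire_add flow_simps)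
qed

lemma vacuum_state_mult_monomial:
  assumes "\<phi> \<in> vacuum_states S" "\<nu> \<noteq> []"
  shows "\<phi> (x * monomial \<iota> S \<mu> a \<nu>) = 0"
proof -
  have pf: "positive_functional \<phi>" and v: "\<phi> (S i * y) = 0" for i y
    using assms by (auto simp: vacuum_states_def states_iff)
  obtain j \<nu>' where "\<nu> = j # \<nu>'" using assms by (cases \<nu>) auto
  then have "\<phi> (star (x * monomial \<iota> S \<mu> a \<nu>)) = 0"
    by (simp add: monomial_def star_mult star_star mult.assoc v)
  then show ?thesis by (simp add: pf_star[OF pf])
qed

section \<open>Ground states\<close>

lemma ground_states_eq: "ground_states \<iota> S = vacuum_states S"
proof (rule set_eqI, rule iffI)
  fix \<psi> assume \<psi>: "\<psi> \<in> ground_states \<iota> S"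
  then have st: "\<psi> \<in> states" and pf: "positive_functional \<psi>" by (auto simp: ground_states_def states_iff)
  have *: "\<psi> (S i * y) = 0" if "y \<in> monomial_span \<iota> S" for i y
  proof -
    let ?m = "monomial \<iota> S [] 1 [i]"
    have m: "?m = star (S i)" using hom_\<iota>[OF ds CP] by (simp add: monomial_def unital_star_hom_def)
    have y: "star y \<in> monomial_span \<iota> S"
      using that by (auto simp: monomial_span_eq[OF ds CP] simp flip: free_eval_star)
    have "bounded ((\<lambda>z. \<psi> (star y * complex_flow flow z ?m)) ` {z. Im z > 0})"
      using \<psi> y monomial_in_span[OF ds CP] by (auto simp: ground_states_def)
    then obtain B where B: "\<And>z. Im z > 0 \<Longrightarrow> cmod (\<psi> (star y * complex_flow flow z ?m)) \<le> B"
      by (auto simp: bounded_iff)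
    \<comment> \<open>The adjoint of S_i has degree -1, so going up the imaginary axis to height t
      multiplies the value by exp t.\<close>
    have "\<psi> (star y * complex_flow flow z ?m) = exp (- \<i> * z) * \<psi> (star y * ?m)" for z
      using functional_complex_flow[OF bounded_clinear_state[OF st, of "star y" 1] entire_extension_monomial, of z "[]" 1 "[i]"]
      by (simp add: mult_scaleC_right pf_scaleC[OF pf])
    then have le: "exp t * cmod (\<psi> (star y * ?m)) \<le> B" if "t > 0" for t
      using B[of "\<i> * of_real t"] that by (simp add: norm_mult)
    have "\<psi> (star y * ?m) = 0"
    proof (rule ccontr)
      assume "\<psi> (star y * ?m) \<noteq> 0"
      then have c: "cmod (\<psi> (star y * ?m)) > 0" by simp
      \<comment> \<open>Chosen so that exp t \<ge> 1 + t already pushes the left side of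
        \<open>le\<close> past B.\<close>
      define t where "t = (\<bar>B\<bar> + 1) / cmod (\<psi> (star y * ?m))"
      have "t > 0" using c by (simp add: t_def divide_pos_pos add_nonneg_pos)
      with le[of t] have "(1 + t) * cmod (\<psi> (star y * ?m)) \<le> B"
        using exp_ge_add_one_self[of t] c by (smt (verit) mult_right_mono)
      moreover have "t * cmod (\<psi> (star y * ?m)) = \<bar>B\<bar> + 1" using c by (simp add: t_def)
      ultimately show False using c abs_ge_self[of B] unfolding distrib_right by linarith
    qed
    then show ?thesis
      using pf_star[OF pf, of "S i * y"] by (simp add: m star_mult)
  qed
  have "\<psi> (S i * y) = 0" for i y
  proof (rule closed_density_induct[OF ds CP, where P = "\<lambda>y. \<psi> (S i * y) = 0"])
    show "closed {y. \<psi> (S i * y) = 0}"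
      by (intro closed_Collect_eq continuous_on_compose2[OF continuous_on_state[OF ds CP st] _ subset_UNIV] continuous_intros)
  qed (rule *)
  with st show "\<psi> \<in> vacuum_states S" by (simp add: vacuum_states_def)
next
  fix \<phi> assume \<phi>: "\<phi> \<in> vacuum_states S"
  then have st: "\<phi> \<in> states" and pf: "positive_functional \<phi>" by (auto simp: vacuum_states_def states_iff)
  have "bounded ((\<lambda>z. \<phi> (x * complex_flow flow z y)) ` {z. Im z > 0})"
    if "y \<in> monomial_span \<iota> S" for x y
  proof -
    \<comment> \<open>The induction carries an explicit extension with its bound, since additivity
      of \<open>complex_flow\<close> is not visible from its definition.\<close>
    from that have "\<exists>f. entire_extension flow y f \<and> (\<exists>B. \<forall>z. Im z > 0 \<longrightarrow> cmod (\<phi> (x * f z)) \<le> B)"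
    proof (induction rule: monomial_span_induct[OF ds CP, consumes 1, case_names zero step])
      case zero
      have "entire_extension flow 0 (\<lambda>w. 0)"
        using entire_exp[of 0 "0::'b"] by (simp add: entire_extension_def flow_simps)
      then show ?case using pf_zero[OF pf] by (intro exI[of _ "\<lambda>w. 0"]) auto
    next
      case (step c \<mu> a \<nu> y)
      let ?k = "of_nat (length \<mu>) - of_nat (length \<nu>) :: complex" and ?m = "monomial \<iota> S \<mu> a \<nu>"
      from step obtain f B where f: "entire_extension flow y f"
        and B: "\<And>z. Im z > 0 \<Longrightarrow> cmod (\<phi> (x * f z)) \<le> B" by blast
      let ?g = "\<lambda>w. c *\<^sub>C exp (\<i> * ?k * w) *\<^sub>C ?m + f w"
      have "cmod (\<phi> (x * ?g z)) \<le> cmod c * cmod (\<phi> (x * ?m)) + B" if "Im z > 0" for z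
      proof -
        \<comment> \<open>With \<nu> empty the degree is nonnegative and the exponential has modulus
          at most one on the upper half-plane; otherwise the vacuum state removes the term, however
          fast the exponential grows.\<close>
        have "cmod (exp (\<i> * ?k * z)) * cmod (\<phi> (x * ?m)) \<le> cmod (\<phi> (x * ?m))"
        proof (cases "\<nu> = []")
          case True
          then have "cmod (exp (\<i> * ?k * z)) \<le> 1" using that by simp
          then show ?thesis by (simp add: mult_left_le_one_le)
        next
          case False
          then show ?thesis using vacuum_state_mult_monomial[OF \<phi> False] by simp
        qed
        then have "cmod (c * exp (\<i> * ?k * z) * \<phi> (x * ?m)) \<le> cmod c * cmod (\<phi> (x * ?m))"
          by (simp only: norm_mult mult.assoc mult_left_mono norm_ge_zero)
        moreover have "\<phi> (x * ?g z) = c * exp (\<i> * ?k * z) * \<phi> (x * ?m) + \<phi> (x * f z)"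
          by (simp only: distrib_left mult_scaleC_right pf_add[OF pf] pf_scaleC[OF pf] mult.assoc)
        ultimately show ?thesis using norm_triangle_mono[OF _ B[OF that]] by simp
      qed
      then show ?case
        using entire_extension_scaleC_add[OF entire_extension_monomial f] by (intro exI[of _ ?g]) blast
    qed
    then obtain f B where f: "entire_extension flow y f" and "\<And>z. Im z > 0 \<Longrightarrow> cmod (\<phi> (x * f z)) \<le> B"
      by blast
    then show ?thesis
      using functional_complex_flow[OF bounded_clinear_state[OF st, of x 1] f]
      by (auto simp: bounded_iff)
  qed
  with st show "\<phi> \<in> ground_states \<iota> S" by (simp add: ground_states_def)
qed

end

section \<open>KMS states from tracial vacuum states\<close>

text \<open>\<open>isom_moment S \<phi> k x\<close> is the sum of \<open>\<phi> (S\<^sub>w\<^sup>* x S\<^sub>w)\<close> over the words \<open>w\<close> of length \<open>k\<close>.\<close>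

primrec isom_moment :: "('n::finite \<Rightarrow> 'b::cstar_algebra) \<Rightarrow> ('b \<Rightarrow> complex) \<Rightarrow> nat \<Rightarrow> 'b \<Rightarrow> complex" where
  "isom_moment S \<phi> 0 x = \<phi> x"
| "isom_moment S \<phi> (Suc k) x = (\<Sum>i\<in>UNIV. isom_moment S \<phi> k (star (S i) * x * S i))"

text \<open>Here r stands for exp(-\<beta>). There are \<open>CARD('n) ^ k\<close> words of length
  k, so the total weight is a geometric series and the prefactor is its reciprocal.\<close>

definition gibbs_state :: "('n::finite \<Rightarrow> 'b::cstar_algebra) \<Rightarrow> ('b \<Rightarrow> complex) \<Rightarrow> real \<Rightarrow> 'b \<Rightarrow> complex" where
  "gibbs_state S \<phi> r x =
     of_real (1 - real CARD('n) * r) * suminf (\<lambda>k. of_real (r ^ k) * isom_moment S \<phi> k x)"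

lemma positive_functional_sum:
  "(\<And>i. i \<in> I \<Longrightarrow> positive_functional (L i)) \<Longrightarrow> positive_functional (\<lambda>x. \<Sum>i\<in>I. L i x)"
proof (induction I rule: infinite_finite_induct)
  case (insert i I)
  then have "positive_functional (L i)" "positive_functional (\<lambda>x. \<Sum>i\<in>I. L i x)" by auto
  then have "positive_functional (\<lambda>x. L i x + (\<Sum>i\<in>I. L i x))"
    unfolding positive_functional_def by (simp add: distrib_left nonneg_Reals_add_I)
  with insert show ?case by simp
qed (simp_all add: positive_functional_def)

context
  fixes \<alpha> :: "'n::finite \<Rightarrow> 'a::cstar_algebra \<Rightarrow> 'a" and \<iota> :: "'a \<Rightarrow> 'b::cstar_algebra" and S :: "'n \<Rightarrow> 'b"
    and \<phi> :: "'b \<Rightarrow> complex"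
  assumes ds: "cstar_dynamical_system \<alpha>" and CP: "cuntz_pimsner \<alpha> \<iota> S"
    and vac: "\<phi> \<in> vacuum_states S" and trace: "\<And>a b. \<phi> (\<iota> (a * b)) = \<phi> (\<iota> (b * a))"
begin

lemma vacuum_state_\<phi>: "\<phi> \<in> states" "positive_functional \<phi>" "\<phi> (S i * y) = 0" "\<phi> 1 = 1"
  using vac by (auto simp: vacuum_states_def states_iff)

lemmas rels = isom_relations[OF ds CP] isom_cancel[OF ds CP] \<iota>_simps[OF ds CP]

section \<open>Moments of a vacuum state that is tracial on A\<close>

lemma positive_functional_moment: "positive_functional (isom_moment S \<phi> k)"
proof (induction k)
  case (Suc k)
  then have "positive_functional (\<lambda>x. \<Sum>i\<in>UNIV. isom_moment S \<phi> k (star (S i) * x * S i))"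
    by (intro positive_functional_sum positive_functional_compress)
  then show ?case by (simp add: fun_eq_iff[of "isom_moment S \<phi> (Suc k)", THEN iffD2])
qed (simp add: vacuum_state_\<phi> fun_eq_iff[of "isom_moment S \<phi> 0" \<phi>, THEN iffD2])

lemma moment_one: "isom_moment S \<phi> k 1 = of_nat (CARD('n) ^ k)"
  by (induction k) (simp_all add: vacuum_state_\<phi> rels)

lemma moment_norm_le: "cmod (isom_moment S \<phi> k x) \<le> real CARD('n) ^ k * norm x"
  using pf_norm_le[OF positive_functional_moment, of k x] by (simp add: moment_one)

text \<open>Only compression by S_i itself survives on S_i y, which consumes one letter; this shift
  of k becomes the factor r in \<open>gibbs_state_isom\<close>.\<close>

lemma moment_isom: "isom_moment S \<phi> (Suc k) (S i * y) = isom_moment S \<phi> k (y * S i)"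
proof -
  have "star (S j) * (S i * y) * S j = (if j = i then y * S i else 0)" for j
    by (simp add: rels)
  then have "isom_moment S \<phi> (Suc k) (S i * y) =
      (\<Sum>j\<in>UNIV. if j = i then isom_moment S \<phi> k (y * S i) else 0)"
    by (simp only: isom_moment.simps if_distrib[of "isom_moment S \<phi> k"] pf_zero[OF positive_functional_moment])
  also have "\<dots> = isom_moment S \<phi> k (y * S i)" by simp
  finally show ?thesis .
qed

lemma monomial_mult_\<iota>: "monomial \<iota> S \<mu> c \<nu> * \<iota> a = monomial \<iota> S \<mu> (c * fold \<alpha> \<nu> a) \<nu>"
proof -
  have h: "unital_star_hom (fold \<alpha> \<nu>)" by (rule unital_star_hom_fold[OF ds])
  have "star (\<iota> (star a) * prod_list (map S \<nu>)) = star (prod_list (map S \<nu>) * \<iota> (fold \<alpha> \<nu> (star a)))"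
    by (simp only: \<iota>_mult_isom_word[OF ds CP])
  then have "star (prod_list (map S \<nu>)) * \<iota> a = \<iota> (fold \<alpha> \<nu> a) * star (prod_list (map S \<nu>))"
    by (simp add: star_mult rels star_star unital_star_hom_simps[OF h])
  then show ?thesis by (simp add: monomial_def rels mult.assoc)
qed

text \<open>A coefficient on either side leaves both words of a monomial unchanged. So both values
  are zero unless the words are empty, where the trace property on A applies.\<close>

lemma vacuum_state_centralizes: "\<phi> (\<iota> a * y) = \<phi> (y * \<iota> a)"
proof (rule eq_of_eq_on_monomials[OF ds CP, where L = "\<lambda>y. \<phi> (\<iota> a * y)" and M = "\<lambda>y. \<phi> (y * \<iota> a)"])
  note pf = vacuum_state_\<phi>(2)
  show "continuous_on UNIV (\<lambda>y. \<phi> (\<iota> a * y))" "continuous_on UNIV (\<lambda>y. \<phi> (y * \<iota> a))"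
    by (intro continuous_on_compose2[OF continuous_on_state[OF ds CP vacuum_state_\<phi>(1)] _ subset_UNIV]
        continuous_intros)+
  show "\<phi> (\<iota> a * (x + y)) = \<phi> (\<iota> a * x) + \<phi> (\<iota> a * y)" "\<phi> ((x + y) * \<iota> a) = \<phi> (x * \<iota> a) + \<phi> (y * \<iota> a)"
    "\<phi> (\<iota> a * (c *\<^sub>C x)) = c * \<phi> (\<iota> a * x)" "\<phi> (c *\<^sub>C x * \<iota> a) = c * \<phi> (x * \<iota> a)" for x y c
    by (simp_all add: algebra_simps pf_add[OF pf] mult_scaleC_left mult_scaleC_right pf_scaleC[OF pf])
  fix \<mu> b \<nu>
  have l: "\<iota> a * monomial \<iota> S \<mu> b \<nu> = monomial \<iota> S \<mu> (fold \<alpha> \<mu> a * b) \<nu>"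
    using \<iota>_mult_isom_word[OF ds CP, of a \<mu>] by (simp add: monomial_def rels flip: mult.assoc)
  have "is_phi \<iota> S (\<lambda>a. \<phi> (\<iota> a)) \<phi>" using vac by (simp add: is_phi_iff[OF ds CP])
  then have m: "\<phi> (monomial \<iota> S \<mu> c \<nu>) = (if \<mu> = [] \<and> \<nu> = [] then \<phi> (\<iota> c) else 0)" for \<mu> c \<nu>
    by (simp add: is_phi_def)
  show "\<phi> (\<iota> a * monomial \<iota> S \<mu> b \<nu>) = \<phi> (monomial \<iota> S \<mu> b \<nu> * \<iota> a)"
    by (simp add: l monomial_mult_\<iota> m trace[of a b])
qed

text \<open>Compression by S_i replaces a by \<alpha>_i(a) on either side, hence the induction keeps
  a arbitrary.\<close>

lemma moment_centralizes: "isom_moment S \<phi> k (\<iota> a * y) = isom_moment S \<phi> k (y * \<iota> a)"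
proof (induction k arbitrary: a y)
  case (Suc k)
  have "isom_moment S \<phi> k (star (S i) * (\<iota> a * y) * S i) = isom_moment S \<phi> k (star (S i) * (y * \<iota> a) * S i)" for i
  proof -
    have "star (S i) * (\<iota> a * y) * S i = \<iota> (\<alpha> i a) * (star (S i) * y * S i)"
      using rels(3)[of i a] by (simp flip: mult.assoc)
    moreover have "star (S i) * (y * \<iota> a) * S i = (star (S i) * y * S i) * \<iota> (\<alpha> i a)"
      using rels(2)[of a i] by (simp add: mult.assoc)
    ultimately show ?thesis using Suc[of "\<alpha> i a" "star (S i) * y * S i"] by simp
  qed
  then show ?case by simp
qed (simp add: vacuum_state_centralizes)

context
  fixes r :: real
  assumes r: "0 < r" "real CARD('n) * r < 1"
begin

section \<open>Gibbs averages\<close>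

lemma summable_dr: "summable (\<lambda>k. (real CARD('n) * r) ^ k)"
  using r by (intro summable_geometric) simp

lemma moment_term_le: "cmod (of_real (r ^ k) * isom_moment S \<phi> k x) \<le> (real CARD('n) * r) ^ k * norm x"
  using mult_left_mono[OF moment_norm_le[of k x], of "r ^ k"] r
  by (simp add: norm_mult norm_power power_mult_distrib mult.commute mult.left_commute)

lemma summable_moment: "summable (\<lambda>k. of_real (r ^ k) * isom_moment S \<phi> k x)"
  by (rule summable_comparison_test'[where N = 0, OF _ moment_term_le]) (intro summable_mult2 summable_dr)

lemma gibbs_state_in_states: "gibbs_state S \<phi> r \<in> states"
proof -
  note pf = positive_functional_moment
  have "gibbs_state S \<phi> r (x + y) = gibbs_state S \<phi> r x + gibbs_state S \<phi> r y" for x y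
    using suminf_add[OF summable_moment[of x] summable_moment[of y]]
    by (simp add: gibbs_state_def pf_add[OF pf] flip: distrib_left)
  moreover have "gibbs_state S \<phi> r (c *\<^sub>C x) = c * gibbs_state S \<phi> r x" for c x
    using suminf_mult[OF summable_moment[of x], of c]
    by (simp add: gibbs_state_def pf_scaleC[OF pf] mult.left_commute)
  moreover have "gibbs_state S \<phi> r (star x * x) \<in> \<real>\<^sub>\<ge>\<^sub>0" for x
  proof -
    have "of_real (r ^ k) * isom_moment S \<phi> k (star x * x) \<in> \<real>\<^sub>\<ge>\<^sub>0" for k
      by (rule nonneg_Reals_mult_I) (use r pf_square[OF pf] in auto)
    then have "(\<Sum>k<n. of_real (r ^ k) * isom_moment S \<phi> k (star x * x)) \<in> \<real>\<^sub>\<ge>\<^sub>0" for n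
      by (induction n) (auto intro: nonneg_Reals_add_I)
    then have "suminf (\<lambda>k. of_real (r ^ k) * isom_moment S \<phi> k (star x * x)) \<in> \<real>\<^sub>\<ge>\<^sub>0"
      using summable_LIMSEQ[OF summable_moment[of "star x * x"]]
      by (intro Lim_in_closed_set[OF closed_nonneg_Reals_complex]) (auto intro: always_eventually)
    moreover have "complex_of_real (1 - real CARD('n) * r) \<in> \<real>\<^sub>\<ge>\<^sub>0"
      using r by (simp only: nonneg_Reals_of_real_iff)
    ultimately show ?thesis
      unfolding gibbs_state_def by (intro nonneg_Reals_mult_I)
  qed
  moreover have "gibbs_state S \<phi> r 1 = 1"
  proof -
    have "suminf (\<lambda>k. of_real (r ^ k) * isom_moment S \<phi> k 1) = suminf (\<lambda>k. (of_real (real CARD('n) * r) :: complex) ^ k)"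
      by (simp add: moment_one power_mult_distrib mult.commute)
    also have "\<dots> = 1 / (1 - of_real (real CARD('n) * r))"
      by (rule suminf_geometric) (use r in \<open>simp add: norm_mult\<close>)
    finally show ?thesis
      using r unfolding gibbs_state_def
      by (simp del: of_real_mult add: of_real_diff[symmetric, of 1, simplified])
  qed
  ultimately show ?thesis by (simp add: states_def)
qed

lemma gibbs_state_isom: "gibbs_state S \<phi> r (S i * y) = of_real r * gibbs_state S \<phi> r (y * S i)"
proof -
  let ?t = "\<lambda>x k. of_real (r ^ k) * isom_moment S \<phi> k x"
  \<comment> \<open>The term of index 0 is \<phi>(S_i y) = 0, so the sum may start at 1 and be
    shifted.\<close>
  have "suminf (?t (S i * y)) = suminf (\<lambda>k. ?t (S i * y) (Suc k))"
    using suminf_split_head[OF summable_moment[of "S i * y"]] by (simp add: vacuum_state_\<phi>)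
  also have "\<dots> = suminf (\<lambda>k. of_real r * ?t (y * S i) k)"
    by (simp only: moment_isom power_Suc of_real_mult mult.assoc)
  also have "\<dots> = of_real r * suminf (?t (y * S i))"
    by (rule suminf_mult[OF summable_moment])
  finally show ?thesis by (simp add: gibbs_state_def)
qed

lemma gibbs_state_\<iota>: "gibbs_state S \<phi> r (\<iota> a * y) = gibbs_state S \<phi> r (y * \<iota> a)"
  by (simp add: gibbs_state_def moment_centralizes)

lemma positive_functional_gibbs: "positive_functional (gibbs_state S \<phi> r)"
  using gibbs_state_in_states by (simp add: states_iff)

lemma gibbs_state_isom_word:
  "gibbs_state S \<phi> r (prod_list (map S \<mu>) * y) =
    of_real (r ^ length \<mu>) * gibbs_state S \<phi> r (y * prod_list (map S \<mu>))"
  by (induction \<mu> arbitrary: y) (simp_all add: mult.assoc gibbs_state_isom flip: power_Suc)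

lemma gibbs_state_star_isom_word:
  "of_real (r ^ length \<nu>) * gibbs_state S \<phi> r (star (prod_list (map S \<nu>)) * y) =
    gibbs_state S \<phi> r (y * star (prod_list (map S \<nu>)))"
  using arg_cong[OF gibbs_state_isom_word[of \<nu> "star y"], of cnj]
  by (simp add: star_mult star_star flip: pf_star[OF positive_functional_gibbs])

text \<open>Rotate the three factors cyclically: the isometries of \<mu> contribute one r per
  letter, the coefficient moves freely, and the adjoints of \<nu> contribute inverse powers, kept on
  the left to avoid division.\<close>

lemma gibbs_state_monomial:
  "of_real (r ^ length \<nu>) * gibbs_state S \<phi> r (monomial \<iota> S \<mu> a \<nu> * y) =
    of_real (r ^ length \<mu>) * gibbs_state S \<phi> r (y * monomial \<iota> S \<mu> a \<nu>)"
proof -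
  let ?m = "prod_list (map S \<mu>)" and ?n = "star (prod_list (map S \<nu>))" and ?g = "gibbs_state S \<phi> r"
  have "?g (monomial \<iota> S \<mu> a \<nu> * y) = of_real (r ^ length \<mu>) * ?g (\<iota> a * (?n * (y * ?m)))"
    by (simp add: monomial_def mult.assoc gibbs_state_isom_word)
  also have "?g (\<iota> a * (?n * (y * ?m))) = ?g (?n * (y * ?m * \<iota> a))"
    by (simp add: gibbs_state_\<iota> mult.assoc)
  finally show ?thesis
    using gibbs_state_star_isom_word[of \<nu> "y * ?m * \<iota> a"]
    by (simp add: monomial_def mult.assoc mult.left_commute)
qed

text \<open>The term of index 0 is \<phi> x itself. The normalisation costs one multiple of
  \<open>real CARD('n) * r\<close> and the geometric tail another, hence the factor 2.\<close>

lemma gibbs_state_approx: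
  "cmod (gibbs_state S \<phi> r x - \<phi> x) \<le> 2 * (real CARD('n) * r) * norm x"
proof -
  let ?d = "real CARD('n) * r" and ?t = "\<lambda>k. of_real (r ^ k) * isom_moment S \<phi> k x"
  have d: "0 < ?d" "?d < 1" using r by simp_all
  define T where "T = suminf (\<lambda>k. ?t (Suc k))"
  have le: "cmod (?t (Suc k)) \<le> ?d * norm x * ?d ^ k" for k
    using moment_term_le[of "Suc k" x] by (simp only: power_Suc mult.assoc mult.commute mult.left_commute)
  have s: "summable (\<lambda>k. ?d * norm x * ?d ^ k)" by (intro summable_mult summable_dr)
  have "cmod T \<le> suminf (\<lambda>k. ?d * norm x * ?d ^ k)"
    unfolding T_def by (rule norm_suminf_le[OF le s])
  also have "\<dots> = ?d * norm x / (1 - ?d)"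
    using suminf_mult[OF summable_dr, of "?d * norm x"] suminf_geometric[of ?d] d by simp
  finally have T: "(1 - ?d) * cmod T \<le> ?d * norm x" using d by (simp add: field_simps)
  have "suminf ?t = \<phi> x + T"
    using suminf_split_head[OF summable_moment[of x]] by (simp add: T_def)
  then have "gibbs_state S \<phi> r x - \<phi> x = of_real (1 - ?d) * T - of_real ?d * \<phi> x"
    by (simp add: gibbs_state_def algebra_simps)
  then have "cmod (gibbs_state S \<phi> r x - \<phi> x) \<le> cmod (of_real (1 - ?d) * T) + cmod (of_real ?d * \<phi> x)"
    by (simp only: norm_triangle_ineq4)
  also have "\<dots> = (1 - ?d) * cmod T + ?d * cmod (\<phi> x)"
    using d by (simp only: norm_mult norm_of_real)
  also have "\<dots> \<le> ?d * norm x + ?d * norm x"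
    using d by (intro add_mono T mult_left_mono state_norm_le vacuum_state_\<phi>(1)) simp
  finally show ?thesis by (simp only: mult_2 distrib_right)
qed

end

text \<open>The hypothesis says \<beta> > log \<open>CARD('n)\<close>, where the Gibbs sum
  converges. The span of monomials serves as dense subalgebra; extension and KMS identity are built
  together by induction and then transferred to \<open>complex_flow\<close>.\<close>

lemma KMS_state_gibbs:
  assumes \<beta>: "real CARD('n) * exp (- \<beta>) < 1"
  shows "KMS_state (gauge_flow \<iota> S) \<beta> (gibbs_state S \<phi> (exp (- \<beta>)))"
proof -
  let ?r = "exp (- \<beta>)" and ?f = "gauge_flow \<iota> S"
  have r: "0 < ?r" "real CARD('n) * ?r < 1" using \<beta> by simp_all
  note st = gibbs_state_in_states[OF r]
  have pf: "positive_functional (gibbs_state S \<phi> ?r)" using st by (simp add: states_iff)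
  let ?D = "monomial_span \<iota> S"
  have ext: "\<exists>f. entire_extension ?f x f \<and>
      (\<forall>y. gibbs_state S \<phi> ?r (x * y) = gibbs_state S \<phi> ?r (y * f (\<i> * of_real \<beta>)))" if "x \<in> ?D" for x
    using that
  proof (induction rule: monomial_span_induct[OF ds CP, consumes 1, case_names zero step])
    case zero
    have "entire_extension ?f 0 (\<lambda>w. 0)"
      using entire_exp[of 0 "0::'b"] flow_simps[OF ds CP] by (simp add: entire_extension_def)
    then show ?case by (intro exI[of _ "\<lambda>w. 0"]) auto
  next
    case (step c \<mu> a \<nu> x)
    let ?k = "of_nat (length \<mu>) - of_nat (length \<nu>) :: complex" and ?m = "monomial \<iota> S \<mu> a \<nu>"
    from step obtain f where f: "entire_extension ?f x f"
      and KMS: "\<And>y. gibbs_state S \<phi> ?r (x * y) = gibbs_state S \<phi> ?r (y * f (\<i> * of_real \<beta>))" by blast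
    let ?g = "\<lambda>w. c *\<^sub>C exp (\<i> * ?k * w) *\<^sub>C ?m + f w"
    have pow: "of_real (?r ^ n) = exp (- of_nat n * complex_of_real \<beta>)" for n
      by (simp add: exp_of_nat_mult[symmetric] flip: exp_of_real)
    \<comment> \<open>At time \<i>\<beta> a monomial of degree k has eigenvalue exp(-k\<beta>), and
      since k is the difference of the word lengths this is the ratio of powers of r in
      \<open>gibbs_state_monomial\<close>.\<close>
    have "gibbs_state S \<phi> ?r (?m * y) = exp (\<i> * ?k * (\<i> * of_real \<beta>)) * gibbs_state S \<phi> ?r (y * ?m)" for y
    proof -
      have "exp (\<i> * ?k * (\<i> * of_real \<beta>)) = exp (- (?k * of_real \<beta>))"
      proof -
        have "\<i> * ?k * (\<i> * of_real \<beta>) = (\<i> * \<i>) * (?k * of_real \<beta>)" by (simp only: ac_simps)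
        then show ?thesis by simp
      qed
      also have "\<dots> = of_real (?r ^ length \<mu>) / of_real (?r ^ length \<nu>)"
      proof -
        have "- (?k * of_real \<beta>) = - of_nat (length \<mu>) * of_real \<beta> - - of_nat (length \<nu>) * of_real \<beta>"
          by (simp add: left_diff_distrib)
        then show ?thesis unfolding pow by (simp only: exp_diff)
      qed
      finally have e: "exp (\<i> * ?k * (\<i> * of_real \<beta>)) = of_real (?r ^ length \<mu>) / of_real (?r ^ length \<nu>)" .
      have "complex_of_real (?r ^ length \<nu>) \<noteq> 0" by simp
      then show ?thesis
        unfolding e using gibbs_state_monomial[OF r, of \<nu> \<mu> a y] by (simp add: field_simps del: of_real_power)
    qed
    then have "gibbs_state S \<phi> ?r ((c *\<^sub>C ?m + x) * y) = gibbs_state S \<phi> ?r (y * ?g (\<i> * of_real \<beta>))" for y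
      by (simp only: distrib_left distrib_right mult_scaleC_left mult_scaleC_right pf_add[OF pf] pf_scaleC[OF pf] KMS)
    then show ?case
      using entire_extension_scaleC_add[OF ds CP entire_extension_monomial[OF ds CP] f] by (intro exI[of _ ?g]) blast
  qed
  have "gibbs_state S \<phi> ?r (x * y) = gibbs_state S \<phi> ?r (y * complex_flow ?f (\<i> * of_real \<beta>) x)" if x: "x \<in> ?D" for x y
  proof -
    obtain f where f: "entire_extension ?f x f"
      and "gibbs_state S \<phi> ?r (x * y) = gibbs_state S \<phi> ?r (y * f (\<i> * of_real \<beta>))"
      using ext[OF x] by blast
    then show ?thesis
      using functional_complex_flow[OF bounded_clinear_state[OF st, of y 1] f] by simp
  qed
  moreover have "star_subalgebra ?D"
    unfolding star_subalgebra_def monomial_span_eq[OF ds CP]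
    by (intro conjI ballI allI range_free_eval_add[OF ds CP] range_free_eval_mult[OF ds CP]
        range_free_eval_star[OF ds CP] range_free_eval_scale[OF ds CP] range_free_eval_gen(4)[OF ds CP])
  moreover have "?D \<subseteq> analytic_elements ?f"
    using ext by (auto simp: analytic_elements_def)
  moreover have "?f t x \<in> ?D" if "x \<in> ?D" for t x
    using that
  proof (induction rule: monomial_span_induct[OF ds CP, consumes 1, case_names zero step])
    case zero
    show ?case using module.span_zero[OF module_scaleC] by (simp add: flow_simps[OF ds CP] monomial_span_def)
  next
    case (step c \<mu> a \<nu> y)
    then show ?case
      using monomial_in_span[OF ds CP, of \<mu> a \<nu>]
      by (simp add: flow_simps[OF ds CP] flow_monomial[OF ds CP] monomial_span_def
          module.span_add[OF module_scaleC] module.span_scale[OF module_scaleC])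
  qed
  ultimately show ?thesis
    unfolding KMS_state_def using st closure_monomial_span[OF ds CP]
    by (intro conjI exI[of _ ?D]) auto
qed

end

section \<open>KMS states on homogeneous elements\<close>

text \<open>The integral of a \<open>2\<pi>\<close>-periodic entire function over a horizontal period does not depend on its
  height: the increment of a primitive over a period has derivative zero.\<close>

lemma periodic_entire_integral_shift:
  assumes hol: "f holomorphic_on UNIV" and per: "\<And>z. f (z + of_real p) = f z" and p: "0 \<le> p"
  obtains J where "\<And>b. ((\<lambda>t. f (of_real t + b)) has_integral J) {0..p}"
proof -
  obtain P where P: "\<And>z. (P has_field_derivative f z) (at z)"
    using holomorphic_convex_primitive'[OF convex_UNIV open_UNIV hol] by auto
  have "((\<lambda>z. P (z + of_real p) - P z) has_field_derivative 0) (at z)" for z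
    using DERIV_diff[OF _ P[of z], of "\<lambda>z. P (z + of_real p)" "f z"] P[of "z + of_real p"]
    by (simp add: DERIV_shift per)
  then obtain J where J: "\<And>z. P (z + of_real p) - P z = J"
    using has_field_derivative_zero_constant[OF convex_UNIV, of "\<lambda>z. P (z + of_real p) - P z"] by auto
  have "((\<lambda>t. f (of_real t + b)) has_integral J) {0..p}" for b
  proof -
    have "((\<lambda>t. P (of_real t + b)) has_vector_derivative f (of_real t + b)) (at t within {0..p})" for t
    proof -
      have "((\<lambda>z. P (z + b)) has_field_derivative f (of_real t + b)) (at (of_real t))"
        using P[of "of_real t + b"] by (simp add: DERIV_shift)
      from has_vector_derivative_real_field[OF this] show ?thesis .
    qed
    from fundamental_theorem_of_calculus[OF p this]
    show ?thesis using J[of b] by (simp add: add.commute)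
  qed
  then show thesis by (rule that)
qed

context
  fixes \<alpha> :: "'n::finite \<Rightarrow> 'a::cstar_algebra \<Rightarrow> 'a" and \<iota> :: "'a \<Rightarrow> 'b::cstar_algebra" and S :: "'n \<Rightarrow> 'b"
  assumes ds: "cstar_dynamical_system \<alpha>" and CP: "cuntz_pimsner \<alpha> \<iota> S"
begin

text \<open>The KMS condition is only given on some dense subalgebra \<open>D\<close> that need not contain \<open>x\<close>; passing to
  the \<open>n\<close>-th Fourier coefficient of the flow turns it into an identity that is continuous in \<open>x\<close>.\<close>

lemma KMS_state_homogeneous:
  assumes KMS: "KMS_state (gauge_flow \<iota> S) \<beta> \<eta>"
    and x: "\<And>t. gauge_flow \<iota> S t x = exp (\<i> * of_nat n * of_real t) *\<^sub>C x"
  shows "\<eta> (x * y) = exp (- (of_nat n * of_real \<beta>)) * \<eta> (y * x)"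
proof -
  let ?f = "gauge_flow \<iota> S"
  have st: "\<eta> \<in> states" and pf: "positive_functional \<eta>"
    using KMS by (auto simp: KMS_state_def states_iff)
  obtain D where D: "closure D = UNIV" "D \<subseteq> analytic_elements ?f" "\<forall>t. ?f t ` D \<subseteq> D"
    and KMS_D: "\<forall>x\<in>D. \<forall>y\<in>D. \<eta> (x * y) = \<eta> (y * complex_flow ?f (\<i> * of_real \<beta>) x)"
    using KMS unfolding KMS_state_def by (elim conjE exE) (rule that)
  have flow_D: "?f t x \<in> D" if "x \<in> D" for t x using D(3) that by blast
  have cont: "continuous_on UNIV (\<lambda>y. \<eta> (x * y * x'))" for x x'
    by (intro continuous_on_compose2[OF continuous_on_state[OF ds CP st] _ subset_UNIV] continuous_intros)
  \<comment> \<open>Continuity frees y from D, but x must remain there to be analytic.\<close>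
  have KMS': "\<eta> (x * y) = \<eta> (y * complex_flow ?f (\<i> * of_real \<beta>) x)" if "x \<in> D" for x y
  proof -
    have "closed {y. \<eta> (x * y) = \<eta> (y * complex_flow ?f (\<i> * of_real \<beta>) x)}"
      using cont[of x 1] cont[of 1 "complex_flow ?f (\<i> * of_real \<beta>) x"] by (intro closed_Collect_eq) simp_all
    then have "closure D \<subseteq> {y. \<eta> (x * y) = \<eta> (y * complex_flow ?f (\<i> * of_real \<beta>) x)}"
      using KMS_D that by (intro closure_minimal) auto
    then show ?thesis using D by auto
  qed
  have key: "\<exists>J. ((\<lambda>t. exp (- \<i> * of_nat n * of_real t) * \<eta> (y * ?f t x)) has_integral J) {0..2 * pi} \<and>
      ((\<lambda>t. exp (- \<i> * of_nat n * of_real t) * \<eta> (?f t x * y)) has_integral exp (- (of_nat n * of_real \<beta>)) * J) {0..2 * pi}"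
    if x: "x \<in> D" for x
  proof -
    let ?G = "\<lambda>z. \<eta> (y * complex_flow ?f z x)"
    have hol: "(\<lambda>z. \<eta> (y * complex_flow ?f z x)) holomorphic_on UNIV" if "x \<in> D" for x
      using holomorphic_functional_entire[OF bounded_clinear_state[OF st, of y 1]]
        entire_extension_complex_flow[of x ?f] D(2) that
      by (auto simp: entire_extension_def)
    have real: "complex_flow ?f (of_real t) x = ?f t x" if "x \<in> D" for t x
      using entire_extension_complex_flow[of x ?f] D(2) that by (auto simp: entire_extension_def)
    \<comment> \<open>For real z this is \<open>flow_flow\<close>; the identity theorem carries it
      to complex z.\<close>
    have shift: "\<eta> (y * complex_flow ?f z (?f t x)) = ?G (z + of_real t)" for z t
    proof (rule holomorphic_eq_of_eq_on_reals[where f = "\<lambda>z. \<eta> (y * complex_flow ?f z (?f t x))"])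
      show "(\<lambda>z. ?G (z + of_real t)) holomorphic_on UNIV"
      proof -
        have "(\<lambda>z. z + of_real t) holomorphic_on UNIV" by (intro holomorphic_intros)
        from holomorphic_on_compose[OF this holomorphic_on_subset[OF hol[OF x] subset_UNIV]]
        show ?thesis by (simp add: o_def)
      qed
      show "\<eta> (y * complex_flow ?f (of_real s) (?f t x)) = ?G (of_real s + of_real t)" for s
        using real[OF x, of "s + t"] by (simp add: real flow_D[OF x] flow_flow[OF ds CP])
    qed (rule hol[OF flow_D[OF x]])
    have per: "?G (z + of_real (2 * pi)) = ?G z" for z
    proof -
      have "?f (2 * pi) x = ?f 0 x" using flow_periodic[OF ds CP, of 0] by simp
      then show ?thesis using shift[of z "2 * pi"] shift[of z 0] by simp
    qed
    \<comment> \<open>The weight isolates the n-th Fourier coefficient and, n being an integer,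
      keeps the period 2\<pi>.\<close>
    let ?H = "\<lambda>z. exp (- \<i> * of_nat n * z) * ?G z"
    have "exp (- \<i> * of_nat n * of_real (2 * pi)) = exp (of_nat n * (- (2 * of_real pi * \<i>)))"
      by (rule arg_cong[of _ _ exp]) simp
    also have "\<dots> = 1"
      unfolding exp_of_nat_mult by (simp add: exp_minus exp_two_pi_i)
    finally have "exp (- \<i> * of_nat n * of_real (2 * pi)) = 1" .
    then have "?H (z + of_real (2 * pi)) = ?H z" for z
      by (simp only: per ring_distribs exp_add) simp
    moreover have "?H holomorphic_on UNIV" by (intro holomorphic_intros hol[OF x])
    ultimately obtain J where J: "\<And>b. ((\<lambda>t. ?H (of_real t + b)) has_integral J) {0..2 * pi}"
      using periodic_entire_integral_shift[of ?H "2 * pi"] by auto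
    have "?H (of_real t + 0) = exp (- \<i> * of_nat n * of_real t) * \<eta> (y * ?f t x)" for t
      by (simp add: real[OF x])
    \<comment> \<open>At height \<beta> the KMS identity swaps the factors and the weight
      contributes exp(n\<beta>); height 0 has the same integral.\<close>
    moreover have "?H (of_real t + \<i> * of_real \<beta>) =
        exp (of_nat n * of_real \<beta>) * (exp (- \<i> * of_nat n * of_real t) * \<eta> (?f t x * y))" for t
    proof -
      have "?G (of_real t + \<i> * of_real \<beta>) = \<eta> (?f t x * y)"
        using KMS'[OF flow_D[OF x], of t y] shift[of "\<i> * of_real \<beta>" t] by (simp add: add.commute)
      moreover have "exp (- \<i> * of_nat n * (of_real t + \<i> * of_real \<beta>)) =
          exp (of_nat n * of_real \<beta>) * exp (- \<i> * of_nat n * of_real t)"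
        unfolding exp_add[symmetric] by (simp add: algebra_simps)
      ultimately show ?thesis by simp
    qed
    ultimately have "((\<lambda>t. exp (- \<i> * of_nat n * of_real t) * \<eta> (y * ?f t x)) has_integral J) {0..2 * pi}"
      and "((\<lambda>t. exp (of_nat n * of_real \<beta>) * (exp (- \<i> * of_nat n * of_real t) * \<eta> (?f t x * y))) has_integral J) {0..2 * pi}"
      using J[of 0] J[of "\<i> * of_real \<beta>"] by simp_all
    from this(1) has_integral_mult_right[OF this(2), of "exp (- (of_nat n * of_real \<beta>))"]
    show ?thesis by (auto simp: exp_minus simp flip: mult.assoc)
  qed
  \<comment> \<open>On x itself the integrand is constant, so its coefficient is 2\<pi> times the
    value. The factors u and v cover both orders; contractivity of the flow and of \<eta> controls
    the replacement of x by x'.\<close>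
  have est: "cmod (J - 2 * pi * \<eta> (u * x * v)) \<le> norm u * norm v * e * (2 * pi)"
    if J: "((\<lambda>t. exp (- \<i> * of_nat n * of_real t) * \<eta> (u * ?f t x' * v)) has_integral J) {0..2 * pi}"
      and e: "norm (x' - x) \<le> e" for J u v x' e
  proof -
    let ?e = "\<lambda>t. exp (- \<i> * of_nat n * of_real t)"
    have c: "?e t * \<eta> (u * ?f t x * v) = \<eta> (u * x * v)" for t
      by (simp add: x mult_scaleC_left mult_scaleC_right pf_scaleC[OF pf] exp_minus)
    have "((\<lambda>t. \<eta> (u * x * v)) has_integral (2 * pi) *\<^sub>R \<eta> (u * x * v)) {0..2 * pi}"
      using has_integral_const_real[of "\<eta> (u * x * v)" 0 "2 * pi"] by simp
    from has_integral_diff[OF J this]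
    have int: "((\<lambda>t. ?e t * \<eta> (u * ?f t x' * v) - \<eta> (u * x * v)) has_integral J - 2 * pi * \<eta> (u * x * v)) {0..2 * pi}"
      by (simp add: scaleR_conv_of_real)
    have "cmod (?e t * \<eta> (u * ?f t x' * v) - \<eta> (u * x * v)) \<le> norm u * norm v * e" for t
    proof -
      have "?e t * \<eta> (u * ?f t x' * v) - \<eta> (u * x * v) = ?e t * \<eta> (u * ?f t (x' - x) * v)"
        by (simp only: flow_simps[OF ds CP] right_diff_distrib left_diff_distrib pf_diff[OF pf] c)
      also have "cmod \<dots> = cmod (\<eta> (u * ?f t (x' - x) * v))" by (simp add: norm_mult)
      also have "\<dots> \<le> norm (u * ?f t (x' - x) * v)" by (rule state_norm_le[OF st])
      also have "\<dots> \<le> norm u * norm (?f t (x' - x)) * norm v"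
        using norm_mult_ineq[of "u * ?f t (x' - x)" v]
          mult_right_mono[OF norm_mult_ineq[of u "?f t (x' - x)"] norm_ge_zero[of v]] by linarith
      also have "\<dots> \<le> norm u * e * norm v"
        using norm_flow_le[OF ds CP, of t "x' - x"] e by (intro mult_left_mono mult_right_mono) auto
      finally show ?thesis by (simp add: mult.commute mult.left_commute)
    qed
    moreover have "0 \<le> norm u * norm v * e" using order_trans[OF norm_ge_zero e] by simp
    ultimately show ?thesis
      using has_integral_bound_real[OF _ finite.emptyI int, of "norm u * norm v * e"] by simp
  qed
  let ?q = "exp (- (of_nat n * complex_of_real \<beta>))"
  define M where "M = 2 * pi * norm y * (1 + cmod ?q)"
  have "cmod (2 * pi * (\<eta> (x * y) - ?q * \<eta> (y * x))) \<le> M * e" if e: "e > 0" for e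
  proof -
    obtain x' where x': "x' \<in> D" "dist x' x < e"
      using D(1) e closure_approachable[of x D] by auto
    then have e': "norm (x' - x) \<le> e" by (simp add: dist_norm)
    obtain J where J: "((\<lambda>t. exp (- \<i> * of_nat n * of_real t) * \<eta> (y * ?f t x')) has_integral J) {0..2 * pi}"
      "((\<lambda>t. exp (- \<i> * of_nat n * of_real t) * \<eta> (?f t x' * y)) has_integral ?q * J) {0..2 * pi}"
      using key[OF x'(1)] by blast
    have a: "cmod (J - 2 * pi * \<eta> (y * x)) \<le> norm y * e * (2 * pi)"
      using est[of y x' 1 J e] J(1) e' by simp
    have b: "cmod (?q * J - 2 * pi * \<eta> (x * y)) \<le> norm y * e * (2 * pi)"
      using est[of 1 x' y "?q * J" e] J(2) e' by simp
    have "2 * pi * (\<eta> (x * y) - ?q * \<eta> (y * x)) =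
        ?q * (J - 2 * pi * \<eta> (y * x)) - (?q * J - 2 * pi * \<eta> (x * y))"
      by (simp add: algebra_simps)
    also have "cmod \<dots> \<le> cmod ?q * cmod (J - 2 * pi * \<eta> (y * x)) + cmod (?q * J - 2 * pi * \<eta> (x * y))"
      using norm_triangle_ineq4 by (simp only: norm_mult[symmetric])
    also have "\<dots> \<le> cmod ?q * (norm y * e * (2 * pi)) + norm y * e * (2 * pi)"
      by (intro add_mono mult_left_mono a b norm_ge_zero)
    finally show ?thesis by (simp only: M_def) (simp add: algebra_simps)
  qed
  note le = this
  have "M \<ge> 0" by (simp add: M_def)
  have "cmod (2 * pi * (\<eta> (x * y) - ?q * \<eta> (y * x))) \<le> 0"
  proof (rule field_le_epsilon)
    fix e :: real assume e: "e > 0"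
    \<comment> \<open>M may be zero, hence the division by M + 1.\<close>
    have "M * (e / (M + 1)) \<le> e" using \<open>M \<ge> 0\<close> e by (simp add: field_simps)
    then show "cmod (2 * pi * (\<eta> (x * y) - ?q * \<eta> (y * x))) \<le> 0 + e"
      using le[of "e / (M + 1)"] \<open>M \<ge> 0\<close> e by simp
  qed
  then show ?thesis by simp
qed

lemma KMS_state_isom:
  "KMS_state (gauge_flow \<iota> S) \<beta> \<eta> \<Longrightarrow> \<eta> (S i * y) = exp (- of_real \<beta>) * \<eta> (y * S i)"
  using KMS_state_homogeneous[of \<beta> \<eta> "S i" 1 y] by (simp add: flow_isom[OF ds CP])

lemma KMS_state_\<iota>:
  "KMS_state (gauge_flow \<iota> S) \<beta> \<eta> \<Longrightarrow> \<eta> (\<iota> a * y) = \<eta> (y * \<iota> a)"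
  using KMS_state_homogeneous[of \<beta> \<eta> "\<iota> a" 0 y] by (simp add: flow_\<iota>[OF ds CP] scaleC_one)

end

section \<open>Compactness and the homeomorphisms\<close>

lemma weak_star_eq_euclidean: "weak_star = (euclidean :: ('b \<Rightarrow> complex) topology)"
  by (simp add: weak_star_def euclidean_product_topology)

text \<open>Banach-Alaoglu: states lie in a product of closed discs of radius norm x, compact by
  Tychonoff, and their defining conditions are pointwise closed.\<close>

lemma compact_states: "compact (states :: ('b::cstar_algebra \<Rightarrow> complex) set)"
proof -
  have "compactin (product_topology (\<lambda>_. euclidean) UNIV) (PiE UNIV (\<lambda>x::'b. cball (0::complex) (norm x)))"
    by (simp add: compactin_PiE)
  then have "compact (PiE UNIV (\<lambda>x::'b. cball (0::complex) (norm x)))"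
    by (simp add: euclidean_product_topology)
  moreover have "closed (states :: ('b \<Rightarrow> complex) set)"
  proof -
    have "closed ((\<lambda>\<phi>. \<phi> (star x * x)) -` \<real>\<^sub>\<ge>\<^sub>0 :: ('b \<Rightarrow> complex) set)" for x
      by (rule closed_vimage) (simp_all add: closed_nonneg_Reals_complex)
    then show ?thesis
      unfolding states_def
      by (intro closed_Collect_conj closed_Collect_all closed_Collect_eq continuous_intros
          continuous_on_product_coordinates) (simp_all add: vimage_def)
  qed
  ultimately have "compact (PiE UNIV (\<lambda>x::'b. cball (0::complex) (norm x)) \<inter> states)"
    by (rule compact_Int_closed)
  moreover have "PiE UNIV (\<lambda>x::'b. cball (0::complex) (norm x)) \<inter> states = states"
    using state_norm_le by (auto simp: PiE_iff)
  ultimately show ?thesis by simp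
qed

lemma mix_in_states:
  assumes "\<phi> \<in> states" "\<psi> \<in> states" "s \<in> {0..1}"
  shows "mix s \<phi> \<psi> \<in> states"
proof -
  have "of_real s * \<phi> (star x * x) + of_real (1 - s) * \<psi> (star x * x) \<in> \<real>\<^sub>\<ge>\<^sub>0" for x
  proof -
    have "complex_of_real s \<in> \<real>\<^sub>\<ge>\<^sub>0" "complex_of_real (1 - s) \<in> \<real>\<^sub>\<ge>\<^sub>0"
      using assms by (simp_all only: nonneg_Reals_of_real_iff) simp_all
    then show ?thesis
      using assms by (intro nonneg_Reals_add_I nonneg_Reals_mult_I) (auto simp: states_def)
  qed
  then show ?thesis
    using assms by (simp add: states_def mix_def algebra_simps)
qed

lemma compact_convex_states: "compact_convex (states :: ('b::cstar_algebra \<Rightarrow> complex) set)"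
  by (simp add: compact_convex_def weak_star_eq_euclidean compact_states mix_in_states)

text \<open>Equations between point evaluations are pointwise closed and stable under
  \<open>mix\<close>; each set of states in the theorem is cut out by such equations.\<close>

lemma compact_convex_Collect_eq:
  fixes X :: "('b \<Rightarrow> complex) set"
  assumes "compact_convex X"
  shows "compact_convex {\<phi> \<in> X. \<forall>k\<in>K. \<phi> (f k) = \<phi> (g k)}"
proof -
  have "closed (\<Inter>k\<in>K. {\<phi> :: 'b \<Rightarrow> complex. \<phi> (f k) = \<phi> (g k)})"
    by (intro closed_INT ballI closed_Collect_eq continuous_on_product_coordinates)
  with assms have "compact (X \<inter> (\<Inter>k\<in>K. {\<phi>. \<phi> (f k) = \<phi> (g k)}))"
    by (intro compact_Int_closed) (simp_all add: compact_convex_def weak_star_eq_euclidean)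
  also have "X \<inter> (\<Inter>k\<in>K. {\<phi>. \<phi> (f k) = \<phi> (g k)}) = {\<phi> \<in> X. \<forall>k\<in>K. \<phi> (f k) = \<phi> (g k)}"
    by auto
  finally show ?thesis
    using assms by (simp add: compact_convex_def weak_star_eq_euclidean mix_def)
qed

lemma state_zero: "\<phi> \<in> states \<Longrightarrow> \<phi> 0 = 0"
  by (rule pf_zero) (simp add: states_iff)

lemma compact_convex_vanishing_on:
  assumes X: "compact_convex X" "X \<subseteq> (states :: ('b::cstar_algebra \<Rightarrow> complex) set)"
  shows "compact_convex (vanishing_on J X)"
proof -
  \<comment> \<open>Vanishing is written as equality with the value at 0, to become an equation
    between evaluations.\<close>
  have "vanishing_on J X = {\<phi> \<in> X. \<forall>a\<in>J. \<phi> a = \<phi> 0}"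
    using X(2) state_zero unfolding vanishing_on_def by fastforce
  then show ?thesis using compact_convex_Collect_eq[OF X(1), of J "\<lambda>a. a" "\<lambda>_. 0"] by simp
qed

lemma compact_convex_tracial_states:
  "compact_convex (tracial_states :: ('b::cstar_algebra \<Rightarrow> complex) set)"
  using compact_convex_Collect_eq[OF compact_convex_states, of UNIV "\<lambda>(x, y). x * y" "\<lambda>(x, y). y * x"]
  by (simp add: tracial_states_def)

context
  fixes \<alpha> :: "'n::finite \<Rightarrow> 'a::cstar_algebra \<Rightarrow> 'a" and \<iota> :: "'a \<Rightarrow> 'b::cstar_algebra" and S :: "'n \<Rightarrow> 'b"
  assumes ds: "cstar_dynamical_system \<alpha>" and CP: "cuntz_pimsner \<alpha> \<iota> S"
begin

section \<open>Limits of KMS states\<close>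

lemma KMS_infinity_states_eq:
  "KMS_infinity_states (gauge_flow \<iota> S) = {\<phi> \<in> vacuum_states S. \<forall>a b. \<phi> (\<iota> (a * b)) = \<phi> (\<iota> (b * a))}"
proof (rule set_eqI, rule iffI)
  fix \<psi> assume "\<psi> \<in> KMS_infinity_states (gauge_flow \<iota> S)"
  then obtain F :: "(real \<times> ('b \<Rightarrow> complex)) filter" where st: "\<psi> \<in> states" and F: "F \<noteq> bot"
    and top: "filterlim fst at_top F"
    and KMS: "eventually (\<lambda>(\<beta>, \<eta>). KMS_state (gauge_flow \<iota> S) \<beta> \<eta>) F"
    and lim: "limitin weak_star snd \<psi> F"
    unfolding KMS_infinity_states_def mem_Collect_eq by (elim conjE exE) (rule that)
  have lim': "((\<lambda>p. snd p x) \<longlongrightarrow> \<psi> x) F" for x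
    using lim by (simp add: weak_star_def limitin_componentwise)
  have "\<psi> (S i * y) = 0" for i y
  proof (rule tendsto_unique[OF F lim'])
    \<comment> \<open>The exponential factor tends to zero while the states stay bounded by the norm
      of y S_i uniformly in \<beta>.\<close>
    have "((\<lambda>p. exp (- fst p) * norm (y * S i)) \<longlongrightarrow> 0 * norm (y * S i)) F"
      using filterlim_compose[OF exp_at_bot filterlim_compose[OF filterlim_uminus_at_bot_at_top top]]
      by (intro tendsto_mult tendsto_const)
    moreover have "\<forall>\<^sub>F p in F. cmod (snd p (S i * y)) \<le> exp (- fst p) * norm (y * S i)"
      using KMS
    proof eventually_elim
      case (elim p)
      obtain \<beta> \<eta> where p: "p = (\<beta>, \<eta>)" by (cases p)
      with elim have K: "KMS_state (gauge_flow \<iota> S) \<beta> \<eta>" by simp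
      then have "cmod (\<eta> (y * S i)) \<le> norm (y * S i)"
        by (intro state_norm_le) (simp add: KMS_state_def)
      then show ?case by (simp add: p KMS_state_isom[OF ds CP K] norm_mult)
    qed
    ultimately show "((\<lambda>p. snd p (S i * y)) \<longlongrightarrow> 0) F"
      unfolding mult_zero_left by (rule Lim_null_comparison[rotated])
  qed
  moreover have "\<psi> (\<iota> (a * b)) = \<psi> (\<iota> (b * a))" for a b
  proof (rule tendsto_unique[OF F lim'])
    \<comment> \<open>Elements of A are fixed by the flow, so the KMS relation there is a trace
      identity for each approximating state.\<close>
    have "\<forall>\<^sub>F p in F. snd p (\<iota> (b * a)) = snd p (\<iota> (a * b))"
      using KMS
    proof eventually_elim
      case (elim p)
      obtain \<beta> \<eta> where "p = (\<beta>, \<eta>)" by (cases p)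
      with elim show ?case
        using KMS_state_\<iota>[OF ds CP, of \<beta> \<eta> b "\<iota> a"] by (simp only: \<iota>_simps(3)[OF ds CP] prod.case snd_conv)
    qed
    then show "((\<lambda>p. snd p (\<iota> (a * b))) \<longlongrightarrow> \<psi> (\<iota> (b * a))) F"
      using lim'[of "\<iota> (b * a)"] by (rule Lim_transform_eventually[rotated])
  qed
  ultimately show "\<psi> \<in> {\<phi> \<in> vacuum_states S. \<forall>a b. \<phi> (\<iota> (a * b)) = \<phi> (\<iota> (b * a))}"
    using st by (simp add: vacuum_states_def)
next
  fix \<phi> assume "\<phi> \<in> {\<phi> \<in> vacuum_states S. \<forall>a b. \<phi> (\<iota> (a * b)) = \<phi> (\<iota> (b * a))}"
  then have vac: "\<phi> \<in> vacuum_states S" and tr: "\<And>a b. \<phi> (\<iota> (a * b)) = \<phi> (\<iota> (b * a))" by auto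
  let ?g = "\<lambda>\<beta>. gibbs_state S \<phi> (exp (- \<beta>))"
  \<comment> \<open>The net is indexed by \<beta> itself; for small \<beta> its members need not be
    states, which a filter at infinity ignores.\<close>
  define F where "F = filtermap (\<lambda>\<beta>. (\<beta>, ?g \<beta>)) (at_top :: real filter)"
  have exp0: "((\<lambda>\<beta>::real. exp (- \<beta>)) \<longlongrightarrow> 0) at_top"
    by (rule filterlim_compose[OF exp_at_bot filterlim_uminus_at_bot_at_top])
  then have "((\<lambda>\<beta>. real CARD('n) * exp (- \<beta>)) \<longlongrightarrow> real CARD('n) * 0) at_top"
    by (intro tendsto_mult tendsto_const)
  then have ev: "\<forall>\<^sub>F \<beta> in at_top. real CARD('n) * exp (- \<beta>) < 1"
    by (rule order_tendstoD(2)) simp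
  have "F \<noteq> bot" by (simp add: F_def filtermap_bot_iff)
  moreover have "filterlim fst at_top F"
    by (simp add: F_def filterlim_filtermap filterlim_ident)
  moreover have "eventually (\<lambda>(\<beta>, \<eta>). KMS_state (gauge_flow \<iota> S) \<beta> \<eta>) F"
    unfolding F_def eventually_filtermap
    using ev by eventually_elim (simp only: prod.case, rule KMS_state_gibbs[OF ds CP vac tr])
  moreover have "limitin weak_star snd \<phi> F"
  proof -
    have "((\<lambda>\<beta>. ?g \<beta> x) \<longlongrightarrow> \<phi> x) at_top" for x
    proof (rule LIM_zero_cancel, rule Lim_null_comparison)
      show "\<forall>\<^sub>F \<beta> in at_top. cmod (?g \<beta> x - \<phi> x) \<le> 2 * (real CARD('n) * exp (- \<beta>)) * norm x"
        using ev by eventually_elim (rule gibbs_state_approx[OF ds CP vac tr], auto)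
      have "((\<lambda>\<beta>. 2 * (real CARD('n) * exp (- \<beta>)) * norm x) \<longlongrightarrow> 2 * (real CARD('n) * 0) * norm x) at_top"
        by (intro tendsto_mult tendsto_const exp0)
      then show "((\<lambda>\<beta>. 2 * (real CARD('n) * exp (- \<beta>)) * norm x) \<longlongrightarrow> 0) at_top" by simp
    qed
    then show ?thesis
      by (simp add: weak_star_def limitin_componentwise F_def filterlim_filtermap)
  qed
  moreover have "\<phi> \<in> states" using vac by (simp add: vacuum_states_def)
  ultimately show "\<phi> \<in> KMS_infinity_states (gauge_flow \<iota> S)"
    unfolding KMS_infinity_states_def mem_Collect_eq by (intro conjI exI[of _ F])
qed

lemma compact_convex_vacuum_states: "compact_convex (vacuum_states S)"
proof -
  have "vacuum_states S = {\<phi> \<in> states. \<forall>k\<in>UNIV. \<phi> ((\<lambda>(i, y). S i * y) k) = \<phi> 0}"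
    using state_zero unfolding vacuum_states_def by fastforce
  then show ?thesis
    using compact_convex_Collect_eq[OF compact_convex_states, of UNIV "\<lambda>(i, y). S i * y" "\<lambda>_. 0"] by simp
qed

lemma compact_convex_KMS_infinity_states: "compact_convex (KMS_infinity_states (gauge_flow \<iota> S))"
  using compact_convex_Collect_eq[OF compact_convex_vacuum_states, of UNIV
      "\<lambda>(a, b). \<iota> (a * b)" "\<lambda>(a, b). \<iota> (b * a)"]
  by (simp add: KMS_infinity_states_eq)

text \<open>The inverse of \<open>phi\<close> is restriction to the coefficients, which is clearly continuous; by
  compactness it is a homeomorphism.\<close>

lemma affine_weak_star_homeomorphism_phi:
  assumes X: "X \<subseteq> vanishing_on (J_ideal \<alpha>) states" and Y: "Y \<subseteq> vacuum_states S" "compact_convex Y"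
    and iff: "\<And>\<phi>. \<phi> \<in> vacuum_states S \<Longrightarrow> \<phi> \<in> Y \<longleftrightarrow> (\<lambda>a. \<phi> (\<iota> a)) \<in> X"
  shows "affine_weak_star_homeomorphism X Y (phi \<iota> S)"
proof -
  let ?R = "\<lambda>\<phi> a. \<phi> (\<iota> a)"
  have phi: "phi \<iota> S \<tau> \<in> vacuum_states S" "?R (phi \<iota> S \<tau>) = \<tau>" if "\<tau> \<in> X" for \<tau>
    using is_phi_phi[OF ds CP, of \<tau>] that X by (auto simp: is_phi_iff[OF ds CP])
  have phiY: "phi \<iota> S \<tau> \<in> Y" if "\<tau> \<in> X" for \<tau>
    using iff[OF phi(1)[OF that]] phi(2)[OF that] that by simp
  have RX: "?R \<phi> \<in> X" "phi \<iota> S (?R \<phi>) = \<phi>" if "\<phi> \<in> Y" for \<phi>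
    using that iff Y phi_restrict[OF ds CP] by auto
  have hom: "homeomorphic_map (subtopology weak_star Y) (subtopology weak_star X) ?R"
  proof (rule continuous_imp_homeomorphic_map)
    have "continuous_on Y ?R"
      by (intro continuous_on_coordinatewise_then_product
          continuous_on_subset[OF continuous_on_product_coordinates]) simp
    then show "continuous_map (subtopology weak_star Y) (subtopology weak_star X) ?R"
      using RX by (auto simp: weak_star_eq_euclidean continuous_map_in_subtopology)
    show "compact_space (subtopology weak_star Y)"
      using Y by (simp add: compact_convex_def compact_space_subtopology)
    show "Hausdorff_space (subtopology weak_star X)"
      by (simp add: weak_star_def Hausdorff_space_subtopology Hausdorff_space_product_topology)
    show "?R ` topspace (subtopology weak_star Y) = topspace (subtopology weak_star X)"
      using RX phiY phi(2) by (auto simp: weak_star_eq_euclidean image_iff) metis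
    show "inj_on ?R (topspace (subtopology weak_star Y))"
      using RX(2) by (auto simp: weak_star_eq_euclidean intro: inj_on_inverseI)
  qed
  \<comment> \<open>The inverse is so far known only abstractly; it equals \<open>phi\<close> on X
    because \<open>phi\<close> undoes restriction on Y.\<close>
  then obtain g where g: "homeomorphic_maps (subtopology weak_star Y) (subtopology weak_star X) ?R g"
    by (auto simp: homeomorphic_map_maps)
  then have gX: "homeomorphic_map (subtopology weak_star X) (subtopology weak_star Y) g"
    by (simp add: homeomorphic_maps_map)
  have inv: "g \<tau> \<in> Y" "?R (g \<tau>) = \<tau>" if "\<tau> \<in> X" for \<tau>
    using homeomorphic_imp_surjective_map[OF gX] g that
    by (auto simp: homeomorphic_maps_map weak_star_eq_euclidean)
  have "g \<tau> = phi \<iota> S \<tau>" if "\<tau> \<in> X" for \<tau>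
    using RX(2)[OF inv(1)[OF that]] inv(2)[OF that] by simp
  then have "homeomorphic_map (subtopology weak_star X) (subtopology weak_star Y) (phi \<iota> S)"
    by (intro homeomorphic_map_eq[OF gX]) (simp add: weak_star_eq_euclidean)
  moreover have "phi \<iota> S (mix s \<sigma> \<tau>) = mix s (phi \<iota> S \<sigma>) (phi \<iota> S \<tau>)"
    if "\<sigma> \<in> X" "\<tau> \<in> X" "s \<in> {0..1}" for \<sigma> \<tau> s
  proof -
    \<comment> \<open>A vacuum state is determined by its restriction, and restriction is visibly
      affine.\<close>
    have "mix s (phi \<iota> S \<sigma>) (phi \<iota> S \<tau>) \<in> vacuum_states S"
      using compact_convex_vacuum_states phi(1) that by (auto simp: compact_convex_def)
    moreover have "?R (mix s (phi \<iota> S \<sigma>) (phi \<iota> S \<tau>)) = mix s \<sigma> \<tau>"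
      using phi(2)[OF that(1)] phi(2)[OF that(2)] by (simp add: mix_def fun_eq_iff)
    ultimately show ?thesis using phi_restrict[OF ds CP] by metis
  qed
  ultimately show ?thesis by (simp add: affine_weak_star_homeomorphism_def)
qed

end

theorem corollary3p8:
  fixes \<alpha> :: "'n::finite \<Rightarrow> 'a::cstar_algebra \<Rightarrow> 'a"
    and \<iota> :: "'a \<Rightarrow> 'b::cstar_algebra"
    and S :: "'n \<Rightarrow> 'b"
  assumes "cstar_dynamical_system \<alpha>"
    and "cuntz_pimsner \<alpha> \<iota> S"
  shows "(\<forall>\<tau> \<in> vanishing_on (J_ideal \<alpha>) states. \<exists>!\<phi>. is_phi \<iota> S \<tau> \<phi>) \<and>
    compact_convex (vanishing_on (J_ideal \<alpha>) states) \<and>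
    compact_convex (ground_states \<iota> S) \<and>
    affine_weak_star_homeomorphism
      (vanishing_on (J_ideal \<alpha>) states) (ground_states \<iota> S) (phi \<iota> S) \<and>
    compact_convex (vanishing_on (J_ideal \<alpha>) tracial_states) \<and>
    compact_convex (KMS_infinity_states (gauge_flow \<iota> S)) \<and>
    affine_weak_star_homeomorphism
      (vanishing_on (J_ideal \<alpha>) tracial_states) (KMS_infinity_states (gauge_flow \<iota> S)) (phi \<iota> S)"
proof (intro conjI ballI)
  show "\<exists>!\<phi>. is_phi \<iota> S \<tau> \<phi>" if "\<tau> \<in> vanishing_on (J_ideal \<alpha>) states" for \<tau>
    using is_phi_exists[OF assms that] is_phi_unique[OF assms] by blast
  show "compact_convex (ground_states \<iota> S)"
    unfolding ground_states_eq[OF assms] by (rule compact_convex_vacuum_states[OF assms])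
  then show "affine_weak_star_homeomorphism
      (vanishing_on (J_ideal \<alpha>) states) (ground_states \<iota> S) (phi \<iota> S)"
    using vacuum_state_restrict[OF assms]
    by (intro affine_weak_star_homeomorphism_phi[OF assms]) (auto simp: ground_states_eq[OF assms])
  show "compact_convex (KMS_infinity_states (gauge_flow \<iota> S))"
    by (rule compact_convex_KMS_infinity_states[OF assms])
  \<comment> \<open>A vacuum state automatically vanishes on J, so membership on both sides reduces
    to traciality of the restriction to A.\<close>
  then show "affine_weak_star_homeomorphism
      (vanishing_on (J_ideal \<alpha>) tracial_states) (KMS_infinity_states (gauge_flow \<iota> S)) (phi \<iota> S)"
    using vacuum_state_restrict[OF assms]
    by (intro affine_weak_star_homeomorphism_phi[OF assms])
       (auto simp: KMS_infinity_states_eq[OF assms] vanishing_on_def tracial_states_def)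
  show "compact_convex (vanishing_on (J_ideal \<alpha>) states)"
    by (intro compact_convex_vanishing_on compact_convex_states subset_refl)
  show "compact_convex (vanishing_on (J_ideal \<alpha>) tracial_states)"
    by (intro compact_convex_vanishing_on compact_convex_tracial_states) (auto simp: tracial_states_def)
qed

end
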